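(* Let $\eta=\epsilon_a-\epsilon_b$ ($1\le a<b\le m$) be a positive root of $\mathfrak g=\mathfrak{gl}(m)$, and let $\Theta_\eta=\sum_{J\in\mathbb I}f_JH_J\in U(\mathfrak b^-)$ be the element defined in the context. Then for every integer $p\ge1$, $\Theta_\eta^p$ is the Šapovalov element for the pair $(\eta,p)$; in other words, for every $\lambda\in\mathfrak h^*$ with $(\lambda+\rho,\eta)=p$, $$\Theta_\eta^p(\lambda)=\theta_{\eta,p}(\lambda),$$ where $\theta_{\eta,p}$ is a Šapovalov element for $(\eta,p)$.
   Context: Ground field $\mathbb C$. $e_{i,j}$ are the matrix units of $\mathfrak{gl}(m)$; $\mathfrak h$ is the diagonal subalgebra, $\epsilon_i(e_{j,j})=\delta_{ij}$, $(\epsilon_i,\epsilon_j)=\delta_{ij}$; $h_\alpha\in\mathfrak h$ satisfies $\beta(h_\alpha)=(\alpha,\beta)$ for all $\beta\in\mathfrak h^*$. $\Delta^+=\{\epsilon_i-\epsilon_j:i<j\}$, $\Pi$ the simple roots $\epsilon_i-\epsilon_{i+1}$; $\mathfrak n^\pm$ strictly upper/lower triangular matrices, $\mathfrak b^-=\mathfrak h\oplus\mathfrak n^-$; $\rho$ is the half-sum of positive roots. Definition of $\Theta_\eta$ for $\eta=\epsilon_a-\epsilon_b$: $\mathbb I=\{I\subseteq\{a,a+1,\dots,b\}:a,b\in I\}$. For $I=\{i_0>i_1>\dots>i_{s+1}\}$ (so $i_0=b$, $i_{s+1}=a$), $f_I=e_{i_0,i_1}e_{i_1,i_2}\cdots e_{i_s,i_{s+1}}$.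 For $a\le k\le b-2$, $h_k=h_{\sigma}+(\rho,\sigma)-1$ with $\sigma=\epsilon_a-\epsilon_{k+1}$. For $I\in\mathbb I$, $H_I=\prod_{x\in\{a,\dots,b\}\setminus I}h_{x-1}$ (empty product $=1$). Šapovalov element for $(\eta,p)$: an element $\theta\in U(\mathfrak b^-)$ of weight $-p\eta$ of the form $\theta=\sum_\pi e_{-\pi}H_\pi$, $H_\pi\in U(\mathfrak h)$, where $\pi$ runs over functions $\Delta^+\to\mathbb Z_{\ge0}$ with $\sum\pi(\alpha)\alpha=p\eta$, $e_{-\pi}$ is the product of the $e_{-\alpha}^{\pi(\alpha)}$ in a fixed order on $\Delta^+$, with $H_{\pi^0}=1$ for the unique $\pi^0$ vanishing off $\Pi$, and $e_\alpha\theta\in U(\mathfrak g)(h_\eta+\rho(h_\eta)-p(\eta,\eta)/2)+U(\mathfrak g)\mathfrak n^+$ for all $\alpha\in\Delta^+$. Evaluation: writing $u\in U(\mathfrak b^-)=U(\mathfrak n^-)\otimes U(\mathfrak h)$ as $\sum_i u_iH_i$ with $u_i\in U(\mathfrak n^-)$, $H_i\in U(\mathfrak h)=S(\mathfrak h)$, put $u(\lambda)=\sum_iu_iH_i(\lambda)\in U(\mathfrak n^-)$. On the hyperplane $(\lambda+\rho,\eta)=p$, $\theta_{\eta,p}(\lambda)$ does not depend on the choice of $\theta_{\eta,p}$. *)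

theory Defs
  imports "HOL-Analysis.Analysis" "HOL-Library.Poly_Mapping"
begin

section \<open>The universal enveloping algebra of \<open>gl(m)\<close>\<close>

type_synonym 'm gl = "((complex, 'm) vec, 'm) vec"

text \<open>
  The indices \<open>1, \<dots>, m\<close> are the elements of an arbitrary finite linearly ordered
  type \<open>'m\<close>, so that \<open>m = CARD('m)\<close> and \<open>gl(m)\<close> is \<^typ>\<open>'m gl\<close> with the commutator
  as bracket.  The tensor algebra is realised as the free unital algebra on the set of all
  matrices (finitely supported functions on words, with concatenation product); the linearity
  of the inclusion of the Lie algebra is part of the relations that are divided out.
\<close>

datatype 'a fword = FWord "'a list"

instantiation fword :: (type) monoid_add
begin

definition zero_fword_def: "0 = FWord []"

fun plus_fword :: "'a fword \<Rightarrow> 'a fword \<Rightarrow> 'a fword" where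
  "FWord u + FWord v = FWord (u @ v)"

instance
proof
  fix a b c :: "'a fword"
  show "a + b + c = a + (b + c)" by (cases a; cases b; cases c) simp
  show "0 + a = a" by (cases a) (simp add: zero_fword_def)
  show "a + 0 = a" by (cases a) (simp add: zero_fword_def)
qed

end

lemma fword_add_eq_0_iff: "x + y = (0 :: 'a fword) \<longleftrightarrow> x = 0 \<and> y = 0"
  by (cases x; cases y) (auto simp: zero_fword_def)

definition free_gen :: "'a \<Rightarrow> 'a fword \<Rightarrow>\<^sub>0 complex" where
  "free_gen x = Poly_Mapping.single (FWord [x]) 1"

definition free_scalar :: "complex \<Rightarrow> 'a fword \<Rightarrow>\<^sub>0 complex" where
  "free_scalar c = Poly_Mapping.single 0 c"

definition mat_scale :: "complex \<Rightarrow> 'm gl \<Rightarrow> 'm::finite gl" where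
  "mat_scale c x = map_matrix (\<lambda>z. c * z) x"

definition lie_bracket :: "'m gl \<Rightarrow> 'm gl \<Rightarrow> 'm::finite gl" where
  "lie_bracket x y = x ** y - y ** x"

inductive_set env_ideal :: "('m::finite gl fword \<Rightarrow>\<^sub>0 complex) set" where
  gen_add: "free_gen (x + y) - free_gen x - free_gen y \<in> env_ideal"
| gen_scale: "free_gen (mat_scale c x) - free_scalar c * free_gen x \<in> env_ideal"
| gen_bracket: "free_gen x * free_gen y - free_gen y * free_gen x - free_gen (lie_bracket x y)
    \<in> env_ideal"
| add: "u \<in> env_ideal \<Longrightarrow> v \<in> env_ideal \<Longrightarrow> u + v \<in> env_ideal"
| mult_left: "u \<in> env_ideal \<Longrightarrow> w * u \<in> env_ideal"
| mult_right: "u \<in> env_ideal \<Longrightarrow> u * w \<in> env_ideal"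

lemma env_ideal_0: "0 \<in> env_ideal"
  using env_ideal.mult_left[OF env_ideal.gen_add, of 0] by simp

lemma env_ideal_uminus: "u \<in> env_ideal \<Longrightarrow> - u \<in> env_ideal"
  using env_ideal.mult_left[of u "-1"] by simp

lemma env_ideal_diff: "u \<in> env_ideal \<Longrightarrow> v \<in> env_ideal \<Longrightarrow> u - v \<in> env_ideal"
  using env_ideal.add[of u "- v"] env_ideal_uminus[of v] by simp

text \<open>The augmentation (constant coefficient) shows that the ideal is proper.\<close>

definition aug :: "('a fword \<Rightarrow>\<^sub>0 complex) \<Rightarrow> complex" where
  "aug u = Poly_Mapping.lookup u 0"

lemma aug_mult:
  fixes u v :: "'a fword \<Rightarrow>\<^sub>0 complex"
  shows "aug (u * v) = aug u * aug v"
proof -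
  have inner: "Sum_any (\<lambda>r. Poly_Mapping.lookup v r when 0 = q + r) = (aug v when q = 0)"
    for q :: "'a fword"
  proof -
    have "Sum_any (\<lambda>r. Poly_Mapping.lookup v r when 0 = q + r)
        = Sum_any (\<lambda>r. (aug v when q = 0) when r = (0 :: 'a fword))"
    proof (rule arg_cong[of _ _ Sum_any], rule ext)
      fix r
      show "(Poly_Mapping.lookup v r when 0 = q + r) = ((aug v when q = 0) when r = 0)"
        using fword_add_eq_0_iff[of q r] by (auto simp: aug_def when_def)
    qed
    also have "\<dots> = (aug v when q = 0)"
      by (rule Sum_any_when_equal)
    finally show ?thesis .
  qed
  have "aug (u * v) = Sum_any (\<lambda>q. Poly_Mapping.lookup u q * (aug v when q = 0))"
    by (simp only: aug_def[of "u * v"] lookup_mult inner)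
  also have "\<dots> = Sum_any (\<lambda>q. aug u * aug v when q = (0 :: 'a fword))"
    by (rule arg_cong[of _ _ Sum_any], rule ext) (simp add: when_def aug_def)
  finally show ?thesis by simp
qed

lemma aug_free_gen: "aug (free_gen x) = 0"
  by (simp add: aug_def free_gen_def lookup_single zero_fword_def)

lemma aug_env_ideal: "u \<in> env_ideal \<Longrightarrow> aug u = 0"
proof (induction rule: env_ideal.induct)
  case (add u v)
  then show ?case by (simp add: aug_def lookup_add)
qed (simp_all add: aug_mult aug_free_gen aug_def[of "_ - _"] lookup_minus,
     simp_all add: aug_def[symmetric] aug_mult aug_free_gen)

definition env_rel ::
  "('m::finite gl fword \<Rightarrow>\<^sub>0 complex) \<Rightarrow> ('m gl fword \<Rightarrow>\<^sub>0 complex) \<Rightarrow> bool" where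
  "env_rel u v \<longleftrightarrow> u - v \<in> env_ideal"

lemma equivp_env_rel: "equivp (env_rel :: ('m::finite gl fword \<Rightarrow>\<^sub>0 complex) \<Rightarrow> _)"
proof (rule equivpI)
  show "reflp (env_rel :: ('m gl fword \<Rightarrow>\<^sub>0 complex) \<Rightarrow> _)" by (simp add: reflp_def env_rel_def env_ideal_0)
  show "symp (env_rel :: ('m gl fword \<Rightarrow>\<^sub>0 complex) \<Rightarrow> _)"
    unfolding symp_def env_rel_def by (metis env_ideal_uminus minus_diff_eq)
  show "transp (env_rel :: ('m gl fword \<Rightarrow>\<^sub>0 complex) \<Rightarrow> _)"
  proof (rule transpI)
    fix u v w :: "'m gl fword \<Rightarrow>\<^sub>0 complex"
    assume "env_rel u v" "env_rel v w"
    then have "(u - v) + (v - w) \<in> env_ideal" by (simp only: env_rel_def env_ideal.add)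
    then show "env_rel u w" by (simp add: env_rel_def)
  qed
qed

quotient_type 'm ugl = "'m::finite gl fword \<Rightarrow>\<^sub>0 complex" / env_rel
  by (rule equivp_env_rel)

instantiation ugl :: (finite) ring_1
begin

lift_definition zero_ugl :: "'a ugl" is 0 .
lift_definition one_ugl :: "'a ugl" is 1 .

lift_definition plus_ugl :: "'a ugl \<Rightarrow> 'a ugl \<Rightarrow> 'a ugl" is "(+)"
  unfolding env_rel_def by (simp only: add_diff_add env_ideal.add)

lift_definition minus_ugl :: "'a ugl \<Rightarrow> 'a ugl \<Rightarrow> 'a ugl" is "(-)"
proof -
  fix u u' v v' :: "'a gl fword \<Rightarrow>\<^sub>0 complex"
  assume "env_rel u u'" "env_rel v v'"
  then have "(u - u') - (v - v') \<in> env_ideal"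
    by (simp add: env_rel_def env_ideal_diff)
  then show "env_rel (u - v) (u' - v')" by (simp add: env_rel_def algebra_simps)
qed

lift_definition uminus_ugl :: "'a ugl \<Rightarrow> 'a ugl" is uminus
  unfolding env_rel_def using env_ideal_uminus by fastforce

lift_definition times_ugl :: "'a ugl \<Rightarrow> 'a ugl \<Rightarrow> 'a ugl" is "(*)"
proof -
  fix u u' v v' :: "'a gl fword \<Rightarrow>\<^sub>0 complex"
  assume "env_rel u u'" "env_rel v v'"
  then have "(u - u') * v + u' * (v - v') \<in> env_ideal"
    unfolding env_rel_def by (intro env_ideal.add env_ideal.mult_left env_ideal.mult_right)
  then show "env_rel (u * v) (u' * v')" by (simp add: env_rel_def algebra_simps)
qed

instance
proof
  fix a b c :: "'a ugl"
  show "a * b * c = a * (b * c)" by transfer (simp add: env_rel_def env_ideal_0 mult.assoc)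
  show "1 * a = a" by transfer (simp add: env_rel_def env_ideal_0)
  show "a * 1 = a" by transfer (simp add: env_rel_def env_ideal_0)
  show "a + b + c = a + (b + c)" by transfer (simp add: env_rel_def env_ideal_0 add.assoc)
  show "a + b = b + a" by transfer (simp add: env_rel_def env_ideal_0 add.commute)
  show "0 + a = a" by transfer (simp add: env_rel_def env_ideal_0)
  show "- a + a = 0" by transfer (simp add: env_rel_def env_ideal_0)
  show "a - b = a + - b" by transfer (simp add: env_rel_def env_ideal_0)
  show "(a + b) * c = a * c + b * c" by transfer (simp add: env_rel_def env_ideal_0 distrib_right)
  show "a * (b + c) = a * b + a * c" by transfer (simp add: env_rel_def env_ideal_0 distrib_left)
  show "(0 :: 'a ugl) \<noteq> 1"
    by transfer (use aug_env_ideal in \<open>force simp: env_rel_def aug_def lookup_minus lookup_one\<close>)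
qed

end

lift_definition scalar :: "complex \<Rightarrow> 'm::finite ugl" is free_scalar .

lift_definition emb :: "'m gl \<Rightarrow> 'm::finite ugl" is free_gen .

lemma emb_add: "emb (x + y) = emb x + emb y"
  by transfer (use env_ideal.gen_add in \<open>simp add: env_rel_def algebra_simps\<close>)

lemma emb_scale: "emb (mat_scale c x) = scalar c * emb x"
  by transfer (simp add: env_rel_def env_ideal.gen_scale)

lemma emb_bracket: "emb (lie_bracket x y) = emb x * emb y - emb y * emb x"
proof -
  have "emb x * emb y - emb y * emb x = emb (lie_bracket x y)"
    by transfer (simp add: env_rel_def env_ideal.gen_bracket)
  then show ?thesis by simp
qed

section \<open>Triangular decomposition, subalgebras and left ideals\<close>

definition cartan :: "'m::{finite,linorder} gl set" where
  "cartan = {x. \<forall>i j. x $ i $ j \<noteq> 0 \<longrightarrow> i = j}"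

definition n_plus :: "'m::{finite,linorder} gl set" where
  "n_plus = {x. \<forall>i j. x $ i $ j \<noteq> 0 \<longrightarrow> i < j}"

definition n_minus :: "'m::{finite,linorder} gl set" where
  "n_minus = {x. \<forall>i j. x $ i $ j \<noteq> 0 \<longrightarrow> j < i}"

definition b_minus :: "'m::{finite,linorder} gl set" where
  "b_minus = {x. \<forall>i j. x $ i $ j \<noteq> 0 \<longrightarrow> j \<le> i}"

inductive_set subalg :: "'m::finite ugl set \<Rightarrow> 'm ugl set" for S where
  scalar: "scalar c \<in> subalg S"
| gen: "x \<in> S \<Longrightarrow> x \<in> subalg S"
| add: "x \<in> subalg S \<Longrightarrow> y \<in> subalg S \<Longrightarrow> x + y \<in> subalg S"
| mult: "x \<in> subalg S \<Longrightarrow> y \<in> subalg S \<Longrightarrow> x * y \<in> subalg S"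

text \<open>By Poincare-Birkhoff-Witt the enveloping algebra of a Lie subalgebra is identified with
  the subalgebra that it generates.\<close>

abbreviation U_h :: "'m::{finite,linorder} ugl set" where "U_h \<equiv> subalg (emb ` cartan)"
abbreviation U_n_minus :: "'m::{finite,linorder} ugl set" where "U_n_minus \<equiv> subalg (emb ` n_minus)"
abbreviation U_b_minus :: "'m::{finite,linorder} ugl set" where "U_b_minus \<equiv> subalg (emb ` b_minus)"

definition left_ideal_gen :: "'m::finite ugl set \<Rightarrow> 'm ugl set" where
  "left_ideal_gen S = {\<Sum>i<n. u i * s i | (n::nat) u s. \<forall>i<n. s i \<in> S}"

section \<open>Weights and roots\<close>

type_synonym 'm weight = "(complex, 'm) vec"

text \<open>The dual of the diagonal subalgebra is \<^typ>\<open>'m weight\<close>, in coordinates with respect to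
  the basis \<open>eps i\<close>.\<close>

definition wt :: "'m weight \<Rightarrow> 'm::finite gl \<Rightarrow> complex" where
  "wt \<beta> x = (\<Sum>i\<in>UNIV. \<beta> $ i * x $ i $ i)"

definition eps :: "'m::finite \<Rightarrow> 'm weight" where
  "eps i = axis i 1"

text \<open>The form is complex bilinear, so it is not the inner product of \<^typ>\<open>'m weight\<close>.\<close>

definition form :: "'m weight \<Rightarrow> 'm::finite weight \<Rightarrow> complex" where
  "form \<alpha> \<beta> = (\<Sum>i\<in>UNIV. \<alpha> $ i * \<beta> $ i)"

definition mat_unit :: "'m \<Rightarrow> 'm \<Rightarrow> 'm::finite gl" where
  "mat_unit i j = (\<chi> k l. if k = i \<and> l = j then 1 else 0)"

definition coroot :: "'m weight \<Rightarrow> 'm::finite gl" where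
  "coroot \<alpha> = (\<chi> i j. if i = j then \<alpha> $ i else 0)"

lemma wt_eps_mat_unit: "wt (eps i) (mat_unit j j) = (if i = j then 1 else 0)"
  by (simp add: wt_def eps_def mat_unit_def axis_def if_distrib[of "\<lambda>z. z * _"] cong: if_cong)

lemma form_eps: "form (eps i) (eps j) = (if i = j then 1 else 0)"
  by (simp add: form_def eps_def axis_def if_distrib[of "\<lambda>z. z * _"] cong: if_cong)

lemma coroot_characterization:
  "x \<in> cartan \<and> (\<forall>\<beta>. wt \<beta> x = form \<alpha> \<beta>) \<longleftrightarrow> x = coroot \<alpha>"
proof (intro iffI conjI allI; (elim conjE)?)
  assume x: "x \<in> cartan" "\<forall>\<beta>. wt \<beta> x = form \<alpha> \<beta>"
  have "x $ i $ i = \<alpha> $ i" for i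
    using x(2)[rule_format, of "axis i 1"]
    by (simp add: wt_def form_def axis_def if_distrib[of "\<lambda>z. z * _"] if_distrib[of "\<lambda>z. _ * z"]
        cong: if_cong)
  then show "x = coroot \<alpha>"
    using x(1) by (auto simp: cartan_def coroot_def vec_eq_iff)
qed (auto simp: cartan_def coroot_def wt_def form_def mult.commute split: if_splits)

text \<open>The pair \<open>(i, j)\<close> stands for the root \<open>eps i - eps j\<close>.\<close>

definition root_vec :: "'m \<times> 'm \<Rightarrow> 'm::finite weight" where
  "root_vec \<alpha> = eps (fst \<alpha>) - eps (snd \<alpha>)"

definition pos_roots :: "('m::{finite,linorder} \<times> 'm) set" where
  "pos_roots = {(i, j). i < j}"

text \<open>\<open>eps i - eps j\<close> is simple iff \<open>j\<close> is the successor of \<open>i\<close>.\<close>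

definition simple_roots :: "('m::{finite,linorder} \<times> 'm) set" where
  "simple_roots = {(i, j). i < j \<and> {i<..<j} = {}}"

definition e_pos :: "'m \<times> 'm \<Rightarrow> 'm::finite ugl" where
  "e_pos \<alpha> = emb (mat_unit (fst \<alpha>) (snd \<alpha>))"

definition e_neg :: "'m \<times> 'm \<Rightarrow> 'm::finite ugl" where
  "e_neg \<alpha> = emb (mat_unit (snd \<alpha>) (fst \<alpha>))"

definition rho :: "'m::{finite,linorder} weight" where
  "rho = (1/2) *s (\<Sum>\<alpha>\<in>pos_roots. root_vec \<alpha>)"

section \<open>The element \<open>\<Theta>\<close>\<close>

definition index_sets :: "'m::{finite,linorder} \<Rightarrow> 'm \<Rightarrow> 'm set set" where
  "index_sets a b = {I. I \<subseteq> {a..b} \<and> a \<in> I \<and> b \<in> I}"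

text \<open>The factors correspond to the pairs of consecutive elements of \<open>I\<close>, in decreasing order.\<close>

definition f_elt :: "'m::{finite,linorder} set \<Rightarrow> 'm ugl" where
  "f_elt I = (let l = rev (sorted_list_of_set I)
     in prod_list (map (\<lambda>(i, j). emb (mat_unit i j)) (zip l (tl l))))"

text \<open>\<open>h_elt a x\<close> is the element usually written \<open>h_k\<close> with \<open>k = x - 1\<close>, that is, the one for
  \<open>\<sigma> = eps a - eps x\<close>; indexing by \<open>x\<close> avoids a predecessor function on \<open>'m\<close>.\<close>

definition h_elt :: "'m::{finite,linorder} \<Rightarrow> 'm \<Rightarrow> 'm ugl" where
  "h_elt a x = (let \<sigma> = root_vec (a, x) in emb (coroot \<sigma>) + scalar (form rho \<sigma> - 1))"

text \<open>The factors commute; a list is only used because \<open>prod\<close> needs a commutative monoid.\<close>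

definition H_elt :: "'m::{finite,linorder} \<Rightarrow> 'm \<Rightarrow> 'm set \<Rightarrow> 'm ugl" where
  "H_elt a b I = prod_list (map (h_elt a) (sorted_list_of_set ({a..b} - I)))"

definition Theta :: "'m::{finite,linorder} \<Rightarrow> 'm \<Rightarrow> 'm ugl" where
  "Theta a b = (\<Sum>J\<in>index_sets a b. f_elt J * H_elt a b J)"

section \<open>Shapovalov elements\<close>

text \<open>Functions on the positive roots are extended by zero.\<close>

definition partitions :: "'m weight \<Rightarrow> ('m::{finite,linorder} \<times> 'm \<Rightarrow> nat) set" where
  "partitions \<beta> = {\<pi>. (\<forall>\<alpha>. \<alpha> \<notin> pos_roots \<longrightarrow> \<pi> \<alpha> = 0) \<and>
     (\<Sum>\<alpha>\<in>pos_roots. of_nat (\<pi> \<alpha>) *s root_vec \<alpha>) = \<beta>}"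

text \<open>Relevant because a sum over an infinite set is zero by convention.\<close>

lemma finite_partitions:
  fixes \<beta> :: "'m::{finite,linorder} weight"
  shows "finite (partitions \<beta>)"
proof -
  define r :: "'m \<Rightarrow> nat" where "r i = card {..<i}" for i
  define L :: "'m weight \<Rightarrow> complex" where "L v = - (\<Sum>i\<in>UNIV. v $ i * of_nat (r i))" for v
  have r_less: "r i < r j" if "i < j" for i j
    unfolding r_def by (rule psubset_card_mono) (use that in auto)
  have L_sum: "L (\<Sum>\<alpha>\<in>A. c \<alpha> *s v \<alpha>) = (\<Sum>\<alpha>\<in>A. c \<alpha> * L (v \<alpha>))"
    for A :: "('m \<times> 'm) set" and c v
    unfolding L_def
    by (simp add: sum_distrib_right sum_distrib_left sum_negf mult.assoc, rule sum.swap)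
  have L_root: "L (root_vec (i, j)) = of_nat (r j) - of_nat (r i)" for i j
    by (simp add: L_def root_vec_def eps_def axis_def left_diff_distrib sum_subtractf
        if_distrib[of "\<lambda>z. z * _"] cong: if_cong)
  define N where "N = nat \<lfloor>Re (L \<beta>)\<rfloor>"
  have bound: "\<pi> \<alpha> \<le> N" if \<pi>: "\<pi> \<in> partitions \<beta>" and \<alpha>: "\<alpha> \<in> pos_roots" for \<pi> \<alpha>
  proof -
    have "L \<beta> = (\<Sum>\<gamma>\<in>pos_roots. of_nat (\<pi> \<gamma>) * L (root_vec \<gamma>))"
      using \<pi> L_sum[of "\<lambda>\<gamma>. of_nat (\<pi> \<gamma>)" root_vec pos_roots] by (simp add: partitions_def)
    then have eq: "Re (L \<beta>) = (\<Sum>\<gamma>\<in>pos_roots. real (\<pi> \<gamma>) * Re (L (root_vec \<gamma>)))"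
      by simp
    have ge1: "Re (L (root_vec \<gamma>)) \<ge> 1" if "\<gamma> \<in> pos_roots" for \<gamma>
      using that r_less[of "fst \<gamma>" "snd \<gamma>"] L_root[of "fst \<gamma>" "snd \<gamma>"]
      by (auto simp: pos_roots_def)
    have "real (\<pi> \<alpha>) * 1 \<le> real (\<pi> \<alpha>) * Re (L (root_vec \<alpha>))"
      using ge1[OF \<alpha>] by (intro mult_left_mono) auto
    also have "\<dots> \<le> Re (L \<beta>)"
      unfolding eq
      by (rule member_le_sum) (use \<alpha> ge1 in \<open>fastforce intro!: mult_nonneg_nonneg\<close>)+
    finally show ?thesis unfolding N_def by linarith
  qed
  have "partitions \<beta> \<subseteq>
      {\<pi>. \<forall>\<alpha>. (\<alpha> \<in> pos_roots \<longrightarrow> \<pi> \<alpha> \<in> {..N}) \<and> (\<alpha> \<notin> pos_roots \<longrightarrow> \<pi> \<alpha> = 0)}"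
    using bound by (auto simp: partitions_def)
  then show ?thesis
    by (rule finite_subset) (intro finite_set_of_finite_funs finite finite_atMost)
qed

text \<open>\<open>rs\<close> lists the positive roots in the fixed order.\<close>

definition e_neg_partition ::
  "('m::{finite,linorder} \<times> 'm) list \<Rightarrow> ('m \<times> 'm \<Rightarrow> nat) \<Rightarrow> 'm ugl" where
  "e_neg_partition rs \<pi> = prod_list (map (\<lambda>\<alpha>. e_neg \<alpha> ^ \<pi> \<alpha>) rs)"

definition has_weight :: "'m::{finite,linorder} ugl \<Rightarrow> 'm weight \<Rightarrow> bool" where
  "has_weight u \<mu> \<longleftrightarrow> (\<forall>h\<in>cartan. emb h * u - u * emb h = scalar (wt \<mu> h) * u)"

definition shapovalov_element ::
  "('m::{finite,linorder} \<times> 'm) list \<Rightarrow> 'm \<times> 'm \<Rightarrow> nat \<Rightarrow> 'm ugl \<Rightarrow> bool" where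
  "shapovalov_element rs \<eta> p \<theta> \<longleftrightarrow>
     \<theta> \<in> U_b_minus \<and>
     has_weight \<theta> (- (of_nat p *s root_vec \<eta>)) \<and>
     (\<exists>H. (\<forall>\<pi>\<in>partitions (of_nat p *s root_vec \<eta>). H \<pi> \<in> U_h) \<and>
          \<theta> = (\<Sum>\<pi>\<in>partitions (of_nat p *s root_vec \<eta>). e_neg_partition rs \<pi> * H \<pi>) \<and>
          (\<forall>\<pi>\<in>partitions (of_nat p *s root_vec \<eta>).
             (\<forall>\<alpha>. \<alpha> \<notin> simple_roots \<longrightarrow> \<pi> \<alpha> = 0) \<longrightarrow> H \<pi> = 1)) \<and>
     (\<forall>\<alpha>\<in>pos_roots. \<exists>u. \<exists>v\<in>left_ideal_gen (emb ` n_plus).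
        e_pos \<alpha> * \<theta> =
          u * (emb (coroot (root_vec \<eta>)) +
               scalar (wt rho (coroot (root_vec \<eta>)) - of_nat p * form (root_vec \<eta>) (root_vec \<eta>) / 2)) + v)"

section \<open>Evaluation at a weight\<close>

text \<open>\<open>U_h_at lam H\<close> is \<open>H(lam)\<close>, the value at \<open>H\<close> of the unique unital algebra homomorphism
  from \<open>U(\<hh>) = S(\<hh>)\<close> to the complex numbers that extends \<open>lam\<close>.\<close>

definition is_character :: "'m weight \<Rightarrow> ('m::{finite,linorder} ugl \<Rightarrow> complex) \<Rightarrow> bool" where
  "is_character lam chi \<longleftrightarrow>
     (\<forall>c. chi (scalar c) = c) \<and>
     (\<forall>x\<in>U_h. \<forall>y\<in>U_h. chi (x + y) = chi x + chi y \<and> chi (x * y) = chi x * chi y) \<and>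
     (\<forall>h\<in>cartan. chi (emb h) = wt lam h)"

definition U_h_at :: "'m weight \<Rightarrow> 'm::{finite,linorder} ugl \<Rightarrow> complex" where
  "U_h_at lam H = (THE z. \<exists>chi. is_character lam chi \<and> z = chi H)"

text \<open>\<open>eval_at lam u\<close> is \<open>u(lam)\<close>, for \<open>u\<close> in \<^term>\<open>U_b_minus\<close>. By Poincare-Birkhoff-Witt the
  result does not depend on the decomposition of \<open>u\<close>.\<close>

definition eval_at :: "'m weight \<Rightarrow> 'm::{finite,linorder} ugl \<Rightarrow> 'm ugl" where
  "eval_at lam u = (THE w. \<exists>(n::nat) us Hs.
     (\<forall>i<n. us i \<in> U_n_minus \<and> Hs i \<in> U_h) \<and>
     u = (\<Sum>i<n. us i * Hs i) \<and>
     w = (\<Sum>i<n. us i * scalar (U_h_at lam (Hs i))))"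

end

theory Submission
  imports Defs
begin

text \<open>
  Write \<open>c\<close> for the predecessor of \<open>b\<close>, \<open>y = e\<^bsub>b,c\<^esub>\<close>, \<open>e = e\<^bsub>c,b\<^esub>\<close>, \<open>T = \<Theta>\<^bsub>a,c\<^esub>\<close>. Then
  \<open>\<Theta>\<^bsub>a,b\<^esub> = y T + [y, T] h\<close> with \<open>h = h_elt a c\<close>, and induction gives the Serre type relation
  \<open>[T, [T, y]] = 0\<close>. Hence \<open>e \<Theta> = T (h_elt a b) + \<Theta>' e\<close> and \<open>T \<Theta> = \<Theta>' T\<close> for \<open>\<Theta>' = \<Theta> + [y, T]\<close>, so that
  \<open>e \<Theta>\<^sup>p = p T \<Theta>\<^sup>p\<^sup>-\<^sup>1 (h\<^sub>\<eta> + \<rho>(h\<^sub>\<eta>) - p) + \<Theta>'\<^sup>p e\<close>; every other simple root vector \<open>e\<^sub>\<alpha>\<close> satisfies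
  \<open>e\<^sub>\<alpha> \<Theta> = \<Theta>\<^sub>\<alpha> e\<^sub>\<alpha>\<close> for some \<open>\<Theta>\<^sub>\<alpha>\<close>.

  The PBW theorem is elementary here because \<open>gl(m)\<close> comes from an associative algebra \<open>A\<close>: \<open>x\<close> acts on
  \<open>S(A)\<close> by multiplication with \<open>x\<close> plus the derivation extending left multiplication by \<open>x\<close>. It yields
  that \<open>U(n\<^sup>-)\<close> meets the left ideal defining a Verma module trivially. For uniqueness, move \<open>\<lambda>\<close> along a
  generic line \<open>\<lambda> + t \<mu>\<close> in the hyperplane. The condition to be singular, taken at top degree in \<open>t\<close> and then in
  top PBW degree, forces a polynomial family of singular vectors to vanish once its coefficient at
  \<open>e\<^sub>-\<^sub>\<eta>\<^sup>p\<close> does.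
\<close>

section \<open>Calculus in U(gl(m)): scalars, matrix units, weights\<close>

section \<open>Scalars and matrix units\<close>

text \<open>Singularity need only be checked for simple root vectors, and building \<Theta> up one
  index at a time concentrates the whole obstruction in the last of them.

  For one fixed \<lambda>, uniqueness would rest on the theorem that the space of homomorphisms
  between two Verma modules has dimension at most one. Moving \<lambda> replaces this by an
  elementary leading term argument: on the line, [e_\<alpha>, e_-\<alpha>] = h_\<alpha> acts with
  slope (\<mu>, \<alpha>) in t, so to leading order e_\<alpha> acts as (\<mu>, \<alpha>) times the
  partial derivative with respect to e_-\<alpha>. The line has to stay in the hyperplane, which
  forces (\<mu>, \<eta>) = 0. Hence only monomials in e_-\<eta> alone escape the argument, and in
  weight -p \<eta> there is exactly one. This leaves one free polynomial in t, which the
  normalization at \<pi>0 determines.\<close>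

lemma poly_mapping_add_induct [case_names single add]:
  assumes "\<And>k v. P (Poly_Mapping.single k v)" and "\<And>f g. P f \<Longrightarrow> P g \<Longrightarrow> P (f + g)"
  shows "P f"
proof (induction f rule: update_induct)
  case const
  then show ?case using assms(1)[of undefined 0] by simp
next
  case (update f a b)
  have "Poly_Mapping.update a b f = f + Poly_Mapping.single a b"
    using update by (intro poly_mapping_eqI) (auto simp: lookup_add lookup_update lookup_single when_def in_keys_iff)
  then show ?case using update assms by simp
qed

abbreviation E :: "'m \<Rightarrow> 'm \<Rightarrow> 'm::finite ugl" where
  "E i j \<equiv> emb (mat_unit i j)"

lemma scalar_0 [simp]: "scalar 0 = 0"
  by transfer (simp add: env_rel_def free_scalar_def env_ideal_0)

lemma scalar_1 [simp]: "scalar 1 = 1"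
  by transfer (simp add: env_rel_def free_scalar_def env_ideal_0)

lemma scalar_add: "scalar (c + d) = scalar c + scalar d"
  by transfer (simp add: env_rel_def free_scalar_def env_ideal_0 single_add)

lemma scalar_mult: "scalar (c * d) = scalar c * scalar d"
  by transfer (simp add: env_rel_def free_scalar_def env_ideal_0 mult_single)

lemma scalar_uminus: "scalar (- c) = - scalar c"
  using scalar_add[of c "- c"] by (simp add: add_eq_0_iff)

lemma scalar_diff: "scalar (c - d) = scalar c - scalar d"
  using scalar_add[of c "- d"] by (simp add: scalar_uminus)

lemma scalar_of_nat: "scalar (of_nat n) = of_nat n"
  by (induction n) (simp_all add: scalar_add)

lemma scalar_numeral [simp]: "scalar (numeral n) = numeral n"
  using scalar_of_nat[of "numeral n"] by simp

lemma free_scalar_commute: "free_scalar c * u = u * free_scalar c"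
proof (induction u rule: poly_mapping_add_induct)
  case (single k v)
  then show ?case by (simp add: free_scalar_def mult_single mult.commute)
next
  case (add f g)
  then show ?case by (simp add: algebra_simps)
qed

lemma scalar_commute: "scalar c * u = u * scalar c"
  by transfer (simp add: env_rel_def free_scalar_commute env_ideal_0)

lemma scalar_left_commute: "u * (scalar c * v) = scalar c * (u * v)"
  by (metis mult.assoc scalar_commute)

interpretation ugl: vector_space "\<lambda>c (u :: 'm::finite ugl). scalar c * u"
  by unfold_locales (simp_all add: algebra_simps scalar_add scalar_mult)

lemma mat_scale_0 [simp]: "mat_scale 0 x = 0"
  by (simp add: mat_scale_def map_matrix_def vec_eq_iff)

lemma emb_0 [simp]: "emb 0 = 0"
  using emb_scale[of 0 0] by simp

lemma emb_uminus: "emb (- x) = - emb x"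
  using emb_add[of x "- x"] by (simp add: add_eq_0_iff)

lemma emb_diff: "emb (x - y) = emb x - emb y"
  using emb_add[of x "- y"] by (simp add: emb_uminus)

lemma emb_sum: "emb (sum f A) = (\<Sum>i\<in>A. emb (f i))"
  by (induction A rule: infinite_finite_induct) (simp_all add: emb_add)

lemma mat_unit_nth [simp]: "mat_unit i j $ k $ l = (if k = i \<and> l = j then 1 else 0)"
  by (simp add: mat_unit_def)

lemma mat_unit_mult: "mat_unit i j ** mat_unit k l = (if j = k then mat_unit i l else 0)"
  by (auto simp: vec_eq_iff matrix_matrix_mult_def if_distrib[of "\<lambda>z. z * _"] cong: if_cong)

lemma gl_expand: "x = (\<Sum>i\<in>UNIV. \<Sum>j\<in>UNIV. mat_scale (x $ i $ j) (mat_unit i j))"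
proof -
  have "(\<Sum>l\<in>UNIV. mat_scale (x $ k $ l) (mat_unit k l) $ i $ j) = (if k = i then x $ i $ j else 0)" for i j k
    by (cases "k = i") (simp_all add: mat_scale_def map_matrix_def if_distrib[of "\<lambda>z. _ * z"] cong: if_cong)
  then show ?thesis by (simp add: vec_eq_iff)
qed

lemma emb_expand: "emb x = (\<Sum>i\<in>UNIV. \<Sum>j\<in>UNIV. scalar (x $ i $ j) * E i j)"
  by (subst gl_expand) (simp add: emb_sum emb_scale)

lemma E_commutator:
  "E i j * E k l - E k l * E i j = (if j = k then E i l else 0) - (if l = i then E k j else 0)"
  by (simp add: emb_bracket[symmetric] lie_bracket_def mat_unit_mult emb_diff)

lemma E_commute: "j \<noteq> k \<Longrightarrow> l \<noteq> i \<Longrightarrow> E i j * E k l = E k l * E i j"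
  using E_commutator[of i j k l] by simp

text \<open>An element is the class of a combination of words, and the class of a word is a product
  of generators ending in a scalar.\<close>

lemma ugl_induct [case_names scalar emb add mult]:
  assumes s: "\<And>c. P (scalar c)" and e: "\<And>x. P (emb x)"
    and a: "\<And>u v. P u \<Longrightarrow> P v \<Longrightarrow> P (u + v)" and m: "\<And>u v. P u \<Longrightarrow> P v \<Longrightarrow> P (u * v)"
  shows "P u"
proof -
  have word: "P (abs_ugl (Poly_Mapping.single (FWord l) c))" for l c
  proof (induction l)
    case Nil
    then show ?case using s[of c] by (simp add: scalar.abs_eq free_scalar_def zero_fword_def)
  next
    case (Cons x l)
    have "abs_ugl (Poly_Mapping.single (FWord (x # l)) c) = emb x * abs_ugl (Poly_Mapping.single (FWord l) c)"
      by (simp add: emb.abs_eq times_ugl.abs_eq free_gen_def mult_single)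
    then show ?case using Cons e m by simp
  qed
  have "P (abs_ugl f)" for f
  proof (induction f rule: poly_mapping_add_induct)
    case (single k v)
    then show ?case using word by (cases k) simp
  next
    case (add f g)
    then show ?case using a by (metis plus_ugl.abs_eq)
  qed
  then show ?thesis by (metis Quotient3_ugl Quotient3_abs_rep)
qed

section \<open>Weights\<close>

lemma commute_prod_list:
  fixes y :: "'a::monoid_mult"
  assumes "\<And>x. x \<in> set xs \<Longrightarrow> y * x = x * y"
  shows "y * prod_list xs = prod_list xs * y"
  using assms
proof (induction xs)
  case (Cons x xs)
  have "y * (x * prod_list xs) = x * (y * prod_list xs)"
    using Cons.prems[of x] by (simp add: mult.assoc[symmetric])
  then show ?case using Cons by (simp add: mult.assoc)
qed simp

lemma cartan_commute:
  fixes h k :: "'m::{finite,linorder} gl"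
  assumes "h \<in> cartan" "k \<in> cartan"
  shows "emb h * emb k = emb k * emb h"
proof -
  have "(h ** k) $ i $ j = (k ** h) $ i $ j" for i j
    unfolding matrix_matrix_mult_def vec_lambda_beta
  proof (rule sum.cong)
    fix l
    show "h $ i $ l * k $ l $ j = k $ i $ l * h $ l $ j"
    proof (cases "i = l \<and> l = j")
      case False
      then have "h $ i $ l = 0 \<or> h $ l $ j = 0" "k $ i $ l = 0 \<or> k $ l $ j = 0"
          "h $ i $ l = 0 \<or> k $ l $ j = 0" "k $ i $ l = 0 \<or> h $ l $ j = 0"
        using assms unfolding cartan_def by blast+
      then show ?thesis by auto
    qed simp
  qed simp
  then have "h ** k = k ** h" by (simp add: vec_eq_iff)
  then have "emb h * emb k - emb k * emb h = 0"
    by (simp add: emb_bracket[symmetric] lie_bracket_def)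
  then show ?thesis by simp
qed

text \<open>Cartan elements are moved to the right throughout, the side on which evaluation expects
  U(h); passing a factor of weight \<mu> shifts them by \<mu>.\<close>

lemma has_weightD: "has_weight u \<mu> \<Longrightarrow> h \<in> cartan \<Longrightarrow> emb h * u = u * (emb h + scalar (wt \<mu> h))"
  unfolding has_weight_def by (simp add: diff_eq_eq distrib_left scalar_commute[of _ u] add.commute)

lemma has_weightI: "(\<And>h. h \<in> cartan \<Longrightarrow> emb h * u = u * (emb h + scalar (wt \<mu> h))) \<Longrightarrow> has_weight u \<mu>"
  unfolding has_weight_def by (simp add: distrib_left scalar_commute[of _ u])

lemma wt_add: "wt (\<mu> + \<nu>) h = wt \<mu> h + wt \<nu> h"
  by (simp add: wt_def distrib_right sum.distrib)

lemma wt_0 [simp]: "wt 0 h = 0"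
  by (simp add: wt_def)

lemma has_weight_add: "has_weight u \<mu> \<Longrightarrow> has_weight v \<mu> \<Longrightarrow> has_weight (u + v) \<mu>"
  by (intro has_weightI) (simp add: has_weightD distrib_left distrib_right[of u v])

lemma has_weight_mult:
  assumes "has_weight u \<mu>" "has_weight v \<nu>"
  shows "has_weight (u * v) (\<mu> + \<nu>)"
proof (rule has_weightI)
  fix h :: "'a gl" assume h: "h \<in> cartan"
  have "emb h * (u * v) = u * (emb h * v + scalar (wt \<mu> h) * v)"
    by (simp only: mult.assoc[symmetric] has_weightD[OF assms(1) h]) (simp only: mult.assoc distrib_right distrib_left)
  also have "\<dots> = u * (v * (emb h + scalar (wt \<nu> h)) + v * scalar (wt \<mu> h))"
    by (simp only: has_weightD[OF assms(2) h] scalar_commute[of _ v])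
  also have "\<dots> = u * v * (emb h + scalar (wt (\<mu> + \<nu>) h))"
    by (simp only: wt_add scalar_add mult.assoc distrib_left add.assoc add.commute[of "scalar (wt \<mu> h)"])
  finally show "emb h * (u * v) = u * v * (emb h + scalar (wt (\<mu> + \<nu>) h))" .
qed

lemma has_weight_scalar: "has_weight (scalar c) 0"
  by (rule has_weightI) (simp, rule scalar_commute[symmetric])

lemma has_weight_uminus: "has_weight u \<mu> \<Longrightarrow> has_weight (- u) \<mu>"
  using has_weight_mult[OF has_weight_scalar[of "- 1"], of u \<mu>] by (simp add: scalar_uminus)

lemma has_weight_diff: "has_weight u \<mu> \<Longrightarrow> has_weight v \<mu> \<Longrightarrow> has_weight (u - v) \<mu>"
  using has_weight_add[of u \<mu> "- v"] has_weight_uminus[of v] by simp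

lemma has_weight_power: "has_weight u \<mu> \<Longrightarrow> has_weight (u ^ n) (of_nat n *s \<mu>)"
proof (induction n)
  case 0
  then show ?case using has_weight_scalar[of 1] by (simp add: vector_smult_lzero)
next
  case (Suc n)
  then show ?case using has_weight_mult[of u \<mu> "u ^ n"] by (simp add: vector_sadd_rdistrib)
qed

lemma has_weight_cartan: "h \<in> cartan \<Longrightarrow> has_weight (emb h) 0"
  by (simp add: has_weight_def cartan_commute)

lemma wt_eps [simp]: "wt (eps i) h = h $ i $ i"
  by (simp add: wt_def eps_def axis_def if_distrib[of "\<lambda>z. z * _"] cong: if_cong)

lemma wt_diff: "wt (\<mu> - \<nu>) h = wt \<mu> h - wt \<nu> h"
  by (simp add: wt_def left_diff_distrib sum_subtractf)

lemma has_weight_E: "has_weight (E i j) (eps i - eps j)"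
  unfolding has_weight_def
proof
  fix h :: "'a gl" assume h: "h \<in> cartan"
  have h0: "k \<noteq> l \<Longrightarrow> h $ k $ l = 0" for k l
    using h by (auto simp: cartan_def)
  have "(h ** mat_unit i j) $ k $ l = (if l = j then h $ k $ i else 0)"
    "(mat_unit i j ** h) $ k $ l = (if k = i then h $ j $ l else 0)" for k l
    by (simp_all add: matrix_matrix_mult_def if_distrib[of "\<lambda>z. _ * z"] if_distrib[of "\<lambda>z. z * _"] cong: if_cong)
  then have "h ** mat_unit i j - mat_unit i j ** h = mat_scale (wt (eps i - eps j) h) (mat_unit i j)"
    by (auto simp: vec_eq_iff mat_scale_def map_matrix_def wt_diff h0)
  then show "emb h * E i j - E i j * emb h = scalar (wt (eps i - eps j) h) * E i j"
    by (simp add: emb_bracket[symmetric] lie_bracket_def emb_scale[symmetric])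
qed

lemma mat_unit_diag_cartan [simp]: "mat_unit i i \<in> cartan"
  by (auto simp: cartan_def)

lemma coroot_root_vec: "coroot (root_vec (i, j)) = mat_unit i i - mat_unit j j"
  by (auto simp: vec_eq_iff coroot_def root_vec_def eps_def axis_def)

lemma h_elt_eq: "h_elt a x = E a a - E x x + scalar (form rho (root_vec (a, x)) - 1)"
  by (simp add: h_elt_def coroot_root_vec emb_diff)

lemma eps_nth: "eps i $ j = (if j = i then 1 else 0)"
  by (simp add: eps_def axis_def)

lemma wt_mat_unit: "wt \<mu> (mat_unit i i) = \<mu> $ i"
  by (simp add: wt_def if_distrib[of "\<lambda>z. _ * z"] if_distribR cong: if_cong)

lemma h_elt_shift:
  assumes "has_weight u \<mu>"
  shows "h_elt a x * u = u * (h_elt a x + scalar (\<mu> $ a - \<mu> $ x))"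
  using has_weightD[OF assms, of "mat_unit a a"] has_weightD[OF assms, of "mat_unit x x"]
  by (simp add: h_elt_eq algebra_simps wt_mat_unit scalar_diff scalar_commute[of _ u])

lemma h_elt_E_commute:
  "i \<notin> {a, x} \<Longrightarrow> j \<notin> {a, x} \<Longrightarrow> h_elt a x * E i j = E i j * h_elt a x"
  using h_elt_shift[OF has_weight_E, of a x i j] by (auto simp: eps_nth)

lemma h_elt_weight: "has_weight (h_elt a x) 0"
  unfolding h_elt_eq
  by (intro has_weight_add has_weight_diff has_weight_cartan has_weight_scalar mat_unit_diag_cartan)

section \<open>Algebra of \<Theta>: recursion, Serre type relation, commutation with root
  vectors\<close>

section \<open>The recursion for \<open>\<Theta>\<close>\<close>

text \<open>Stands in for b = c + 1 on an arbitrary finite linear order, so that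
  \<open>E c b\<close> is a simple root vector.\<close>

definition adjacent :: "'m::linorder \<Rightarrow> 'm \<Rightarrow> bool" where
  "adjacent c b \<longleftrightarrow> c < b \<and> {c<..<b} = {}"

lemma adjacent_cases: "adjacent c b \<Longrightarrow> x < b \<longleftrightarrow> x \<le> c"
  unfolding adjacent_def by (metis emptyE greaterThanLessThan_iff leD le_less_trans linorder_not_le)

lemma adjacent_less: "adjacent c b \<Longrightarrow> c < b"
  by (simp add: adjacent_def)

lemma obtain_adjacent:
  fixes a b :: "'m::{finite,linorder}"
  assumes "a < b"
  obtains c where "adjacent c b" "a \<le> c"
proof
  have ne: "a \<in> {..<b}" using assms by simp
  then have "Max {..<b} < b" using Max_in[of "{..<b}"] by fastforce
  then show "adjacent (Max {..<b}) b"
    unfolding adjacent_def by (auto simp: not_less[symmetric])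
       (metis Max_ge finite lessThan_iff leD)
  show "a \<le> Max {..<b}" using ne by simp
qed

lemma adjacent_induct [consumes 1, case_names base step]:
  fixes a b :: "'m::{finite,linorder}"
  assumes "a \<le> b" "P a" "\<And>c b. a \<le> c \<Longrightarrow> adjacent c b \<Longrightarrow> P c \<Longrightarrow> P b"
  shows "P b"
  using assms(1)
proof (induction "card {..b}" arbitrary: b rule: less_induct)
  case less
  show ?case
  proof (cases "a = b")
    case False
    then have "a < b" using less.prems by simp
    then obtain c where c: "adjacent c b" "a \<le> c" by (rule obtain_adjacent)
    have "{..c} \<subset> {..b}" using adjacent_less[OF c(1)] by auto
    then have "P c" using less.hyps[of c] c by (simp add: psubset_card_mono)
    then show ?thesis using assms(3) c by blast
  qed (use assms(2) in simp)
qed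

lemma sorted_list_of_set_insert_top:
  assumes "finite I" "\<And>x. x \<in> I \<Longrightarrow> x < b"
  shows "sorted_list_of_set (insert b I) = sorted_list_of_set I @ [b]"
proof (rule sorted_distinct_set_unique)
  show "sorted (sorted_list_of_set I @ [b])" using assms by (auto simp: sorted_append less_imp_le)
  show "distinct (sorted_list_of_set I @ [b])" using assms by auto
  show "set (sorted_list_of_set (insert b I)) = set (sorted_list_of_set I @ [b])"
    by (simp only: set_append list.set set_sorted_list_of_set[OF assms(1)] set_sorted_list_of_set[OF finite.insertI[OF assms(1)]]) simp
qed simp_all

lemma f_elt_insert_top:
  assumes "I \<noteq> {}" "\<And>x. x \<in> I \<Longrightarrow> x < b"
  shows "f_elt (insert b I) = E b (Max I) * f_elt I"
proof -
  have eq: "sorted_list_of_set I = sorted_list_of_set (I - {Max I}) @ [Max I]"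
  proof -
    have "insert (Max I) (I - {Max I}) = I" using assms(1) by (simp add: insert_absorb)
    moreover have "x < Max I" if "x \<in> I - {Max I}" for x
      using that by (simp add: less_le)
    ultimately show ?thesis
      using sorted_list_of_set_insert_top[of "I - {Max I}" "Max I"] by simp
  qed
  have eq': "sorted_list_of_set (insert b I) = sorted_list_of_set (I - {Max I}) @ [Max I, b]"
    using sorted_list_of_set_insert_top[OF _ assms(2), of I] eq by simp
  show ?thesis
    unfolding f_elt_def Let_def eq' eq by simp
qed

lemma f_elt_commute:
  assumes "\<And>k l. k \<in> I \<Longrightarrow> l \<in> I \<Longrightarrow> y * E k l = E k l * y"
  shows "y * f_elt I = f_elt I * y"
  unfolding f_elt_def Let_def
proof (rule commute_prod_list)
  fix x assume "x \<in> set (map (\<lambda>(i, j). E i j) (zip (rev (sorted_list_of_set I)) (tl (rev (sorted_list_of_set I)))))"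
  then obtain i j where ij: "x = E i j"
      "(i, j) \<in> set (zip (rev (sorted_list_of_set I)) (tl (rev (sorted_list_of_set I))))" by auto
  then have "i \<in> I" "j \<in> I"
    using set_zip_leftD[OF ij(2)] set_zip_rightD[OF ij(2)]
    by (simp, metis finite list.sel(2) list.set_sel(2) set_rev set_sorted_list_of_set)
  then show "y * x = x * y" using assms ij by simp
qed

lemma Theta_self [simp]: "Theta a a = 1"
proof -
  have "index_sets a a = {{a}}" by (auto simp: index_sets_def)
  then show ?thesis by (simp add: Theta_def f_elt_def H_elt_def)
qed

text \<open>An index set for a, b either passes through the predecessor c or skips it. In the second
  case c is put back; this is reversible since every member of \<open>index_sets a c\<close>
  contains c, and a < c ensures that deleting c leaves a in place.\<close>

lemma index_sets_adjacent:
  fixes a :: "'m::{finite,linorder}"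
  assumes "a < c" "adjacent c b"
  shows "index_sets a b = insert b ` index_sets a c \<union> (\<lambda>I. insert b (I - {c})) ` index_sets a c" (is "_ = ?A \<union> ?B")
    and "insert b ` index_sets a c \<inter> (\<lambda>I. insert b (I - {c})) ` index_sets a c = {}"
    and "inj_on (insert b) (index_sets a c)"
    and "inj_on (\<lambda>I. insert b (I - {c})) (index_sets a c)"
proof -
  have cb: "x \<le> b \<longleftrightarrow> x \<le> c \<or> x = b" for x using adjacent_cases[OF assms(2), of x] by auto
  have b: "b \<notin> I" if "I \<in> index_sets a c" for I
  proof
    assume "b \<in> I"
    then have "b \<in> {a..c}" using that by (auto simp: index_sets_def)
    then show False using adjacent_less[OF assms(2)] by auto
  qed
  have bc: "b \<noteq> c" using adjacent_less[OF assms(2)] by simp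
  show "index_sets a b = ?A \<union> ?B"
  proof (intro equalityI subsetI)
    fix I assume I: "I \<in> index_sets a b"
    show "I \<in> ?A \<union> ?B"
    proof (cases "c \<in> I")
      case True
      then have "I - {b} \<in> index_sets a c" "I = insert b (I - {b})"
        using I bc assms(1) cb adjacent_less[OF assms(2)] by (auto simp: index_sets_def)
      then show ?thesis by blast
    next
      case False
      then have "insert c (I - {b}) \<in> index_sets a c" "I = insert b (insert c (I - {b}) - {c})"
        using I bc assms(1) cb adjacent_less[OF assms(2)] by (auto simp: index_sets_def)
      then show ?thesis by blast
    qed
  next
    fix I assume "I \<in> ?A \<union> ?B"
    then show "I \<in> index_sets a b"
      using assms(1) adjacent_less[OF assms(2)] cb by (auto simp: index_sets_def)
  qed
  show "?A \<inter> ?B = {}" using bc by (auto simp: index_sets_def)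
  show "inj_on (insert b) (index_sets a c)" using b by (auto simp: inj_on_def insert_ident)
  show "inj_on (\<lambda>I. insert b (I - {c})) (index_sets a c)"
  proof (rule inj_onI)
    fix I J assume *: "I \<in> index_sets a c" "J \<in> index_sets a c" "insert b (I - {c}) = insert b (J - {c})"
    then have "I - {c} = J - {c}" using b by (metis Diff_iff insert_ident)
    then show "I = J" using * by (auto simp: index_sets_def)
  qed
qed

text \<open>Read an index set as a path from b down to a. If it passes through c, its first factor
  is \<open>E b c\<close>. If it skips c, then \<open>E b k\<close>, the bracket of
  \<open>E b c\<close> and \<open>E c k\<close>, replaces the first factor \<open>E c k\<close> of a
  path from c, and the complement gains c, whence the factor \<open>h_elt a c\<close>.\<close>

lemma Theta_rec:
  fixes a :: "'m::{finite,linorder}"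
  assumes "a \<le> c" "adjacent c b"
  shows "Theta a b = E b c * Theta a c + (E b c * Theta a c - Theta a c * E b c) * h_elt a c"
proof (cases "a = c")
  case True
  have b: "x \<le> b \<longleftrightarrow> x \<le> c \<or> x = b" for x using adjacent_cases[OF assms(2), of x] by auto
  have "c < b" and ab: "{a..b} = {a, b}" using b adjacent_less[OF assms(2)] True by auto
  have "index_sets a b = {{a, b}}"
    unfolding index_sets_def ab by auto
  moreover have "f_elt {a, b} = E b a"
    using f_elt_insert_top[of "{a}" b] \<open>c < b\<close> True by (simp add: insert_commute f_elt_def)
  \<comment> \<open>\<open>Theta a a\<close> is 1, so the commutator term vanishes.\<close>
  ultimately show ?thesis using True ab by (simp add: Theta_def H_elt_def)
next
  case False
  then have ac: "a < c" using assms by simp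
  have cb: "c < b" "b \<noteq> c" using adjacent_less[OF assms(2)] by auto
  have le_b: "x \<le> b \<longleftrightarrow> x \<le> c \<or> x = b" for x using adjacent_cases[OF assms(2), of x] by auto
  let ?y = "E b c"
  let ?g = "\<lambda>I. f_elt I * H_elt a b I"
  have H: "?y * H_elt a c I = H_elt a c I * ?y" if I: "I \<in> index_sets a c" for I
    unfolding H_elt_def
  proof (rule commute_prod_list)
    fix x assume "x \<in> set (map (h_elt a) (sorted_list_of_set ({a..c} - I)))"
    then obtain z where z: "x = h_elt a z" "z \<le> c" "z \<notin> I" by auto
    then have "z < c" using I by (auto simp: index_sets_def less_le)
    then have "b \<notin> {a, z}" "c \<notin> {a, z}" using ac cb(1) by auto
    then show "?y * x = x * ?y" using z h_elt_E_commute by metis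
  qed
  have main: "?g (insert b I) = ?y * (f_elt I * H_elt a c I)"
       "?g (insert b (I - {c})) = (?y * (f_elt I * H_elt a c I) - f_elt I * H_elt a c I * ?y) * h_elt a c"
    if I: "I \<in> index_sets a c" for I
  proof -
    have Ic: "I \<noteq> {}" "c \<in> I" "a \<in> I" "\<And>x. x \<in> I \<Longrightarrow> x \<le> c" using I by (auto simp: index_sets_def)
    have mx: "Max I = c" using Ic by (intro Max_eqI) auto
    have lt: "x < b" if "x \<in> I" for x using Ic(4)[OF that] cb by simp
    have nbc: "\<not> b \<le> c" using cb(1) by simp
    then have compl: "{a..b} - insert b I = {a..c} - I"
      using ac by (auto simp: le_b)
    show "?g (insert b I) = ?y * (f_elt I * H_elt a c I)"
      using f_elt_insert_top[OF Ic(1) lt] by (simp add: mx H_elt_def compl mult.assoc)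
    define K where "K = I - {c}"
    have K: "K \<noteq> {}" "\<And>x. x \<in> K \<Longrightarrow> x < c" "\<And>x. x \<in> K \<Longrightarrow> x < b" "insert c K = I"
      using Ic ac lt by (auto simp: K_def less_le)
    have fI: "f_elt I = E c (Max K) * f_elt K" using f_elt_insert_top[OF K(1,2)] K(4) by simp
    have fbK: "f_elt (insert b K) = E b (Max K) * f_elt K" using f_elt_insert_top[OF K(1,3)] by simp
    have comm: "?y * f_elt K = f_elt K * ?y"
      by (rule f_elt_commute) (use K cb in \<open>force intro: E_commute\<close>)
    have mK: "Max K \<noteq> b" using K(3)[OF Max_in[OF finite K(1)]] by simp
    \<comment> \<open>Of the factors of \<open>f_elt I\<close> only the first one, which leaves c,
      fails to commute with \<open>E b c\<close>.\<close>
    have "?y * f_elt I - f_elt I * ?y = (?y * E c (Max K) - E c (Max K) * ?y) * f_elt K"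
      by (simp add: fI algebra_simps comm)
    also have "\<dots> = f_elt (insert b K)"
      using mK by (simp add: E_commutator fbK)
    finally have br: "?y * f_elt I - f_elt I * ?y = f_elt (insert b K)" .
    have "{a..b} - insert b K = insert c ({a..c} - I)" using ac cb(2) nbc by (auto simp: le_b K_def)
    moreover have "sorted_list_of_set (insert c ({a..c} - I)) = sorted_list_of_set ({a..c} - I) @ [c]"
      by (rule sorted_list_of_set_insert_top) (use Ic in \<open>auto simp: less_le\<close>)
    ultimately have "H_elt a b (insert b K) = H_elt a c I * h_elt a c" by (simp add: H_elt_def)
    then have "?g (insert b K) = (?y * f_elt I - f_elt I * ?y) * H_elt a c I * h_elt a c"
      by (simp add: br mult.assoc)
    also have "\<dots> = (?y * (f_elt I * H_elt a c I) - f_elt I * H_elt a c I * ?y) * h_elt a c"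
      using H[OF I] by (simp add: algebra_simps)
    finally show "?g (insert b (I - {c})) = (?y * (f_elt I * H_elt a c I) - f_elt I * H_elt a c I * ?y) * h_elt a c"
      by (simp add: K_def)
  qed
  have "Theta a b = (\<Sum>I\<in>index_sets a c. ?g (insert b I)) + (\<Sum>I\<in>index_sets a c. ?g (insert b (I - {c})))"
    unfolding Theta_def
    by (subst index_sets_adjacent(1)[OF ac assms(2)], subst sum.union_disjoint)
       (simp_all add: index_sets_adjacent(2-4)[OF ac assms(2)] sum.reindex)
  also have "\<dots> = (\<Sum>I\<in>index_sets a c. ?y * (f_elt I * H_elt a c I)) +
     (\<Sum>I\<in>index_sets a c. (?y * (f_elt I * H_elt a c I) - f_elt I * H_elt a c I * ?y) * h_elt a c)"
    by (intro arg_cong2[of _ _ _ _ "(+)"] sum.cong refl main)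
  also have "\<dots> = ?y * Theta a c + (?y * Theta a c - Theta a c * ?y) * h_elt a c"
    by (simp add: Theta_def sum_distrib_left sum_distrib_right sum_subtractf left_diff_distrib)
  finally show ?thesis .
qed

section \<open>Root vectors and powers of \<open>\<Theta>\<close>\<close>

lemma form_root_vec: "form \<mu> (root_vec (a, b)) = \<mu> $ a - \<mu> $ b"
  by (simp add: form_def root_vec_def eps_def axis_def right_diff_distrib sum_subtractf
      if_distrib[of "\<lambda>z. _ * z"] cong: if_cong)

text \<open>The index k is the first entry of a positive root once for each larger index, and the
  second entry once for each smaller one.\<close>

lemma rho_nth:
  fixes k :: "'m::{finite,linorder}"
  shows "rho $ k = (of_nat (card {k<..}) - of_nat (card {..<k})) / 2"
proof -
  have "(\<Sum>\<alpha>\<in>pos_roots. root_vec \<alpha> $ k) =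
      (\<Sum>\<alpha>\<in>pos_roots. if fst \<alpha> = k then 1 else 0) - (\<Sum>\<alpha>\<in>pos_roots. if snd \<alpha> = k then 1 else 0)"
    by (simp add: root_vec_def eps_nth sum_subtractf eq_commute[of k])
  also have "\<dots> = of_nat (card {\<alpha> \<in> pos_roots. fst \<alpha> = k}) - of_nat (card {\<alpha> \<in> pos_roots. snd \<alpha> = k})"
    by (simp add: sum.If_cases Int_def conj_commute)
  also have "{\<alpha> \<in> pos_roots. fst \<alpha> = k} = Pair k ` {k<..}" by (auto simp: pos_roots_def)
  also have "{\<alpha> \<in> pos_roots. snd \<alpha> = k} = (\<lambda>i. (i, k)) ` {..<k}" by (auto simp: pos_roots_def)
  finally show ?thesis
    by (simp add: rho_def card_image inj_on_def)
qed

lemma adjacent_greater: "adjacent c b \<Longrightarrow> c < x \<longleftrightarrow> b \<le> (x :: 'm::linorder)"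
  by (metis adjacent_cases linorder_not_le)

lemma scalar_neg_1 [simp]: "scalar (- 1) = - 1"
  by (simp add: scalar_uminus)

lemma scalar_neg_numeral [simp]: "scalar (- numeral n) = - numeral n"
  by (simp add: scalar_uminus)

lemma rho_adjacent:
  fixes c :: "'m::{finite,linorder}"
  assumes "adjacent c b"
  shows "rho $ c - rho $ b = 1"
proof -
  have "{c<..} = insert b {b<..}" "{..<b} = insert c {..<c}"
    by (auto simp: adjacent_cases[OF assms] adjacent_greater[OF assms])
  then show ?thesis by (simp add: rho_nth field_simps)
qed

text \<open>This value makes the step from c to b uniform: for a = c the right-hand side of
  \<open>h_elt_adjacent\<close> becomes \<open>E c c - E b b\<close>.\<close>

lemma h_elt_self: "h_elt a a = - 1"
  by (simp add: h_elt_eq form_root_vec scalar_diff)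

lemma h_elt_adjacent:
  fixes c :: "'m::{finite,linorder}"
  assumes "adjacent c b"
  shows "h_elt a b = h_elt a c + (E c c - E b b) + 1"
proof -
  have "form rho (root_vec (a, b)) = form rho (root_vec (a, c)) + 1"
    using rho_adjacent[OF assms] by (simp add: form_root_vec algebra_simps)
  then show ?thesis by (simp add: h_elt_eq scalar_diff scalar_add)
qed

lemma Theta_weight:
  fixes a :: "'m::{finite,linorder}"
  assumes "a \<le> b"
  shows "has_weight (Theta a b) (eps b - eps a)"
  using assms
proof (induction rule: adjacent_induct)
  case base
  then show ?case using has_weight_scalar[of 1] by simp
next
  case (step c b)
  note 1 = has_weight_mult[OF has_weight_E[of b c] step.IH]
  note 2 = has_weight_mult[OF step.IH has_weight_E[of b c]]
  have eq: "eps b - eps c + (eps c - eps a) = eps b - eps a"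
       "eps c - eps a + (eps b - eps c) = eps b - (eps a :: 'm weight)" by simp_all
  have 3: "has_weight ((E b c * Theta a c - Theta a c * E b c) * h_elt a c) (eps b - eps a + 0)"
    using 1 2 unfolding eq by (intro has_weight_mult has_weight_diff h_elt_weight)
  show ?case
    unfolding Theta_rec[OF step.hyps] using 1 3 unfolding eq by (simp add: has_weight_add)
qed

text \<open>The shift 2 is (\<sigma>, \<sigma>) for the root \<sigma> given by the pair (a, c),
  since \<open>Theta a c\<close> has weight -\<sigma>.\<close>

lemma h_elt_Theta:
  fixes a :: "'m::{finite,linorder}"
  assumes "a < c"
  shows "h_elt a c * Theta a c = Theta a c * (h_elt a c - 2)"
  using h_elt_shift[OF Theta_weight[of a c], of a c] assms by (auto simp: eps_nth)

lemma commute_mult: "y * u = u * (y::'a::semigroup_mult) \<Longrightarrow> y * v = v * y \<Longrightarrow> y * (u * v) = (u * v) * y"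
  by (metis mult.assoc)

lemma commute_add: "y * u = u * (y::'a::ring) \<Longrightarrow> y * v = v * y \<Longrightarrow> y * (u + v) = (u + v) * y"
  by (simp add: distrib_left distrib_right)

lemma commute_diff: "y * u = u * (y::'a::ring) \<Longrightarrow> y * v = v * y \<Longrightarrow> y * (u - v) = (u - v) * y"
  by (simp add: left_diff_distrib right_diff_distrib)

text \<open>Each factor \<open>E k l\<close> of \<open>Theta a c\<close> has k \<le> c and l < c,
  and its Cartan factors involve only indices below c; all of these commute with
  \<open>E i j\<close>.\<close>

lemma E_Theta_commute:
  fixes a :: "'m::{finite,linorder}"
  assumes "a \<le> c" "c \<le> i" "c < j"
  shows "E i j * Theta a c = Theta a c * E i j"
  using assms
proof (induction rule: adjacent_induct)
  case (step c b)
  have cb: "c < b" using step adjacent_less by blast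
  have IH: "E i j * Theta a c = Theta a c * E i j" using step cb by auto
  have 1: "E i j * E b c = E b c * E i j" by (rule E_commute) (use cb step in auto)
  have 2: "E i j * h_elt a c = h_elt a c * E i j"
    by (rule h_elt_E_commute[symmetric]) (use cb step in auto)
  show ?case
    unfolding Theta_rec[OF step.hyps] by (intro commute_mult commute_add commute_diff IH 1 2)
qed simp

lemma ugl_double_cancel:
  fixes u :: "'m::finite ugl"
  assumes "u + u = 0"
  shows "u = 0"
proof -
  have "scalar (1/2) * (u + u) = scalar (1/2 + 1/2) * u"
    by (simp only: scalar_add distrib_left distrib_right)
  then show ?thesis using assms by simp
qed

text \<open>Here \<open>A = [S, x]\<close>. Applying \<open>ad S\<close> twice to \<open>[x, x'] = 0\<close> gives \<open>2 [A, A'] = 0\<close>; the rest is rewriting to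
  a normal form in which \<open>k\<close> stands on the right.\<close>

lemma serre_step:
  fixes x x' S k :: "'m::finite ugl"
  assumes xx: "x * x' = x' * x"
    and A: "S * x = A + x * S" and A': "S * x' = A' + x' * S"
    and SA: "S * A = A * S" and SA': "S * A' = A' * S"
    and kS: "k * S = S * k - 2 * S" and kx: "k * x = x * k + x" and kx': "k * x' = x' * k + x'"
  shows "(x * S - A * k) * (x' * S - A' * k) = (x' * S - A' * k) * (x * S - A * k)"
proof -
  have A_eq: "A = S * x - x * S" "A' = S * x' - x' * S" using A A' by simp_all
  have l: "S * (x * u) = A * u + x * (S * u)" "S * (x' * u) = A' * u + x' * (S * u)"
     "S * (A * u) = A * (S * u)" "S * (A' * u) = A' * (S * u)"
     "k * (S * u) = S * (k * u) - 2 * (S * u)" "k * (x * u) = x * (k * u) + x * u"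
     "k * (x' * u) = x' * (k * u) + x' * u" "x * (x' * u) = x' * (x * u)" for u
    unfolding mult.assoc[symmetric] by (simp_all add: assms distrib_right left_diff_distrib)
  have "S * (x * x') = A * x' + x * A' + x' * (x * S)" "S * (x' * x) = A' * x + x' * A + x' * (x * S)"
    by (simp_all add: l A A' distrib_left)
  \<comment> \<open>First derivative of [x, x'] = 0 under ad S, solved for
    \<open>A * x'\<close>.\<close>
  then have Ax': "A * x' = A' * x + x' * A - x * A'"
    by (simp add: xx algebra_simps)
  have "S * (A * x') = A * A' + A * x' * S"
    by (simp add: l A A' SA SA' distrib_left mult.assoc)
  moreover have "S * (A' * x + x' * A - x * A') = A' * A + A' * A - A * A' + (A' * x + x' * A - x * A') * S"
    by (simp add: l A A' SA SA' distrib_left distrib_right right_diff_distrib left_diff_distrib mult.assoc)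
  ultimately have "A * A' + A * x' * S = A' * A + A' * A - A * A' + A * x' * S"
    unfolding Ax' by simp
  then have "(A * A' - A' * A) + (A * A' - A' * A) = 0"
    by (simp add: algebra_simps)
  then have "A * A' - A' * A = 0" by (rule ugl_double_cancel)
  then have AA': "A * A' = A' * A" by simp
  have two: "2 * u = u + u" for u :: "'m ugl" by (simp add: mult_2)
  have kA: "k * A = A * k - A"
    unfolding A_eq by (simp add: right_diff_distrib left_diff_distrib l kS kx two distrib_left distrib_right mult.assoc algebra_simps)
  have kA': "k * A' = A' * k - A'"
    unfolding A_eq by (simp add: right_diff_distrib left_diff_distrib l kS kx' two distrib_left distrib_right mult.assoc algebra_simps)
  have l': "k * (A * u) = A * (k * u) - A * u" "k * (A' * u) = A' * (k * u) - A' * u"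
     "A * (x' * u) = A' * (x * u) + x' * (A * u) - x * (A' * u)" "A * (A' * u) = A' * (A * u)" for u
    unfolding mult.assoc[symmetric] by (simp_all add: kA kA' Ax' AA' distrib_right left_diff_distrib)
  show ?thesis
    by (simp add: right_diff_distrib left_diff_distrib distrib_left distrib_right mult.assoc
      A A' SA SA' kS kx kx' kA kA' Ax' AA' l l' two xx)
qed

text \<open>Bracketing with \<open>E b c\<close> turns \<open>x = E c d\<close> into
  \<open>x' = E b d\<close> and changes nothing else in the recursion for \<open>Theta a c\<close>.
  So the claim is that the same expression formed with x and with x' commutes.
  \<open>serre_step\<close> deduces this from the induction hypothesis for both outer indices c and
  b, which is why b is generalized.\<close>

lemma Theta_serre:
  fixes a :: "'m::{finite,linorder}"
  assumes "a \<le> c" "c < b"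
  shows "Theta a c * (E b c * Theta a c - Theta a c * E b c) = (E b c * Theta a c - Theta a c * E b c) * Theta a c"
  using assms
proof (induction arbitrary: b rule: adjacent_induct)
  case (step d c)
  have dc: "d < c" "d < b" "c \<noteq> d" "d \<noteq> b" "c \<noteq> b" using step adjacent_less[of d c] by auto
  let ?S = "Theta a d" and ?x = "E c d" and ?x' = "E b d" and ?y = "E b c" and ?k = "h_elt a d"
  have yx: "?y * ?x = ?x' + ?x * ?y" using E_commutator[of b c c d] dc by (simp add: algebra_simps)
  have xx: "?x * ?x' = ?x' * ?x" using dc by (intro E_commute) auto
  have yS: "?y * ?S = ?S * ?y" by (rule E_Theta_commute) (use step dc in auto)
  show ?case
  proof (cases "a = d")
    \<comment> \<open>Here \<open>S = 1\<close>, and the relation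
      \<open>k * S = S * k - 2 * S\<close> required by \<open>serre_step\<close> fails.\<close>
    case True
    then have "Theta a c = ?x" using Theta_rec[OF step.hyps] by simp
    then show ?thesis using yx xx by simp
  next
    case False
    have yk: "?y * ?k = ?k * ?y"
      by (rule h_elt_E_commute[symmetric]) (use step dc in auto)
    define A where "A = ?S * ?x - ?x * ?S"
    define A' where "A' = ?S * ?x' - ?x' * ?S"
    have T: "Theta a c = ?x * ?S - A * ?k"
      by (simp add: Theta_rec[OF step.hyps] A_def algebra_simps)
    have l: "?y * (?x * u) = ?x' * u + ?x * (?y * u)" "?y * (?S * u) = ?S * (?y * u)"
        "?y * (?k * u) = ?k * (?y * u)" for u
      unfolding mult.assoc[symmetric] by (simp_all add: yx yS yk distrib_right)
    have D: "?y * Theta a c - Theta a c * ?y = ?x' * ?S - A' * ?k"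
      by (simp add: T A_def A'_def right_diff_distrib left_diff_distrib distrib_left distrib_right mult.assoc yx yS yk l)
    have SA: "?S * A = A * ?S" "?S * A' = A' * ?S"
      using step.IH[OF dc(1)] step.IH[OF dc(2)] by (simp_all add: A_def A'_def algebra_simps)
    have ad: "a < d" using step.hyps False by simp
    have kE: "?k * E j d = E j d * ?k + E j d" if "d < j" for j
      using h_elt_shift[OF has_weight_E, of a d j d] that ad by (auto simp: eps_nth distrib_left)
    show ?thesis
      unfolding D unfolding T
      by (rule serre_step[OF xx _ _ SA])
         (use h_elt_Theta[OF ad] kE dc in \<open>simp_all add: A_def A'_def right_diff_distrib mult_2 mult_2_right\<close>)
  qed
qed simp

text \<open>Let a < c, A = [y, T] and \<Theta> = y T + A k. Moving e to the right uses [e, y] = g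
  and e k = (k + 1) e: the shift of k turns \<Theta> into \<Theta>' = \<Theta> + A, and the rest is
  g T + [g, T] k = T (g + 1 + k). In the second identity T y = y T - A contributes -A T and T k = (k
  + 2) T contributes 2 A T, provided T A = A T, which is the Serre type relation.\<close>

lemma last_root_Theta:
  fixes a :: "'m::{finite,linorder}"
  assumes "a \<le> c" "adjacent c b"
  defines "\<Theta>' \<equiv> Theta a b + (E b c * Theta a c - Theta a c * E b c)"
  shows "E c b * Theta a b = Theta a c * h_elt a b + \<Theta>' * E c b"
    and "Theta a c * Theta a b = \<Theta>' * Theta a c"
proof -
  have cb: "c < b" using adjacent_less[OF assms(2)] .
  let ?T = "Theta a c" and ?y = "E b c" and ?k = "h_elt a c" and ?e = "E c b" and ?g = "E c c - E b b"
  have ey: "?e * ?y = ?y * ?e + ?g" using E_commutator[of c b b c] by (simp add: algebra_simps)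
  have eT: "?e * ?T = ?T * ?e" by (rule E_Theta_commute) (use assms cb in auto)
  have \<Theta>: "Theta a b = ?y * ?T + (?y * ?T - ?T * ?y) * ?k" by (rule Theta_rec[OF assms(1,2)])
  have hb: "h_elt a b = ?k + ?g + 1" by (rule h_elt_adjacent[OF assms(2)])
  have *: "?e * Theta a b = ?T * h_elt a b + \<Theta>' * ?e \<and> ?T * Theta a b = \<Theta>' * ?T"
  proof (cases "a = c")
    case True
    then show ?thesis unfolding \<Theta>'_def \<Theta> hb by (simp add: ey h_elt_self)
  next
    case False
    then have ac: "a < c" using assms by simp
    have ek: "?e * ?k = ?k * ?e + ?e"
      using h_elt_shift[OF has_weight_E, of a c c b] ac cb by (auto simp: eps_nth algebra_simps)
    have gT: "?g * ?T = ?T * ?g + ?T"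
      using has_weightD[OF Theta_weight[OF assms(1)], of "mat_unit c c"]
        has_weightD[OF Theta_weight[OF assms(1)], of "mat_unit b b"] ac cb
      by (auto simp: wt_mat_unit eps_nth algebra_simps)
    define g where "g = ?g"
    note ey' = ey[folded g_def] and gT' = gT[folded g_def]
    have kT: "?k * ?T = ?T * ?k - ?T - ?T" using h_elt_Theta[OF ac] by (simp add: right_diff_distrib mult_2_right)
    have l: "?e * (?y * u) = ?y * (?e * u) + g * u" "?e * (?T * u) = ?T * (?e * u)"
        "?e * (?k * u) = ?k * (?e * u) + ?e * u" "g * (?T * u) = ?T * (g * u) + ?T * u"
        "?k * (?T * u) = ?T * (?k * u) - ?T * u - ?T * u" for u
      unfolding mult.assoc[symmetric] by (simp_all add: ey' eT ek gT' kT distrib_right left_diff_distrib)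
    have 1: "?e * Theta a b = ?T * h_elt a b + \<Theta>' * ?e"
      unfolding \<Theta>'_def \<Theta> hb g_def[symmetric]
      by (simp add: right_diff_distrib left_diff_distrib distrib_left distrib_right mult.assoc l ey' eT ek gT')
    define A where "A = ?y * ?T - ?T * ?y"
    have TA: "?T * A = A * ?T" using Theta_serre[OF assms(1) cb] by (simp add: A_def)
    have Ty: "?T * ?y = ?y * ?T - A" by (simp add: A_def)
    have l2: "?T * (?y * u) = ?y * (?T * u) - A * u" "?T * (A * u) = A * (?T * u)" for u
      unfolding mult.assoc[symmetric] by (simp_all add: Ty TA left_diff_distrib)
    have 2: "?T * Theta a b = \<Theta>' * ?T"
      unfolding \<Theta>'_def \<Theta> A_def[symmetric]
      by (simp add: right_diff_distrib left_diff_distrib distrib_left distrib_right mult.assoc l2 TA kT)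
    show ?thesis using 1 2 by simp
  qed
  show "?e * Theta a b = ?T * h_elt a b + \<Theta>' * ?e" "?T * Theta a b = \<Theta>' * ?T" using * by simp_all
qed

text \<open>An sl(2) computation. Passing e through each of the p factors leaves T h, with
  \<open>h = h_elt a b\<close>, between powers of \<Theta>' and \<Theta>. Every \<Theta>' becomes
  \<Theta> on passing T, and moving h to the right past k factors subtracts 2 k; the sum of h - 2 k
  over k < p is p (h + 1 - p).\<close>

lemma last_root_Theta_power:
  fixes a :: "'m::{finite,linorder}"
  assumes "a \<le> c" "adjacent c b"
  shows "\<exists>v. E c b * Theta a b ^ p =
    of_nat p * Theta a c * Theta a b ^ (p - 1) * (h_elt a b + 1 - of_nat p) + v * E c b"
proof -
  have ab: "a < b" using assms adjacent_less by fastforce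
  let ?T = "Theta a c" and ?Th = "Theta a b" and ?e = "E c b" and ?h = "h_elt a b"
  obtain \<Theta>' where e: "?e * ?Th = ?T * ?h + \<Theta>' * ?e" and TT: "?T * ?Th = \<Theta>' * ?T"
    using last_root_Theta[OF assms] by blast
  have h: "?h * ?Th = ?Th * (?h - 2)" by (rule h_elt_Theta[OF ab])
  have pT: "\<Theta>' ^ n * ?T = ?T * ?Th ^ n" for n
    by (induction n) (simp_all add: mult.assoc, metis TT mult.assoc power_Suc power_Suc2)
  have "?e * ?Th ^ p = of_nat p * ?T * ?Th ^ (p - 1) * (?h + 1 - of_nat p) + \<Theta>' ^ p * ?e"
  proof (induction p)
    case (Suc p)
    let ?P = "of_nat p :: 'm ugl"
    define W where "W = ?T * ?Th ^ p"
    have P: "?P * u = u * ?P" for u by (rule mult_of_nat_commute)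
    have P': "?P * (W * u) = W * (?P * u)" "?P * (?h * u) = ?h * (?P * u)" for u
      unfolding mult.assoc[symmetric] by (simp_all only: P[of W] P[of ?h])
    have "?e * ?Th ^ Suc p = (?e * ?Th ^ p) * ?Th"
      by (simp add: mult.assoc power_commutes)
    also have "\<dots> = ?P * ?T * ?Th ^ (p - 1) * ((?h + 1 - ?P) * ?Th) + \<Theta>' ^ p * (?e * ?Th)"
      by (simp add: Suc distrib_right mult.assoc)
    also have "(?h + 1 - ?P) * ?Th = ?Th * (?h - 1 - ?P)"
      by (simp add: distrib_right right_diff_distrib left_diff_distrib h P[of ?Th] mult_2_right)
    \<comment> \<open>For p = 0 the exponent p - 1 is truncated, but both sides carry the factor
      \<open>of_nat p\<close>.\<close>
    also have "?P * ?T * ?Th ^ (p - 1) * (?Th * (?h - 1 - ?P)) = ?P * ?T * ?Th ^ p * (?h - 1 - ?P)"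
      by (cases p) (simp_all add: mult.assoc power_commutes, simp add: mult.assoc[symmetric] power_commutes)
    also have "\<Theta>' ^ p * (?e * ?Th) = ?T * ?Th ^ p * ?h + \<Theta>' ^ Suc p * ?e"
      by (simp add: e distrib_left mult.assoc[symmetric] pT power_commutes)
    also have "?P * ?T * ?Th ^ p * (?h - 1 - ?P) + (?T * ?Th ^ p * ?h + \<Theta>' ^ Suc p * ?e)
      = of_nat (Suc p) * W * (?h + 1 - of_nat (Suc p)) + \<Theta>' ^ Suc p * ?e"
      unfolding mult.assoc[of ?P ?T] W_def[symmetric]
      by (simp add: distrib_left distrib_right right_diff_distrib mult.assoc P' P[of ?h] P[of W])
    also have "of_nat (Suc p) * W = of_nat (Suc p) * ?T * ?Th ^ (Suc p - 1)"
      by (simp add: W_def mult.assoc)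
    finally show ?case .
  qed simp
  then show ?thesis by blast
qed

text \<open>Puts \<open>e * u\<close> into the left ideal of e without naming the new left factor;
  unlike commuting, this survives the shifts of Cartan factors.\<close>

definition semicommutes :: "'a::times \<Rightarrow> 'a \<Rightarrow> bool" where
  "semicommutes e u \<longleftrightarrow> (\<exists>v. e * u = v * e)"

lemma semicommutes_mult: "semicommutes e u \<Longrightarrow> semicommutes e v \<Longrightarrow> semicommutes (e :: 'a::semigroup_mult) (u * v)"
  unfolding semicommutes_def by (metis mult.assoc)

lemma semicommutes_add: "semicommutes e u \<Longrightarrow> semicommutes e v \<Longrightarrow> semicommutes (e :: 'a::ring) (u + v)"
  unfolding semicommutes_def by (metis distrib_left distrib_right)

lemma semicommutes_diff: "semicommutes e u \<Longrightarrow> semicommutes e v \<Longrightarrow> semicommutes (e :: 'a::ring) (u - v)"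
  unfolding semicommutes_def by (metis left_diff_distrib right_diff_distrib)

lemma semicommutes_commute: "e * u = u * e \<Longrightarrow> semicommutes e u"
  unfolding semicommutes_def by blast

lemma semicommutes_power: "semicommutes (e :: 'a::monoid_mult) u \<Longrightarrow> semicommutes e (u ^ n)"
  by (induction n) (auto intro: semicommutes_commute semicommutes_mult)

lemma semicommutes_h_elt: "semicommutes (E i j) (h_elt a x)"
proof -
  let ?s = "scalar ((eps i - eps j) $ a - (eps i - eps j) $ x)"
  have "E i j * h_elt a x = (h_elt a x - ?s) * E i j"
    using h_elt_shift[OF has_weight_E, of a x i j] scalar_commute[of _ "E i j"] by (simp add: distrib_left left_diff_distrib)
  then show ?thesis unfolding semicommutes_def by blast
qed

text \<open>The delicate case is the simple root just below the last one, j = c with a < c. There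
  \<open>last_root_Theta\<close> gives \<open>E i c * Theta a c\<close> an extra summand S k, where
  \<open>S = Theta a i\<close> and \<open>k = h_elt a c\<close>. With \<open>y = E b c\<close> it
  contributes y S k + [y, S k] k to \<open>E i c * Theta a b\<close>, and this is 0 because y
  commutes with S and k y = y k + y.\<close>

lemma simple_root_Theta:
  fixes a :: "'m::{finite,linorder}"
  assumes "a \<le> b" "adjacent i j" "j \<noteq> b \<or> a = b"
  shows "semicommutes (E i j) (Theta a b)"
  using assms
proof (induction rule: adjacent_induct)
  case base
  then show ?case by (simp add: semicommutes_commute)
next
  case (step c b)
  have cb: "c < b" and ij: "i < j" using step.hyps step.prems adjacent_less by blast+
  have jb: "j \<noteq> b" "i < x \<longleftrightarrow> j \<le> x" for x
    using step.prems cb step.hyps adjacent_greater[of i j x] by auto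
  let ?T = "Theta a c" and ?y = "E b c" and ?k = "h_elt a c" and ?e = "E i j"
  have i: "i \<noteq> c"
  proof
    assume "i = c"
    then show False using adjacent_cases[OF step.hyps(2), of j] ij jb(2)[of b] cb jb(1) by auto
  qed
  have ey: "?e * ?y = ?y * ?e" using i jb by (intro E_commute) auto
  show ?case
  proof (cases "j = c \<and> a \<noteq> c")
    case False
    then have "semicommutes ?e ?T" using step by auto
    then show ?thesis
      unfolding Theta_rec[OF step.hyps]
      by (intro semicommutes_add semicommutes_mult semicommutes_diff semicommutes_h_elt semicommutes_commute[OF ey])
  next
    case True
    then have ac: "a < c" "j = c" using step.hyps by auto
    have ai: "a \<le> i" "adjacent i c" using ac step.prems adjacent_cases by auto
    let ?S = "Theta a i"
    obtain T' where eT: "?e * ?T = ?S * ?k + T' * ?e"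
      using last_root_Theta(1)[OF ai] ac by blast
    obtain k' where ek: "?e * ?k = k' * ?e"
      using semicommutes_h_elt[of i j a c] unfolding semicommutes_def by blast
    have yS: "?y * ?S = ?S * ?y"
      by (rule E_Theta_commute) (use ai cb ij ac in auto)
    have ky: "?k * ?y = ?y * ?k + ?y"
      using h_elt_shift[OF has_weight_E, of a c b c] ac cb by (auto simp: eps_nth distrib_left)
    have l: "?e * (?y * u) = ?y * (?e * u)" "?e * (?T * u) = ?S * (?k * u) + T' * (?e * u)"
       "?y * (?S * u) = ?S * (?y * u)" "?k * (?y * u) = ?y * (?k * u) + ?y * u" "?e * (?k * u) = k' * (?e * u)" for u
      unfolding mult.assoc[symmetric] by (simp_all add: ey eT yS ky ek distrib_right)
    have "?e * Theta a b = (?y * T' + (?y * T' - T' * ?y) * k') * ?e"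
      unfolding Theta_rec[OF step.hyps]
      by (simp add: right_diff_distrib left_diff_distrib distrib_left distrib_right mult.assoc l ey eT yS ky ek)
    then show ?thesis unfolding semicommutes_def by blast
  qed
qed

section \<open>Left ideals and the singularity condition\<close>

lemma left_ideal_gen_0: "0 \<in> left_ideal_gen S"
  unfolding left_ideal_gen_def by (rule CollectI, rule exI[of _ 0]) simp

lemma left_ideal_gen_add_mult:
  assumes "x \<in> left_ideal_gen S" "s \<in> S"
  shows "x + u * s \<in> left_ideal_gen S"
proof -
  obtain n us ss where x: "x = (\<Sum>i<n. us i * ss i)" "\<forall>i<(n::nat). ss i \<in> S"
    using assms(1) unfolding left_ideal_gen_def by blast
  have "x + u * s = (\<Sum>i<Suc n. (us(n := u)) i * (ss(n := s)) i)" by (simp add: x)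
  moreover have "\<forall>i<Suc n. (ss(n := s)) i \<in> S" using x assms(2) by (simp add: less_Suc_eq)
  ultimately show ?thesis unfolding left_ideal_gen_def by blast
qed

lemma left_ideal_gen_induct [consumes 1, case_names zero add_mult]:
  assumes "x \<in> left_ideal_gen S" "P 0"
    and "\<And>x u s. x \<in> left_ideal_gen S \<Longrightarrow> P x \<Longrightarrow> s \<in> S \<Longrightarrow> P (x + u * s)"
  shows "P x"
proof -
  obtain n us ss where x: "x = (\<Sum>i<n. us i * ss i)" "\<forall>i<(n::nat). ss i \<in> S"
    using assms(1) unfolding left_ideal_gen_def by blast
  have "(\<Sum>i<k. us i * ss i) \<in> left_ideal_gen S \<and> P (\<Sum>i<k. us i * ss i)" if "k \<le> n" for k
    using that x(2) by (induction k) (simp_all add: left_ideal_gen_0 assms(2) assms(3) left_ideal_gen_add_mult)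
  then show ?thesis using x(1) by blast
qed

lemma left_ideal_gen_base: "s \<in> S \<Longrightarrow> u * s \<in> left_ideal_gen S"
  using left_ideal_gen_add_mult[OF left_ideal_gen_0] by fastforce

lemma left_ideal_gen_add:
  assumes "x \<in> left_ideal_gen S" "y \<in> left_ideal_gen S"
  shows "x + y \<in> left_ideal_gen S"
  using assms(2) by (induction y rule: left_ideal_gen_induct) (simp_all add: assms(1) add.assoc[symmetric] left_ideal_gen_add_mult)

lemma left_ideal_gen_mult: "x \<in> left_ideal_gen S \<Longrightarrow> u * x \<in> left_ideal_gen S"
  by (induction x rule: left_ideal_gen_induct)
     (simp_all add: distrib_left mult.assoc[symmetric] left_ideal_gen_add_mult left_ideal_gen_0)

lemma left_ideal_gen_diff:
  assumes "x \<in> left_ideal_gen S" "y \<in> left_ideal_gen S"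
  shows "x - y \<in> left_ideal_gen S"
  using left_ideal_gen_add[OF assms(1) left_ideal_gen_mult[OF assms(2), of "- 1"]] by simp

lemma left_ideal_gen_sum: "(\<And>i. i \<in> A \<Longrightarrow> f i \<in> left_ideal_gen S) \<Longrightarrow> sum f A \<in> left_ideal_gen S"
  by (induction A rule: infinite_finite_induct) (simp_all add: left_ideal_gen_0 left_ideal_gen_add)

lemma wt_coroot: "wt \<mu> (coroot \<sigma>) = form \<mu> \<sigma>"
  by (simp add: wt_def form_def coroot_def)

text \<open>\<open>h_elt\<close> has a -1 built in, and p (\<eta>, \<eta>) / 2 = p.\<close>

lemma shapovalov_factor_eq:
  fixes a :: "'m::{finite,linorder}"
  assumes "a \<noteq> b"
  shows "emb (coroot (root_vec (a, b))) +
      scalar (wt rho (coroot (root_vec (a, b))) - of_nat p * form (root_vec (a, b)) (root_vec (a, b)) / 2)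
    = h_elt a b + 1 - of_nat p"
proof -
  have "form (root_vec (a, b)) (root_vec (a, b)) = 2"
    using assms unfolding form_root_vec by (simp add: root_vec_def eps_nth)
  then show ?thesis by (simp add: wt_coroot h_elt_def Let_def scalar_diff scalar_of_nat)
qed

lemma E_n_plus: "i < j \<Longrightarrow> E i j \<in> emb ` n_plus"
  by (auto simp: n_plus_def)

text \<open>With z the Cartan factor, U z + U n^+ is closed under left multiplication and
  differences. As \<open>E i j\<close> is an iterated commutator of simple root vectors, it suffices
  to treat these.\<close>

lemma Theta_power_singular:
  fixes a :: "'m::{finite,linorder}"
  assumes "a < b" "i < j"
  shows "\<exists>u. \<exists>v\<in>left_ideal_gen (emb ` n_plus). E i j * Theta a b ^ p = u * (h_elt a b + 1 - of_nat p) + v"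
proof -
  let ?z = "h_elt a b + 1 - of_nat p :: 'm ugl"
  let ?S = "\<lambda>x. \<exists>u. \<exists>v\<in>left_ideal_gen (emb ` n_plus). x = u * ?z + v"
  have mult: "?S (u * x)" if x: "?S x" for x u
  proof -
    obtain v w where "w \<in> left_ideal_gen (emb ` n_plus)" "x = v * ?z + w" using x by blast
    then have "u * x = u * v * ?z + u * w" "u * w \<in> left_ideal_gen (emb ` n_plus)"
      by (simp_all add: distrib_left mult.assoc left_ideal_gen_mult)
    then show ?thesis by blast
  qed
  have diff: "?S (x - y)" if x: "?S x" and y: "?S y" for x y
  proof -
    obtain u v u' v' where uv: "v \<in> left_ideal_gen (emb ` n_plus)" "v' \<in> left_ideal_gen (emb ` n_plus)"
       and eq: "x = u * ?z + v" "y = u' * ?z + v'" using x y by auto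
    have "x - y = (u - u') * ?z + (v - v')" unfolding eq by (simp add: left_diff_distrib)
    then show ?thesis using left_ideal_gen_diff[OF uv] by blast
  qed
  have simple: "?S (E i j * Theta a b ^ p)" if ij: "adjacent i j" for i j
  proof (cases "j = b")
    case True
    have "a \<le> i" using assms(1) adjacent_cases[OF ij, of a] True by simp
    then obtain v where "E i j * Theta a b ^ p =
      of_nat p * Theta a i * Theta a b ^ (p - 1) * ?z + v * E i j"
      using last_root_Theta_power[of a i b p] ij True by blast
    then show ?thesis using left_ideal_gen_base[OF E_n_plus[OF adjacent_less[OF ij]]] by blast
  next
    case False
    then have "semicommutes (E i j) (Theta a b)"
      using simple_root_Theta[of a b i j] ij assms by simp
    from semicommutes_power[OF this] obtain v where "E i j * Theta a b ^ p = 0 * ?z + v * E i j"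
      unfolding semicommutes_def by auto
    then show ?thesis using left_ideal_gen_base[OF E_n_plus[OF adjacent_less[OF ij]]] by blast
  qed
  have "i \<le> j" using assms(2) by simp
  then have "i < j \<longrightarrow> ?S (E i j * Theta a b ^ p)"
  proof (induction rule: adjacent_induct)
    case (step c j)
    show ?case
    proof (cases "i = c")
      case False
      then have "i < c" "i \<noteq> j" using step.hyps adjacent_less by fastforce+
      then have "E i j = E i c * E c j - E c j * E i c" using E_commutator[of i c c j] by simp
      then have "E i j * Theta a b ^ p = E i c * (E c j * Theta a b ^ p) - E c j * (E i c * Theta a b ^ p)"
        by (simp add: left_diff_distrib mult.assoc)
      then show ?thesis
        using diff[OF mult[OF simple[OF step.hyps(2)]] mult] step.IH \<open>i < c\<close> by presburger
    qed (use simple step in simp)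
  qed simp
  then show ?thesis using assms(2) by simp
qed

section \<open>Spanning half of PBW and the normal form of the powers of \<Theta>\<close>

section \<open>Reordering words\<close>

definition word_prod :: "('i \<Rightarrow> 'a::monoid_mult) \<Rightarrow> 'i list \<Rightarrow> 'a" where
  "word_prod g w = prod_list (map g w)"

lemma word_prod_simps [simp]: "word_prod g [] = 1" "word_prod g (x # w) = g x * word_prod g w"
    "word_prod g (v @ w) = word_prod g v * word_prod g w"
  by (simp_all add: word_prod_def)

text \<open>The flag \<open>c\<close> decides whether the empty word counts, that is, whether
  brackets may produce constants. The strict length bound makes the set empty for n = 0, which
  starts inductions on the PBW degree.\<close>

definition words :: "'i set \<Rightarrow> ('i \<Rightarrow> 'w::comm_monoid_add) \<Rightarrow> bool \<Rightarrow> nat \<Rightarrow> 'w \<Rightarrow> 'i list set" where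
  "words K d c n \<beta> = {w. set w \<subseteq> K \<and> length w < n \<and> (c \<or> w \<noteq> []) \<and> sum_list (map d w) = \<beta>}"

text \<open>Two letters commute up to shorter words of the same degree. This is all that rearranging
  needs, whether the letters come from n^-, from the upper triangular part shifted by a weight, or
  from all of gl(m).\<close>

locale reordering =
  fixes g :: "'i \<Rightarrow> 'm::finite ugl" and K :: "'i set" and d :: "'i \<Rightarrow> 'w::comm_monoid_add" and c :: bool
  assumes bracket: "x \<in> K \<Longrightarrow> y \<in> K \<Longrightarrow>
    g x * g y - g y * g x \<in> ugl.span (word_prod g ` words K d c 2 (d x + d y))"
begin

abbreviation W :: "nat \<Rightarrow> 'w \<Rightarrow> 'm ugl set" where
  "W n \<beta> \<equiv> ugl.span (word_prod g ` words K d c n \<beta>)"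

lemma W_mono: "n \<le> n' \<Longrightarrow> W n \<beta> \<subseteq> W n' \<beta>"
  by (intro ugl.span_mono image_mono) (auto simp: words_def)

lemma W_mult_left:
  assumes "u \<in> W n \<beta>" "x \<in> K"
  shows "g x * u \<in> W (Suc n) (d x + \<beta>)"
  using assms(1)
proof (induction rule: ugl.span_induct_alt)
  case (step r u v)
  then obtain w where w: "w \<in> words K d c n \<beta>" "u = word_prod g w" by blast
  then have "x # w \<in> words K d c (Suc n) (d x + \<beta>)" using assms(2) by (auto simp: words_def)
  then have "g x * u \<in> W (Suc n) (d x + \<beta>)"
    unfolding w(2) by (intro ugl.span_base) (metis imageI word_prod_simps(2))
  then show ?case using step.IH
    by (simp add: distrib_left scalar_left_commute ugl.span_add ugl.span_scale)
qed (simp add: ugl.span_zero)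

lemma W_mult_right:
  assumes "u \<in> W n \<beta>" "set v \<subseteq> K"
  shows "u * word_prod g v \<in> W (n + length v) (\<beta> + sum_list (map d v))"
  using assms(1)
proof (induction rule: ugl.span_induct_alt)
  case (step r u u')
  then obtain w where w: "w \<in> words K d c n \<beta>" "u = word_prod g w" by blast
  then have "w @ v \<in> words K d c (n + length v) (\<beta> + sum_list (map d v))" using assms(2) by (auto simp: words_def)
  then have "u * word_prod g v \<in> W (n + length v) (\<beta> + sum_list (map d v))"
    unfolding w(2) by (intro ugl.span_base) (metis imageI word_prod_simps(3))
  then show ?case using step.IH
    by (simp add: distrib_right mult.assoc ugl.span_add ugl.span_scale)
qed (simp add: ugl.span_zero)

lemma move_letter:
  assumes "x \<in> K" "set p \<subseteq> K" "set q \<subseteq> K"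
  shows "word_prod g (x # p @ q) - word_prod g (p @ x # q) \<in> W (Suc (length p + length q)) (sum_list (map d (x # p @ q)))"
  using assms(2)
proof (induction p)
  case (Cons y p)
  let ?n = "Suc (length p + length q)" and ?s = "sum_list (map d (p @ q))"
  have 1: "(g x * g y - g y * g x) * word_prod g (p @ q) \<in> W (2 + length (p @ q)) (d x + d y + ?s)"
    by (rule W_mult_right[OF bracket]) (use assms Cons.prems in auto)
  have 2: "g y * (word_prod g (x # p @ q) - word_prod g (p @ x # q)) \<in> W (Suc ?n) (d y + sum_list (map d (x # p @ q)))"
    by (rule W_mult_left[OF Cons.IH]) (use Cons.prems in auto)
  have "word_prod g (x # (y # p) @ q) - word_prod g ((y # p) @ x # q)
    = (g x * g y - g y * g x) * word_prod g (p @ q) + g y * (word_prod g (x # p @ q) - word_prod g (p @ x # q))"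
    by (simp add: left_diff_distrib right_diff_distrib mult.assoc)
  moreover have "W (2 + length (p @ q)) (d x + d y + ?s) = W (Suc ?n) (sum_list (map d (x # (y # p) @ q)))"
    "W (Suc ?n) (d y + sum_list (map d (x # p @ q))) = W (Suc ?n) (sum_list (map d (x # (y # p) @ q)))"
    by (simp_all add: ac_simps)
  ultimately show ?case using ugl.span_add[of _ _ "_ - _"] 1 2
    by (simp only: length_Cons add_Suc ugl.span_add)
qed (simp add: ugl.span_zero)

text \<open>Each transposition costs a bracket, hence an error made of shorter words of the same
  degree.\<close>

lemma reorder:
  assumes "mset v = mset w" "set v \<subseteq> K"
  shows "word_prod g v - word_prod g w \<in> W (length v) (sum_list (map d v))"
  using assms
proof (induction v arbitrary: w)
  case (Cons x v)
  then have "x \<in> set w" by (metis list.set_intros(1) set_mset_mset)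
  then obtain p q where w: "w = p @ x # q" by (meson split_list)
  then have m: "mset v = mset (p @ q)" using Cons.prems by simp
  have set: "set (p @ q) \<subseteq> K" using Cons.prems(2) mset_eq_setD[OF m] by simp
  have "length v = length (p @ q)" "sum_list (map d v) = sum_list (map d (p @ q))"
    using mset_eq_length[OF m] by (simp, metis m mset_map sum_mset_sum_list)
  then have 1: "word_prod g (x # p @ q) - word_prod g (p @ x # q) \<in> W (length (x # v)) (sum_list (map d (x # v)))"
    using move_letter[of x p q] Cons.prems set by simp
  have 2: "g x * (word_prod g v - word_prod g (p @ q)) \<in> W (Suc (length v)) (d x + sum_list (map d v))"
    by (rule W_mult_left[OF Cons.IH[OF m]]) (use Cons.prems in auto)
  have "word_prod g (x # v) - word_prod g w = g x * (word_prod g v - word_prod g (p @ q)) +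
     (word_prod g (x # p @ q) - word_prod g (p @ x # q))"
    by (simp add: w right_diff_distrib)
  then show ?case using ugl.span_add[OF 2] 1 by simp
qed (simp add: ugl.span_zero)

text \<open>Replacing a word by its chosen rearrangement leaves an error in shorter words, so
  induction on the length bound applies.\<close>

lemma W_canonical:
  assumes can: "\<And>w. set w \<subseteq> K \<Longrightarrow> mset (can w) = mset w"
  shows "W n \<beta> \<subseteq> ugl.span (word_prod g ` can ` words K d c n \<beta>)"
proof (induction n)
  case 0
  then show ?case by (simp add: words_def)
next
  case (Suc n)
  let ?S = "\<lambda>n. ugl.span (word_prod g ` can ` words K d c n \<beta>)"
  have mono: "?S n \<subseteq> ?S (Suc n)" by (intro ugl.span_mono image_mono) (auto simp: words_def)
  have "word_prod g w \<in> ?S (Suc n)" if w: "w \<in> words K d c (Suc n) \<beta>" for w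
  proof -
    have "word_prod g w - word_prod g (can w) \<in> W (length w) (sum_list (map d w))"
      by (rule reorder) (use w can in \<open>auto simp: words_def\<close>)
    also have "\<dots> \<subseteq> W n \<beta>" using w W_mono[of "length w" n \<beta>] by (auto simp: words_def)
    finally have "word_prod g w - word_prod g (can w) \<in> ?S (Suc n)" using Suc mono by blast
    moreover have "word_prod g (can w) \<in> ?S (Suc n)" using w by (intro ugl.span_base) blast
    ultimately show ?thesis using ugl.span_add by fastforce
  qed
  then show ?case by (intro ugl.span_minimal) auto
qed

end

section \<open>The leading term of \<open>\<Theta>\<^sup>p\<close>\<close>

lemma U_h_0: "0 \<in> U_h" and U_h_1: "1 \<in> U_h" and U_h_h_elt: "h_elt a x \<in> U_h"
proof -
  show "0 \<in> U_h" using subalg.scalar[of 0] by simp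
  show "1 \<in> U_h" using subalg.scalar[of 1] by simp
  have E: "E i i \<in> U_h" for i by (intro subalg.gen imageI) simp
  have "h_elt a x = E a a + scalar (- 1) * E x x + scalar (form rho (root_vec (a, x)) - 1)"
    by (simp add: h_elt_eq)
  then show "h_elt a x \<in> U_h" by (simp only: E subalg.add subalg.mult subalg.scalar)
qed

lemma e_neg_eq: "e_neg \<alpha> = E (snd \<alpha>) (fst \<alpha>)"
  by (simp add: e_neg_def)

lemma U_h_E: "H \<in> U_h \<Longrightarrow> \<exists>H'\<in>U_h. H * E i j = E i j * H'"
proof (induction rule: subalg.induct)
  case (scalar c)
  then show ?case using subalg.scalar scalar_commute by blast
next
  case (gen x)
  then obtain h where h: "h \<in> cartan" "x = emb h" by blast
  then have "emb h + scalar (wt (eps i - eps j) h) \<in> U_h" by (auto intro: subalg.intros)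
  then show ?case using has_weightD[OF has_weight_E h(1)] h(2) by blast
next
  case (add x y)
  then obtain H H' where "H \<in> U_h" "H' \<in> U_h" "x * E i j = E i j * H" "y * E i j = E i j * H'" by blast
  then have "(x + y) * E i j = E i j * (H + H')" "H + H' \<in> U_h"
    by (simp_all add: distrib_left distrib_right subalg.add)
  then show ?case by blast
next
  case (mult x y)
  then obtain H H' where H: "H \<in> U_h" "H' \<in> U_h" "x * E i j = E i j * H" "y * E i j = E i j * H'" by blast
  have "x * y * E i j = x * E i j * H'" by (simp add: mult.assoc H(4))
  also have "\<dots> = E i j * (H * H')" by (simp add: mult.assoc H(3))
  finally show ?case using subalg.mult[OF H(1,2)] by blast
qed

lemma U_h_word: "H \<in> U_h \<Longrightarrow> \<exists>H'\<in>U_h. H * word_prod e_neg w = word_prod e_neg w * H'"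
proof (induction w arbitrary: H)
  case (Cons x w)
  obtain H' where H': "H' \<in> U_h" "H * e_neg x = e_neg x * H'" using U_h_E[OF Cons.prems] unfolding e_neg_eq by blast
  obtain H'' where H'': "H'' \<in> U_h" "H' * word_prod e_neg w = word_prod e_neg w * H''" using Cons.IH[OF H'(1)] by blast
  have "H * word_prod e_neg (x # w) = e_neg x * (H' * word_prod e_neg w)"
    by (simp add: mult.assoc[symmetric] H'(2))
  also have "\<dots> = word_prod e_neg (x # w) * H''" by (simp add: H''(2) mult.assoc)
  finally show ?case using H''(1) by blast
qed auto

text \<open>Additivity of d along i, j, k makes the bracket of two root vectors homogeneous; both
  \<open>root_vec\<close> and the zero grading have it.\<close>

lemma e_neg_reordering:
  assumes "\<And>i j k. d (i, j) + d (j, k) = d (i, k)"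
  shows "reordering e_neg pos_roots d c"
proof
  fix x y :: "'a \<times> 'a" assume *: "x \<in> pos_roots" "y \<in> pos_roots"
  obtain i j k l where xy: "x = (i, j)" "y = (k, l)" by (cases x; cases y) auto
  have ij: "i < j" "k < l" using * xy by (auto simp: pos_roots_def)
  let ?S = "ugl.span (word_prod e_neg ` words pos_roots d c 2 (d x + d y))"
  have letter: "e_neg z \<in> ?S" if "z \<in> pos_roots" "d z = d x + d y" for z
  proof (rule ugl.span_base)
    have "e_neg z = word_prod e_neg [z]" "[z] \<in> words pos_roots d c 2 (d x + d y)"
      using that by (simp_all add: words_def)
    then show "e_neg z \<in> word_prod e_neg ` words pos_roots d c 2 (d x + d y)" by blast
  qed
  have eq: "e_neg x * e_neg y - e_neg y * e_neg x = (if i = l then e_neg (k, j) else 0) - (if k = j then e_neg (i, l) else 0)"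
    by (simp add: xy e_neg_eq E_commutator)
  have "e_neg (k, j) \<in> ?S" if "i = l"
    using that ij assms[of k l j] by (intro letter) (auto simp: xy pos_roots_def add.commute)
  moreover have "e_neg (i, l) \<in> ?S" if "k = j"
    using that ij assms[of i j l] by (intro letter) (auto simp: xy pos_roots_def)
  ultimately show "e_neg x * e_neg y - e_neg y * e_neg x \<in> ?S"
    unfolding eq by (auto intro!: ugl.span_diff ugl.span_neg simp: ugl.span_zero)
qed

interpretation neg: reordering "e_neg :: 'm::{finite,linorder} \<times> 'm \<Rightarrow> 'm ugl" pos_roots root_vec False
  by (rule e_neg_reordering) (simp add: root_vec_def)

text \<open>PBW filtration of U(b^-) in weight -\<beta>. The right factor from U(h) has degree 0, so
  only the factors from n^- count.\<close>

definition filt :: "nat \<Rightarrow> 'm::{finite,linorder} weight \<Rightarrow> 'm ugl set" where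
  "filt n \<beta> = ugl.span {word_prod e_neg w * H | w H. w \<in> words pos_roots root_vec True n \<beta> \<and> H \<in> U_h}"

lemma filt_base: "w \<in> words pos_roots root_vec True n \<beta> \<Longrightarrow> H \<in> U_h \<Longrightarrow> word_prod e_neg w * H \<in> filt n \<beta>"
  unfolding filt_def by (rule ugl.span_base) blast

lemma filt_base': "w \<in> words pos_roots root_vec True n \<beta> \<Longrightarrow> word_prod e_neg w \<in> filt n \<beta>"
  using filt_base[OF _ U_h_1] by fastforce

lemma filt_mono: "n \<le> n' \<Longrightarrow> filt n \<beta> \<subseteq> filt n' \<beta>"
  unfolding filt_def by (intro ugl.span_mono) (force simp: words_def)

lemma filt_add: "u \<in> filt n \<beta> \<Longrightarrow> v \<in> filt n \<beta> \<Longrightarrow> u + v \<in> filt n \<beta>"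
  unfolding filt_def by (rule ugl.span_add)

lemma filt_diff: "u \<in> filt n \<beta> \<Longrightarrow> v \<in> filt n \<beta> \<Longrightarrow> u - v \<in> filt n \<beta>"
  unfolding filt_def by (rule ugl.span_diff)

lemma W_filt: "neg.W n \<beta> \<subseteq> filt n \<beta>"
proof (rule ugl.span_minimal)
  show "ugl.subspace (filt n \<beta>)" unfolding filt_def by (rule ugl.subspace_span)
  show "word_prod e_neg ` words pos_roots root_vec False n \<beta> \<subseteq> filt n \<beta>"
    using filt_base' by (fastforce simp: words_def)
qed

lemma filt_mult_U_h: "u \<in> filt n \<beta> \<Longrightarrow> H \<in> U_h \<Longrightarrow> u * H \<in> filt n \<beta>"
  unfolding filt_def
proof (induction rule: ugl.span_induct_alt)
  case (step r u u')
  then obtain w H' where w: "w \<in> words pos_roots root_vec True n \<beta>" "H' \<in> U_h" "u = word_prod e_neg w * H'" by blast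
  then have "u * H \<in> filt n \<beta>"
    using step.prems by (simp add: mult.assoc filt_base subalg.mult)
  then show ?case using step unfolding filt_def
    by (simp add: distrib_right mult.assoc ugl.span_add ugl.span_scale)
qed (simp add: ugl.span_zero)

text \<open>Both length bounds are strict, so lengths below m and below n add up to a length below m
  + n - 1.\<close>

lemma filt_mult:
  assumes "u \<in> filt m \<beta>" "v \<in> filt n \<gamma>"
  shows "u * v \<in> filt (m + n - 1) (\<beta> + \<gamma>)"
proof -
  have 1: "word_prod e_neg w * H * v \<in> filt (m + n - 1) (\<beta> + \<gamma>)"
    if w: "w \<in> words pos_roots root_vec True m \<beta>" and H: "H \<in> U_h" for w H
    using assms(2) unfolding filt_def[of n]
  proof (induction rule: ugl.span_induct_alt)
    case (step r u u')
    then obtain w' H' where w': "w' \<in> words pos_roots root_vec True n \<gamma>" "H' \<in> U_h" "u = word_prod e_neg w' * H'" by blast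
    obtain H'' where H'': "H'' \<in> U_h" "H * word_prod e_neg w' = word_prod e_neg w' * H''"
      using U_h_word[OF H] by blast
    have "word_prod e_neg w * H * u = word_prod e_neg (w @ w') * (H'' * H')"
      using H''(2) by (simp add: w'(3) mult.assoc[symmetric]) (simp add: mult.assoc)
    also have "\<dots> \<in> filt (m + n - 1) (\<beta> + \<gamma>)"
      by (rule filt_base) (use w w' H'' in \<open>auto simp: words_def intro: subalg.mult\<close>)
    finally show ?case using step unfolding filt_def
      by (simp add: distrib_left scalar_left_commute ugl.span_add ugl.span_scale)
  qed (simp add: filt_def ugl.span_zero)
  show ?thesis
    using assms(1) unfolding filt_def[of m]
  proof (induction rule: ugl.span_induct_alt)
    case (step r u u')
    then have "u * v \<in> filt (m + n - 1) (\<beta> + \<gamma>)" using 1 by auto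
    then show ?case using step unfolding filt_def
      by (simp add: distrib_right mult.assoc ugl.span_add ugl.span_scale)
  qed (simp add: filt_def ugl.span_zero)
qed

lemma root_vec_same [simp]: "root_vec (a, a) = 0"
  by (simp add: root_vec_def)

lemma simple_root_adjacent: "(c, b) \<in> simple_roots \<longleftrightarrow> adjacent c b"
  by (auto simp: simple_roots_def adjacent_def)

lemma simple_subset_pos: "simple_roots \<subseteq> pos_roots"
  by (auto simp: simple_roots_def pos_roots_def)

text \<open>In the recursion the commutator drops the PBW degree and the Cartan factor has degree 0,
  so the top term is the product of the \<open>E b c\<close> over all steps, a word in simple
  roots.\<close>

lemma Theta_leading:
  fixes a :: "'m::{finite,linorder}"
  assumes "a \<le> b"
  shows "\<exists>w. set w \<subseteq> simple_roots \<and> sum_list (map root_vec w) = root_vec (a, b) \<and>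
    Theta a b - word_prod e_neg w \<in> filt (length w) (root_vec (a, b))"
  using assms
proof (induction rule: adjacent_induct)
  case base
  show ?case by (rule exI[of _ "[]"]) (simp add: filt_def ugl.span_zero)
next
  case (step c b)
  then obtain w where w: "set w \<subseteq> simple_roots" "sum_list (map root_vec w) = root_vec (a, c)"
    and r: "Theta a c - word_prod e_neg w \<in> filt (length w) (root_vec (a, c))" by blast
  have cb: "(c, b) \<in> simple_roots" using step simple_root_adjacent by blast
  then have cb': "(c, b) \<in> pos_roots" using simple_subset_pos by blast
  have y: "E b c = e_neg (c, b)" by (simp add: e_neg_eq)
  let ?y = "e_neg (c, b)" and ?n = "Suc (length w)" and ?\<beta> = "root_vec (a, b)"
  let ?r = "Theta a c - word_prod e_neg w"
  have \<beta>: "root_vec (c, b) + root_vec (a, c) = ?\<beta>" "root_vec (a, c) + root_vec (c, b) = ?\<beta>"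
    by (simp_all add: root_vec_def)
  have "[(c, b)] \<in> words pos_roots root_vec True 2 (root_vec (c, b))" using cb' by (simp add: words_def)
  then have yf: "?y \<in> filt 2 (root_vec (c, b))" using filt_base' by fastforce
  have yr: "?y * ?r \<in> filt ?n ?\<beta>" "?r * ?y \<in> filt ?n ?\<beta>"
    using filt_mult[OF yf r] filt_mult[OF r yf] by (simp_all add: \<beta>)
  have "word_prod e_neg ((c, b) # w) - word_prod e_neg (w @ [(c, b)]) \<in> neg.W (length ((c, b) # w)) (sum_list (map root_vec ((c, b) # w)))"
    by (rule neg.reorder) (use cb' w simple_subset_pos in auto)
  then have yw: "?y * word_prod e_neg w - word_prod e_neg w * ?y \<in> filt ?n ?\<beta>"
    using W_filt w(2) \<beta> by (auto simp: word_prod_def)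
  have "(?y * word_prod e_neg w - word_prod e_neg w * ?y) + (?y * ?r - ?r * ?y) \<in> filt ?n ?\<beta>"
    by (intro filt_add filt_diff yr yw)
  then have "?y * Theta a c - Theta a c * ?y \<in> filt ?n ?\<beta>" by (simp add: algebra_simps)
  then have "?y * ?r + (?y * Theta a c - Theta a c * ?y) * h_elt a c \<in> filt ?n ?\<beta>"
    by (intro filt_add yr filt_mult_U_h U_h_h_elt)
  then have "Theta a b - word_prod e_neg ((c, b) # w) \<in> filt ?n ?\<beta>"
    unfolding Theta_rec[OF step.hyps] y by (simp add: algebra_simps)
  then show ?case using w cb \<beta> by (intro exI[of _ "(c, b) # w"]) simp
qed

lemma power_leading:
  fixes w :: "('m::{finite,linorder} \<times> 'm) list"
  assumes w: "set w \<subseteq> simple_roots" "sum_list (map root_vec w) = \<beta>"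
    and r: "u - word_prod e_neg w \<in> filt (length w) \<beta>"
  shows "\<exists>v. set v \<subseteq> simple_roots \<and> sum_list (map root_vec v) = of_nat p *s \<beta> \<and>
    u ^ p - word_prod e_neg v \<in> filt (length v) (of_nat p *s \<beta>)"
proof (induction p)
  case 0
  show ?case by (rule exI[of _ "[]"]) (simp add: filt_def ugl.span_zero)
next
  case (Suc p)
  then obtain v where v: "set v \<subseteq> simple_roots" "sum_list (map root_vec v) = of_nat p *s \<beta>"
    and s: "u ^ p - word_prod e_neg v \<in> filt (length v) (of_nat p *s \<beta>)" by blast
  let ?w = "word_prod e_neg w" and ?v = "word_prod e_neg v" and ?n = "length w + length v"
  define \<gamma> where "\<gamma> = of_nat (Suc p) *s \<beta>"
  have \<gamma>: "\<beta> + of_nat p *s \<beta> = \<gamma>" by (simp add: \<gamma>_def vector_sadd_rdistrib)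
  have wf: "?w \<in> filt (Suc (length w)) \<beta>"
    by (rule filt_base') (use w simple_subset_pos in \<open>auto simp: words_def\<close>)
  have vf: "?v \<in> filt (Suc (length v)) (of_nat p *s \<beta>)"
    by (rule filt_base') (use v simple_subset_pos in \<open>auto simp: words_def\<close>)
  have 1: "?w * (u ^ p - ?v) \<in> filt ?n \<gamma>" "(u - ?w) * ?v \<in> filt ?n \<gamma>"
    using filt_mult[OF wf s] filt_mult[OF r vf] by (simp_all add: \<gamma>)
  have 2: "(u - ?w) * (u ^ p - ?v) \<in> filt ?n \<gamma>"
    using filt_mult[OF r s] filt_mono[of "?n - 1" ?n] unfolding \<gamma> by auto
  have "u ^ Suc p - word_prod e_neg (w @ v) = ?w * (u ^ p - ?v) + (u - ?w) * ?v + (u - ?w) * (u ^ p - ?v)"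
    by (simp add: algebra_simps)
  then have "u ^ Suc p - word_prod e_neg (w @ v) \<in> filt ?n \<gamma>" using 1 2 by (simp add: filt_add)
  then show ?case using w v \<gamma> unfolding \<gamma>_def[symmetric] by (intro exI[of _ "w @ v"]) simp
qed

section \<open>Sums over partitions\<close>

definition partition_word :: "'i list \<Rightarrow> ('i \<Rightarrow> nat) \<Rightarrow> 'i list" where
  "partition_word rs \<pi> = concat (map (\<lambda>\<alpha>. replicate (\<pi> \<alpha>) \<alpha>) rs)"

lemma word_prod_replicate: "word_prod g (replicate n \<alpha>) = g \<alpha> ^ n"
  by (induction n) simp_all

lemma word_prod_partition_word: "word_prod e_neg (partition_word rs \<pi>) = e_neg_partition rs \<pi>"
  unfolding partition_word_def e_neg_partition_def by (induction rs) (simp_all add: word_prod_replicate)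

lemma count_partition_word:
  assumes "distinct rs"
  shows "count (mset (partition_word rs \<pi>)) \<alpha> = (if \<alpha> \<in> set rs then \<pi> \<alpha> else 0)"
  using assms unfolding partition_word_def by (induction rs) auto

lemma mset_partition_word_count:
  assumes "distinct rs" "set_mset M \<subseteq> set rs"
  shows "mset (partition_word rs (count M)) = M"
  using assms by (intro multiset_eqI) (auto simp: count_partition_word count_eq_zero_iff)

lemma sum_list_root_vec:
  fixes w :: "('m::{finite,linorder} \<times> 'm) list"
  assumes "set w \<subseteq> pos_roots"
  shows "sum_list (map root_vec w) = (\<Sum>\<alpha>\<in>pos_roots. of_nat (count (mset w) \<alpha>) *s root_vec \<alpha>)"
  using assms
proof (induction w)
  case (Cons x w)
  have "(\<Sum>\<alpha>\<in>pos_roots. of_nat (count (mset (x # w)) \<alpha>) *s root_vec \<alpha>) =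
    (\<Sum>\<alpha>\<in>pos_roots. (if \<alpha> = x then root_vec x else 0) + of_nat (count (mset w) \<alpha>) *s root_vec \<alpha>)"
    by (rule sum.cong) (auto simp: vector_sadd_rdistrib)
  also have "\<dots> = root_vec x + sum_list (map root_vec w)"
    using Cons by (simp add: sum.distrib)
  finally show ?case by simp
qed (simp add: vector_smult_lzero)

lemma count_word_partitions:
  assumes "w \<in> words pos_roots root_vec True n \<beta>"
  shows "count (mset w) \<in> partitions \<beta>"
  using assms sum_list_root_vec[of w] by (auto simp: words_def partitions_def)

text \<open>The degree has to be carried along: that no ordered monomial of degree n or more occurs
  is what later gives the coefficient 1 at \<pi>0.\<close>

lemma filt_partitions:
  fixes rs :: "('m::{finite,linorder} \<times> 'm) list"
  assumes rs: "distinct rs" "set rs = pos_roots" and u: "u \<in> filt n \<beta>"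
  shows "\<exists>H. (\<forall>\<pi>. H \<pi> \<in> U_h) \<and> (\<forall>\<pi>. sum \<pi> pos_roots \<ge> n \<longrightarrow> H \<pi> = 0) \<and>
    u = (\<Sum>\<pi>\<in>partitions \<beta>. e_neg_partition rs \<pi> * H \<pi>)"
proof -
  let ?T = "{u. \<exists>H. (\<forall>\<pi>. H \<pi> \<in> U_h) \<and> (\<forall>\<pi>. sum \<pi> pos_roots \<ge> n \<longrightarrow> H \<pi> = 0) \<and>
    u = (\<Sum>\<pi>\<in>partitions \<beta>. e_neg_partition rs \<pi> * H \<pi>)}"
  have add: "u + v \<in> ?T" if uv: "u \<in> ?T" "v \<in> ?T" for u v
  proof -
    obtain H H' where H: "\<forall>\<pi>. H \<pi> \<in> U_h" "\<forall>\<pi>. sum \<pi> pos_roots \<ge> n \<longrightarrow> H \<pi> = 0"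
        "u = (\<Sum>\<pi>\<in>partitions \<beta>. e_neg_partition rs \<pi> * H \<pi>)"
      and H': "\<forall>\<pi>. H' \<pi> \<in> U_h" "\<forall>\<pi>. sum \<pi> pos_roots \<ge> n \<longrightarrow> H' \<pi> = 0"
        "v = (\<Sum>\<pi>\<in>partitions \<beta>. e_neg_partition rs \<pi> * H' \<pi>)" using uv by auto
    show ?thesis
      by (rule CollectI, rule exI[of _ "\<lambda>\<pi>. H \<pi> + H' \<pi>"])
         (use H H' in \<open>simp add: subalg.add distrib_left sum.distrib\<close>)
  qed
  have U_h: "u * K \<in> ?T" if u: "u \<in> ?T" and K: "K \<in> U_h" for u K
  proof -
    obtain H where H: "\<forall>\<pi>. H \<pi> \<in> U_h" "\<forall>\<pi>. sum \<pi> pos_roots \<ge> n \<longrightarrow> H \<pi> = 0"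
        "u = (\<Sum>\<pi>\<in>partitions \<beta>. e_neg_partition rs \<pi> * H \<pi>)" using u by auto
    show ?thesis
      by (rule CollectI, rule exI[of _ "\<lambda>\<pi>. H \<pi> * K"])
         (use H K in \<open>simp add: subalg.mult sum_distrib_right mult.assoc\<close>)
  qed
  have zero: "0 \<in> ?T" by (rule CollectI, rule exI[of _ "\<lambda>_. 0"]) (simp add: U_h_0)
  have sub: "ugl.subspace ?T"
    unfolding ugl.subspace_def
  proof (intro conjI ballI allI)
    fix c u assume "u \<in> ?T"
    from U_h[OF this subalg.scalar[of c]] show "scalar c * u \<in> ?T" by (simp only: scalar_commute[of c u])
  qed (fact zero, rule add)
  have base: "e_neg_partition rs \<pi> \<in> ?T" if "\<pi> \<in> partitions \<beta>" "sum \<pi> pos_roots < n" for \<pi>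
  proof (rule CollectI, rule exI[of _ "\<lambda>\<sigma>. if \<sigma> = \<pi> then 1 else 0"], intro conjI)
    show "e_neg_partition rs \<pi> = (\<Sum>\<sigma>\<in>partitions \<beta>. e_neg_partition rs \<sigma> * (if \<sigma> = \<pi> then 1 else 0))"
      using that by (simp add: finite_partitions if_distrib[of "\<lambda>z. _ * z"] cong: if_cong)
  qed (use that U_h_0 U_h_1 in auto)
  let ?can = "\<lambda>w. partition_word rs (count (mset w))"
  have can: "mset (?can w) = mset w" if "set w \<subseteq> pos_roots" for w
    using that rs by (intro mset_partition_word_count) auto
  have word: "word_prod e_neg w \<in> ?T" if w: "w \<in> words pos_roots root_vec True n \<beta>" for w
  proof -
    have canT: "word_prod e_neg (?can v) \<in> ?T" if v: "v \<in> words pos_roots root_vec True n \<beta>" for v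
    proof -
      have "sum (count (mset v)) pos_roots = length v"
        using v unfolding words_def by (metis (mono_tags, lifting) finite mem_Collect_eq set_mset_mset size_mset size_multiset_overloaded_eq sum.mono_neutral_left count_eq_zero_iff DiffD2)
      then show ?thesis unfolding word_prod_partition_word
        using count_word_partitions[OF v] v by (intro base) (auto simp: words_def)
    qed
    have "neg.W n \<beta> \<subseteq> ?T"
    proof -
      have "neg.W n \<beta> \<subseteq> ugl.span (word_prod e_neg ` ?can ` words pos_roots root_vec False n \<beta>)"
        by (rule neg.W_canonical) (rule can)
      also have "\<dots> \<subseteq> ?T"
        by (rule ugl.span_minimal[OF _ sub]) (use canT in \<open>auto simp: words_def\<close>)
      finally show ?thesis .
    qed
    moreover have "word_prod e_neg w - word_prod e_neg (?can w) \<in> neg.W (length w) \<beta>"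
      using neg.reorder[of w "?can w"] can[of w] w by (simp add: words_def)
    moreover have "neg.W (length w) \<beta> \<subseteq> neg.W n \<beta>" using w by (intro neg.W_mono) (auto simp: words_def)
    ultimately have "word_prod e_neg w - word_prod e_neg (?can w) \<in> ?T" by blast
    from add[OF this canT[OF w]] show ?thesis by simp
  qed
  have "filt n \<beta> \<subseteq> ?T"
    unfolding filt_def by (rule ugl.span_minimal[OF _ sub]) (use word U_h in blast)
  then show ?thesis using u by auto
qed

lemma simple_partition_unique:
  assumes \<pi>: "\<pi> \<in> partitions \<beta>" "\<forall>\<alpha>. \<alpha> \<notin> simple_roots \<longrightarrow> \<pi> \<alpha> = 0"
    and \<sigma>: "\<sigma> \<in> partitions \<beta>" "\<forall>\<alpha>. \<alpha> \<notin> simple_roots \<longrightarrow> \<sigma> \<alpha> = 0"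
  shows "\<pi> = \<sigma>"
proof -
  \<comment> \<open>Summing the coordinates up to i is pairing with the fundamental coweight dual to
    the simple root (i, j), so it reads off the coefficient of that root.\<close>
  have val: "of_nat (\<pi> (i, j)) = (\<Sum>k\<in>{..i}. \<beta> $ k)"
    if \<pi>: "\<pi> \<in> partitions \<beta>" "\<forall>\<alpha>. \<alpha> \<notin> simple_roots \<longrightarrow> \<pi> \<alpha> = 0" and ij: "(i, j) \<in> simple_roots"
    for \<pi> i j
  proof -
    have lt: "x < j \<longleftrightarrow> x \<le> i" "i < x \<longleftrightarrow> j \<le> x" for x
      using ij by (simp_all add: simple_root_adjacent adjacent_cases adjacent_greater)
    have root: "(\<Sum>k\<in>{..i}. root_vec \<alpha> $ k) = (if \<alpha> = (i, j) then 1 else 0)" if "\<alpha> \<in> simple_roots" for \<alpha>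
    proof -
      obtain x y where xy: "\<alpha> = (x, y)" by (cases \<alpha>)
      have xy': "z < y \<longleftrightarrow> z \<le> x" "x < z \<longleftrightarrow> y \<le> z" for z
        using that by (simp_all add: xy simple_root_adjacent adjacent_cases adjacent_greater)
      have "(\<Sum>k\<in>{..i}. root_vec \<alpha> $ k) = (if x \<le> i then 1 else 0) - (if y \<le> i then 1 else 0)"
        by (simp add: xy root_vec_def eps_nth sum_subtractf)
      moreover have "x = i \<longleftrightarrow> y = j" using lt xy' by (metis order.antisym order.refl linorder_not_le)
      moreover have "y \<le> i \<longleftrightarrow> x < i" using xy' by simp
      ultimately show ?thesis using xy by auto
    qed
    have "(\<Sum>k\<in>{..i}. \<beta> $ k) = (\<Sum>k\<in>{..i}. \<Sum>\<alpha>\<in>pos_roots. of_nat (\<pi> \<alpha>) * root_vec \<alpha> $ k)"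
      using \<pi>(1) unfolding partitions_def by (simp, metis (no_types, lifting) sum.cong sum_component vector_smult_component)
    also have "\<dots> = (\<Sum>\<alpha>\<in>pos_roots. of_nat (\<pi> \<alpha>) * (\<Sum>k\<in>{..i}. root_vec \<alpha> $ k))"
      by (subst sum.swap) (simp add: sum_distrib_left)
    also have "\<dots> = (\<Sum>\<alpha>\<in>pos_roots. if \<alpha> = (i, j) then of_nat (\<pi> (i, j)) else 0)"
    proof (intro sum.cong refl)
      fix \<alpha>
      show "of_nat (\<pi> \<alpha>) * (\<Sum>k\<in>{..i}. root_vec \<alpha> $ k) = (if \<alpha> = (i, j) then of_nat (\<pi> (i, j)) else 0)"
      proof (cases "\<alpha> \<in> simple_roots")
        case True
        from root[OF this] show ?thesis by simp
      next
        case False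
        then have "\<pi> \<alpha> = 0" "\<alpha> \<noteq> (i, j)" using \<pi>(2) ij by blast+
        then show ?thesis by simp
      qed
    qed
    also have "\<dots> = of_nat (\<pi> (i, j))"
    proof -
      have "(i, j) \<in> pos_roots" using ij simple_subset_pos by blast
      then show ?thesis by simp
    qed
    finally show ?thesis by simp
  qed
  show ?thesis
  proof
    fix \<alpha> :: "'a \<times> 'a"
    show "\<pi> \<alpha> = \<sigma> \<alpha>"
      using val[OF \<pi>] val[OF \<sigma>] \<pi>(2) \<sigma>(2) by (cases "\<alpha> \<in> simple_roots"; cases \<alpha>) (simp_all, metis of_nat_eq_iff)
  qed
qed

lemma sum_partitions_U_b_minus:
  assumes "\<And>\<pi>. \<pi> \<in> A \<Longrightarrow> H \<pi> \<in> U_h" and "set rs = pos_roots"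
  shows "(\<Sum>\<pi>\<in>A. e_neg_partition rs \<pi> * H \<pi>) \<in> U_b_minus"
proof -
  have h: "u \<in> U_b_minus" if "u \<in> U_h" for u
    using that
  proof (induction rule: subalg.induct)
    case (gen x)
    then show ?case by (intro subalg.gen) (auto simp: cartan_def b_minus_def)
  qed (auto intro: subalg.intros)
  have sum: "sum f A \<in> U_b_minus" if "\<And>\<pi>. \<pi> \<in> A \<Longrightarrow> f \<pi> \<in> U_b_minus" for f and A :: "'c set"
    using that subalg.scalar[of 0] by (induction A rule: infinite_finite_induct) (auto intro: subalg.add)
  have e: "e_neg \<alpha> \<in> U_b_minus" if "\<alpha> \<in> pos_roots" for \<alpha>
    using that unfolding e_neg_eq by (intro subalg.gen imageI) (auto simp: pos_roots_def b_minus_def)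
  have w: "word_prod e_neg w \<in> U_b_minus" if "set w \<subseteq> pos_roots" for w
    using that subalg.scalar[of 1] e by (induction w) (auto intro: subalg.mult)
  have "e_neg_partition rs \<pi> \<in> U_b_minus" for \<pi>
    unfolding word_prod_partition_word[symmetric]
    by (rule w) (auto simp: partition_word_def assms(2)[symmetric])
  then show ?thesis using assms(1) h by (intro sum subalg.mult) auto
qed

text \<open>The power of \<Theta> and the ordered monomial of \<pi>0 differ by an element of degree
  smaller than that of \<pi>0. Its expansion in ordered monomials adds nothing at \<pi>0, so the
  coefficient there is exactly 1.\<close>

lemma shapovalov_Theta_power:
  fixes a b :: "'m::{finite,linorder}" and rs :: "('m \<times> 'm) list"
  assumes "a < b" and rs: "distinct rs" "set rs = pos_roots"
  shows "shapovalov_element rs (a, b) p (Theta a b ^ p)"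
proof -
  let ?\<beta> = "of_nat p *s root_vec (a, b)" and ?u = "Theta a b ^ p"
  obtain w where "set w \<subseteq> simple_roots" "sum_list (map root_vec w) = root_vec (a, b)"
    "Theta a b - word_prod e_neg w \<in> filt (length w) (root_vec (a, b))"
    using Theta_leading[OF less_imp_le[OF assms(1)]] by blast
  from power_leading[OF this, of p] obtain v where v: "set v \<subseteq> simple_roots" "sum_list (map root_vec v) = ?\<beta>"
    "?u - word_prod e_neg v \<in> filt (length v) ?\<beta>" by blast
  have vp: "set v \<subseteq> pos_roots" using v(1) simple_subset_pos by blast
  define \<pi>0 where "\<pi>0 = count (mset v)"
  have \<pi>0: "\<pi>0 \<in> partitions ?\<beta>"
    unfolding \<pi>0_def by (rule count_word_partitions[of _ "Suc (length v)"]) (use vp v in \<open>auto simp: words_def\<close>)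
  have size: "sum \<pi>0 pos_roots = length v"
    unfolding \<pi>0_def using vp by (metis (mono_tags, lifting) finite set_mset_mset size_mset size_multiset_overloaded_eq sum.mono_neutral_left count_eq_zero_iff DiffD2)
  have "mset (partition_word rs \<pi>0) = mset v"
    unfolding \<pi>0_def by (rule mset_partition_word_count) (use rs vp in auto)
  then have "word_prod e_neg v - e_neg_partition rs \<pi>0 \<in> neg.W (length v) ?\<beta>"
    using neg.reorder[of v "partition_word rs \<pi>0"] vp v(2) by (simp add: word_prod_partition_word)
  then have "(?u - word_prod e_neg v) + (word_prod e_neg v - e_neg_partition rs \<pi>0) \<in> filt (length v) ?\<beta>"
    using W_filt by (intro filt_add v) blast
  then have "?u - e_neg_partition rs \<pi>0 \<in> filt (length v) ?\<beta>" by simp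
  from filt_partitions[OF rs this] obtain H where H: "\<forall>\<pi>. H \<pi> \<in> U_h" "\<forall>\<pi>. sum \<pi> pos_roots \<ge> length v \<longrightarrow> H \<pi> = 0"
    "?u - e_neg_partition rs \<pi>0 = (\<Sum>\<pi>\<in>partitions ?\<beta>. e_neg_partition rs \<pi> * H \<pi>)"
    by blast
  define H' where "H' \<pi> = H \<pi> + (if \<pi> = \<pi>0 then 1 else 0)" for \<pi>
  have H': "H' \<pi> \<in> U_h" for \<pi> unfolding H'_def using H(1) U_h_0 U_h_1 by (auto intro: subalg.add)
  have u: "?u = (\<Sum>\<pi>\<in>partitions ?\<beta>. e_neg_partition rs \<pi> * H' \<pi>)"
    using H(3) \<pi>0 by (simp add: H'_def distrib_left sum.distrib finite_partitions diff_eq_eq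
      if_distrib[of "\<lambda>z. _ * z"] cong: if_cong)
  have one: "H' \<pi> = 1" if "\<pi> \<in> partitions ?\<beta>" "\<forall>\<alpha>. \<alpha> \<notin> simple_roots \<longrightarrow> \<pi> \<alpha> = 0" for \<pi>
  proof -
    have "\<pi> = \<pi>0"
      by (rule simple_partition_unique[OF that \<pi>0]) (use v(1) in \<open>auto simp: \<pi>0_def count_eq_zero_iff\<close>)
    then show ?thesis using H(2) size by (simp add: H'_def)
  qed
  have wt: "has_weight ?u (- ?\<beta>)"
  proof -
    have "of_nat p *s (eps b - eps a) = - ?\<beta>"
      by (simp add: vec_eq_iff root_vec_def algebra_simps)
    then show ?thesis
      using has_weight_power[OF Theta_weight[of a b], of p] assms(1) by simp
  qed
  show ?thesis
    unfolding shapovalov_element_def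
  proof (intro conjI ballI)
    show "?u \<in> U_b_minus" unfolding u by (rule sum_partitions_U_b_minus) (use H' rs in auto)
    show "has_weight ?u (- ?\<beta>)" by (rule wt)
    show "\<exists>H. (\<forall>\<pi>\<in>partitions ?\<beta>. H \<pi> \<in> U_h) \<and> ?u = (\<Sum>\<pi>\<in>partitions ?\<beta>. e_neg_partition rs \<pi> * H \<pi>) \<and>
          (\<forall>\<pi>\<in>partitions ?\<beta>. (\<forall>\<alpha>. \<alpha> \<notin> simple_roots \<longrightarrow> \<pi> \<alpha> = 0) \<longrightarrow> H \<pi> = 1)"
      using H' u one by blast
  next
    fix \<alpha> :: "'m \<times> 'm" assume "\<alpha> \<in> pos_roots"
    then show "\<exists>x. \<exists>v\<in>left_ideal_gen (emb ` n_plus). e_pos \<alpha> * ?u = x * (emb (coroot (root_vec (a, b))) +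
        scalar (wt rho (coroot (root_vec (a, b))) - of_nat p * form (root_vec (a, b)) (root_vec (a, b)) / 2)) + v"
      using Theta_power_singular[OF assms(1), of "fst \<alpha>" "snd \<alpha>" p] shapovalov_factor_eq[of a b p] assms(1)
      by (auto simp: pos_roots_def e_pos_def)
  qed
qed

section \<open>Independence half of PBW by an action on polynomials\<close>

section \<open>The action on the symmetric algebra\<close>

type_synonym 'm sym = "('m \<times> 'm) multiset \<Rightarrow>\<^sub>0 complex"

text \<open>The Leibniz rule on the monomial with multiset M and coefficient c, for the derivation
  sending the variable v to \<open>h v\<close>; the sum over the multiset counts repeated
  variables.\<close>

definition deriv_term :: "('v \<Rightarrow> 'v multiset \<Rightarrow>\<^sub>0 complex) \<Rightarrow> 'v multiset \<Rightarrow> complex \<Rightarrow> 'v multiset \<Rightarrow>\<^sub>0 complex" where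
  "deriv_term h M c = (\<Sum>v\<in>#M. Poly_Mapping.single (M - {#v#}) c * h v)"

definition derivation :: "('v \<Rightarrow> 'v multiset \<Rightarrow>\<^sub>0 complex) \<Rightarrow> ('v multiset \<Rightarrow>\<^sub>0 complex) \<Rightarrow> 'v multiset \<Rightarrow>\<^sub>0 complex" where
  "derivation h f = (\<Sum>M\<in>Poly_Mapping.keys f. deriv_term h M (Poly_Mapping.lookup f M))"

lemma deriv_term_0 [simp]: "deriv_term h M 0 = 0"
  by (simp add: deriv_term_def)

lemma deriv_term_add: "deriv_term h M (c + d) = deriv_term h M c + deriv_term h M d"
  by (simp add: deriv_term_def single_add distrib_right sum_mset.distrib)

lemma derivation_superset:
  "finite A \<Longrightarrow> Poly_Mapping.keys f \<subseteq> A \<Longrightarrow> derivation h f = (\<Sum>M\<in>A. deriv_term h M (Poly_Mapping.lookup f M))"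
  unfolding derivation_def by (rule sum.mono_neutral_left) (auto simp: in_keys_iff)

lemma derivation_single: "derivation h (Poly_Mapping.single M c) = deriv_term h M c"
  by (subst derivation_superset[of "{M}"]) auto

lemma derivation_add: "derivation h (f + g) = derivation h f + derivation h g"
proof -
  let ?A = "Poly_Mapping.keys f \<union> Poly_Mapping.keys g"
  have "Poly_Mapping.keys (f + g) \<subseteq> ?A" by (rule keys_add)
  then show ?thesis
    by (simp add: derivation_superset[of ?A] lookup_add deriv_term_add sum.distrib)
qed

lemma derivation_mult: "derivation h (f * g) = derivation h f * g + f * derivation h g"
proof (induction f rule: poly_mapping_add_induct)
  case (single M c)
  show ?case
  proof (induction g rule: poly_mapping_add_induct)
    case (single N d)
    have 1: "(\<Sum>v\<in>#M. Poly_Mapping.single (M + N - {#v#}) (c * d) * h v) =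
        (\<Sum>v\<in>#M. Poly_Mapping.single N d * (Poly_Mapping.single (M - {#v#}) c * h v))"
    proof (rule arg_cong[of _ _ sum_mset], rule image_mset_cong)
      fix v assume "v \<in># M"
      then have "M + N - {#v#} = N + (M - {#v#})" by (metis add.commute diff_union_single_conv)
      then show "Poly_Mapping.single (M + N - {#v#}) (c * d) * h v = Poly_Mapping.single N d * (Poly_Mapping.single (M - {#v#}) c * h v)"
        by (simp add: mult.assoc[symmetric] mult_single mult.commute[of c d])
    qed
    have 2: "(\<Sum>v\<in>#N. Poly_Mapping.single (M + N - {#v#}) (c * d) * h v) =
        (\<Sum>v\<in>#N. Poly_Mapping.single M c * (Poly_Mapping.single (N - {#v#}) d * h v))"
    proof (rule arg_cong[of _ _ sum_mset], rule image_mset_cong)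
      fix v assume "v \<in># N"
      then have "M + N - {#v#} = M + (N - {#v#})" by (metis diff_union_single_conv)
      then show "Poly_Mapping.single (M + N - {#v#}) (c * d) * h v = Poly_Mapping.single M c * (Poly_Mapping.single (N - {#v#}) d * h v)"
        by (simp add: mult.assoc[symmetric] mult_single)
    qed
    have "derivation h (Poly_Mapping.single M c * Poly_Mapping.single N d) =
        (\<Sum>v\<in>#M. Poly_Mapping.single (M + N - {#v#}) (c * d) * h v) + (\<Sum>v\<in>#N. Poly_Mapping.single (M + N - {#v#}) (c * d) * h v)"
      by (simp only: mult_single derivation_single deriv_term_def image_mset_union sum_mset.union)
    also have "\<dots> = Poly_Mapping.single N d * derivation h (Poly_Mapping.single M c) +
        Poly_Mapping.single M c * derivation h (Poly_Mapping.single N d)"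
      by (simp only: 1 2 derivation_single deriv_term_def sum_mset_distrib_left)
    finally show ?case by (simp only: mult.commute)
  next
    case (add f g)
    then show ?case by (simp add: distrib_left derivation_add)
  qed
next
  case (add f f')
  then show ?case by (simp add: distrib_right derivation_add)
qed

lemma derivation_0 [simp]: "derivation h 0 = 0"
  by (simp add: derivation_def)

lemma derivation_const [simp]: "derivation h (Poly_Mapping.single {#} c) = 0"
  by (simp add: derivation_single deriv_term_def)

lemma derivation_sum: "derivation h (sum f A) = (\<Sum>i\<in>A. derivation h (f i))"
  by (induction A rule: infinite_finite_induct) (simp_all add: derivation_add)

lemma derivation_var: "derivation h (Poly_Mapping.single {#v#} c) = Poly_Mapping.single {#} c * h v"
  by (simp add: derivation_single deriv_term_def)

lemma derivation_add_fun: "derivation (\<lambda>v. h v + h' v) f = derivation h f + derivation h' f"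
  by (simp add: derivation_def deriv_term_def distrib_left sum_mset.distrib sum.distrib)

lemma derivation_mult_fun: "derivation (\<lambda>v. k * h v) f = k * derivation h f"
  by (simp add: derivation_def deriv_term_def sum_mset_distrib_left sum_distrib_left mult.left_commute)

lemma derivation_like_eq_0:
  assumes add: "\<And>f g. \<delta> (f + g) = \<delta> f + \<delta> g"
    and mult: "\<And>f g. \<delta> (f * g) = \<delta> f * g + f * \<delta> (g :: 'v multiset \<Rightarrow>\<^sub>0 complex)"
    and const: "\<And>c. \<delta> (Poly_Mapping.single {#} c) = 0" and var: "\<And>v. \<delta> (Poly_Mapping.single {#v#} 1) = 0"
  shows "\<delta> f = 0"
proof (induction f rule: poly_mapping_add_induct)
  case (single M c)
  show ?case
  proof (induction M)
    case (add v M)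
    have "Poly_Mapping.single (add_mset v M) c = Poly_Mapping.single {#v#} 1 * Poly_Mapping.single M c"
      by (simp add: mult_single)
    then show ?case using add by (simp add: mult var)
  qed (simp add: const)
qed (simp add: add)

text \<open>The variable with index \<open>(i, j)\<close> corresponds to \<open>E j i\<close>, so that it matches \<open>e_neg (i, j)\<close>.\<close>

definition lin :: "'m gl \<Rightarrow> 'm::finite sym" where
  "lin x = (\<Sum>\<alpha>\<in>UNIV. Poly_Mapping.single {#\<alpha>#} (x $ snd \<alpha> $ fst \<alpha>))"

abbreviation const :: "complex \<Rightarrow> 'm::finite sym" where
  "const c \<equiv> Poly_Mapping.single {#} c"

lemma lin_add: "lin (x + y) = lin x + lin y"
  by (simp add: lin_def single_add sum.distrib)

lemma lin_scale: "lin (mat_scale c x) = const c * lin x"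
  by (simp add: lin_def mat_scale_def map_matrix_def sum_distrib_left mult_single)

lemma lin_diff: "lin (x - y) = lin x - lin y"
  by (simp add: lin_def single_diff sum_subtractf)

lemma lin_sum: "lin (sum f A) = (\<Sum>i\<in>A. lin (f i))"
  by (induction A rule: infinite_finite_induct) (simp_all add: lin_add, simp_all add: lin_def)

lemma lin_mat_unit: "lin (mat_unit j i) = Poly_Mapping.single {#(i, j)#} 1"
proof -
  have "Poly_Mapping.single {#\<alpha>#} ((mat_unit j i :: 'a gl) $ snd \<alpha> $ fst \<alpha>) =
    (if \<alpha> = (i, j) then Poly_Mapping.single {#(i, j)#} 1 else 0)" for \<alpha>
    by (cases \<alpha>) simp
  then show ?thesis by (simp add: lin_def)
qed

definition left_deriv :: "'m gl \<Rightarrow> 'm sym \<Rightarrow> 'm::finite sym" where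
  "left_deriv x = derivation (\<lambda>\<alpha>. lin (x ** mat_unit (snd \<alpha>) (fst \<alpha>)))"

lemma sum_UNIV_prod: "(\<Sum>\<alpha>\<in>UNIV. f \<alpha>) = (\<Sum>l\<in>UNIV. \<Sum>k\<in>UNIV. f (l, k))"
  by (simp add: sum.cartesian_product)

lemma left_deriv_lin: "left_deriv x (lin y) = lin (x ** y)"
proof -
  have "left_deriv x (lin y) = (\<Sum>\<alpha>\<in>UNIV. const (y $ snd \<alpha> $ fst \<alpha>) * lin (x ** mat_unit (snd \<alpha>) (fst \<alpha>)))"
    by (simp add: left_deriv_def lin_def[of y] derivation_sum derivation_var)
  also have "\<dots> = lin (\<Sum>\<alpha>\<in>UNIV. mat_scale (y $ snd \<alpha> $ fst \<alpha>) (x ** mat_unit (snd \<alpha>) (fst \<alpha>)))"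
    by (simp add: lin_sum lin_scale)
  also have "(\<Sum>\<alpha>\<in>UNIV. mat_scale (y $ snd \<alpha> $ fst \<alpha>) (x ** mat_unit (snd \<alpha>) (fst \<alpha>))) = x ** y"
  proof -
    have "(\<Sum>\<alpha>\<in>UNIV. mat_scale (y $ snd \<alpha> $ fst \<alpha>) (x ** mat_unit (snd \<alpha>) (fst \<alpha>)) $ i $ j) = (x ** y) $ i $ j" for i j
    proof -
      have "(x ** mat_unit k l) $ i $ j = (if j = l then x $ i $ k else 0)" for k l
        by (simp add: matrix_matrix_mult_def if_distrib[of "\<lambda>z. _ * z"] cong: if_cong)
      then have "(\<Sum>\<alpha>\<in>UNIV. mat_scale (y $ snd \<alpha> $ fst \<alpha>) (x ** mat_unit (snd \<alpha>) (fst \<alpha>)) $ i $ j)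
        = (\<Sum>l\<in>UNIV. \<Sum>k\<in>UNIV. if j = l then y $ k $ l * x $ i $ k else 0)"
        by (simp add: mat_scale_def map_matrix_def sum_UNIV_prod if_distrib[of "\<lambda>z. _ * z"] cong: if_cong)
      also have "\<dots> = (\<Sum>l\<in>UNIV. if j = l then \<Sum>k\<in>UNIV. y $ k $ l * x $ i $ k else 0)"
        by (intro sum.cong refl) auto
      also have "\<dots> = (x ** y) $ i $ j"
        by (simp add: matrix_matrix_mult_def mult.commute)
      finally show ?thesis .
    qed
    then show ?thesis by (simp add: vec_eq_iff)
  qed
  finally show ?thesis .
qed

definition left_op :: "'m gl \<Rightarrow> 'm sym \<Rightarrow> 'm::finite sym" where
  "left_op x f = lin x * f + left_deriv x f"

lemma left_op_add: "left_op x (f + g) = left_op x f + left_op x g"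
  by (simp add: left_op_def left_deriv_def derivation_add distrib_left)

lemma left_op_const: "left_op x (const c * f) = const c * left_op x f"
  by (simp add: left_op_def left_deriv_def derivation_mult distrib_left mult.left_commute)

lemma left_op_0 [simp]: "left_op x 0 = 0"
  by (simp add: left_op_def left_deriv_def)

lemma matrix_mult_add_left: "(x + y) ** z = x ** z + y ** (z :: 'm::finite gl)"
  by (simp add: vec_eq_iff matrix_matrix_mult_def distrib_right sum.distrib)

lemma matrix_mult_diff_left: "(x - y) ** z = x ** z - y ** (z :: 'm::finite gl)"
  by (simp add: vec_eq_iff matrix_matrix_mult_def left_diff_distrib sum_subtractf)

lemma mat_scale_mult: "mat_scale c x ** y = mat_scale c (x ** y)"
  by (simp add: vec_eq_iff mat_scale_def map_matrix_def matrix_matrix_mult_def sum_distrib_left mult.assoc)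

lemma left_op_plus: "left_op (x + y) f = left_op x f + left_op y f"
  by (simp add: left_op_def left_deriv_def lin_add matrix_mult_add_left derivation_add_fun distrib_right)

lemma left_op_scale: "left_op (mat_scale c x) f = const c * left_op x f"
  by (simp add: left_op_def left_deriv_def lin_scale mat_scale_mult derivation_mult_fun distrib_left mult.assoc)

text \<open>A commutator of derivations is a derivation, so it is enough to compare on variables,
  where the identity is associativity of the matrix product.\<close>

lemma left_deriv_commutator:
  "left_deriv x (left_deriv y f) - left_deriv y (left_deriv x f) = left_deriv (lie_bracket x y) f"
proof -
  let ?\<delta> = "\<lambda>f. left_deriv x (left_deriv y f) - left_deriv y (left_deriv x f) - left_deriv (lie_bracket x y) f"
  have "?\<delta> f = 0"
  proof (rule derivation_like_eq_0[where \<delta> = ?\<delta>])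
    show "?\<delta> (f + g) = ?\<delta> f + ?\<delta> g" for f g
      by (simp add: left_deriv_def derivation_add)
    show "?\<delta> (f * g) = ?\<delta> f * g + f * ?\<delta> g" for f g
      by (simp add: left_deriv_def derivation_add derivation_mult algebra_simps)
    show "?\<delta> (const c) = 0" for c
      by (simp add: left_deriv_def)
    show "?\<delta> (Poly_Mapping.single {#v#} 1) = 0" for v
    proof -
      have "Poly_Mapping.single {#v#} 1 = lin (mat_unit (snd v) (fst v))" by (simp add: lin_mat_unit)
      then show ?thesis
        by (simp add: left_deriv_lin lie_bracket_def matrix_mul_assoc lin_diff[symmetric] matrix_mult_diff_left)
    qed
  qed
  then show ?thesis by simp
qed

text \<open>The bracket relation holds because \<open>left_deriv x\<close> acts on linear forms by left multiplication with
  \<open>x\<close>, so that the two cross terms combine to \<open>lin (x ** y) - lin (y ** x)\<close>.\<close>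

lemma left_op_bracket:
  "left_op x (left_op y f) - left_op y (left_op x f) = left_op (lie_bracket x y) f"
proof -
  have "left_op x (left_op y f) - left_op y (left_op x f) =
    (lin (x ** y) - lin (y ** x)) * f + (left_deriv x (left_deriv y f) - left_deriv y (left_deriv x f))"
    unfolding left_op_def
    by (simp add: left_deriv_def derivation_add derivation_mult)
       (simp add: left_deriv_def[symmetric] left_deriv_lin algebra_simps)
  then show ?thesis
    by (simp add: left_deriv_commutator left_op_def lie_bracket_def lin_diff)
qed

primrec act_word :: "'m gl fword \<Rightarrow> 'm sym \<Rightarrow> 'm::finite sym" where
  "act_word (FWord l) s = foldr left_op l s"

definition act_free :: "('m::finite gl fword \<Rightarrow>\<^sub>0 complex) \<Rightarrow> 'm sym \<Rightarrow> 'm sym" where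
  "act_free f s = (\<Sum>w\<in>Poly_Mapping.keys f. const (Poly_Mapping.lookup f w) * act_word w s)"

lemma act_free_superset:
  "finite A \<Longrightarrow> Poly_Mapping.keys f \<subseteq> A \<Longrightarrow> act_free f s = (\<Sum>w\<in>A. const (Poly_Mapping.lookup f w) * act_word w s)"
  unfolding act_free_def by (rule sum.mono_neutral_left) (auto simp: in_keys_iff)

lemma act_free_single: "act_free (Poly_Mapping.single w c) s = const c * act_word w s"
  by (subst act_free_superset[of "{w}"]) auto

lemma act_free_add: "act_free (f + g) s = act_free f s + act_free g s"
proof -
  let ?A = "Poly_Mapping.keys f \<union> Poly_Mapping.keys g"
  have "Poly_Mapping.keys (f + g) \<subseteq> ?A" by (rule keys_add)
  then show ?thesis
    by (simp add: act_free_superset[of ?A] lookup_add single_add distrib_right sum.distrib)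
qed

lemma act_word_add: "act_word w (s + t) = act_word w s + act_word w t"
proof (cases w)
  case (FWord l)
  have "foldr left_op l (s + t) = foldr left_op l s + foldr left_op l t"
    by (induction l) (simp_all add: left_op_add)
  then show ?thesis by (simp add: FWord)
qed

lemma act_word_const: "act_word w (const c * s) = const c * act_word w s"
proof (cases w)
  case (FWord l)
  have "foldr left_op l (const c * s) = const c * foldr left_op l s"
    by (induction l) (simp_all add: left_op_const)
  then show ?thesis by (simp add: FWord)
qed

lemma act_word_plus: "act_word (v + w) s = act_word v (act_word w s)"
  by (cases v; cases w) simp

lemma act_free_add_right: "act_free f (s + t) = act_free f s + act_free f t"
  by (simp add: act_free_def act_word_add distrib_left sum.distrib)

lemma act_free_0_right [simp]: "act_free f 0 = 0"
  using act_free_add_right[of f 0 0] by simp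

lemma act_free_mult: "act_free (f * g) s = act_free f (act_free g s)"
proof (induction f rule: poly_mapping_add_induct)
  case (single v c)
  show ?case
  proof (induction g rule: poly_mapping_add_induct)
    case (single w d)
    then show ?case
      by (simp add: mult_single act_free_single act_word_plus act_word_const mult.assoc[symmetric])
  qed (simp add: distrib_left act_free_add act_free_add_right)
qed (simp add: distrib_right act_free_add)

lemma act_free_uminus: "act_free (- f) s = - act_free f s"
proof -
  have "act_free f s + act_free (- f) s = 0"
    using act_free_add[of f "- f" s] by (simp add: act_free_def[of 0])
  then show ?thesis by (rule minus_unique[symmetric])
qed

lemma act_free_diff: "act_free (f - g) s = act_free f s - act_free g s"
  using act_free_add[of f "- g" s] by (simp add: act_free_uminus)

lemma act_free_gen: "act_free (free_gen x) s = left_op x s"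
  by (simp add: free_gen_def act_free_single)

lemma act_free_scalar: "act_free (free_scalar c) s = const c * s"
  by (simp add: free_scalar_def act_free_single zero_fword_def)

lemma act_env_ideal: "u \<in> env_ideal \<Longrightarrow> act_free u s = 0"
proof (induction arbitrary: s rule: env_ideal.induct)
  case (gen_add x y)
  then show ?case by (simp add: act_free_diff act_free_gen left_op_plus)
next
  case (gen_scale c x)
  then show ?case by (simp add: act_free_diff act_free_gen act_free_mult act_free_scalar left_op_scale)
next
  case (gen_bracket x y)
  then show ?case by (simp add: act_free_diff act_free_gen act_free_mult left_op_bracket)
qed (simp_all add: act_free_add act_free_mult)

lift_definition act :: "'m::finite ugl \<Rightarrow> 'm sym \<Rightarrow> 'm sym" is act_free
  unfolding env_rel_def by (rule ext) (metis act_env_ideal act_free_diff eq_iff_diff_eq_0)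

lemma act_add: "act (u + v) s = act u s + act v s"
  by transfer (rule act_free_add)

lemma act_mult: "act (u * v) s = act u (act v s)"
  by transfer (rule act_free_mult)

lemma act_scalar: "act (scalar c) s = const c * s"
  by transfer (rule act_free_scalar)

lemma act_one: "act 1 s = s"
  using act_scalar[of 1 s] by simp

lemma act_emb: "act (emb x) s = left_op x s"
  by transfer (rule act_free_gen)

section \<open>Leading terms\<close>

definition deg_less :: "nat \<Rightarrow> ('v multiset \<Rightarrow>\<^sub>0 complex) set" where
  "deg_less n = {f. \<forall>M\<in>Poly_Mapping.keys f. size M < n}"

lemma deg_less_0: "0 \<in> deg_less n"
  by (simp add: deg_less_def)

lemma deg_less_add: "f \<in> deg_less n \<Longrightarrow> g \<in> deg_less n \<Longrightarrow> f + g \<in> deg_less n"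
  unfolding deg_less_def using keys_add[of f g] by blast

lemma deg_less_sum: "(\<And>i. i \<in> A \<Longrightarrow> f i \<in> deg_less n) \<Longrightarrow> sum f A \<in> deg_less n"
  by (induction A rule: infinite_finite_induct) (simp_all add: deg_less_0 deg_less_add)

lemma deg_less_sum_mset: "(\<And>i. i \<in># A \<Longrightarrow> f i \<in> deg_less n) \<Longrightarrow> (\<Sum>i\<in>#A. f i) \<in> deg_less n"
  by (induction A) (simp_all add: deg_less_0 deg_less_add)

lemma deg_less_mult: "f \<in> deg_less (Suc m) \<Longrightarrow> g \<in> deg_less n \<Longrightarrow> f * g \<in> deg_less (m + n)"
  unfolding deg_less_def using keys_mult[of f g] by fastforce

lemma deg_less_single: "size M < n \<Longrightarrow> Poly_Mapping.single M c \<in> deg_less n"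
  by (simp add: deg_less_def)

lemma deg_less_lin: "lin x \<in> deg_less (Suc (Suc 0))"
  unfolding lin_def by (intro deg_less_sum deg_less_single) simp

lemma deg_less_left_deriv:
  assumes "f \<in> deg_less n"
  shows "left_deriv x f \<in> deg_less n"
  unfolding left_deriv_def derivation_def deriv_term_def
proof (intro deg_less_sum deg_less_sum_mset)
  fix M v assume M: "M \<in> Poly_Mapping.keys f" "v \<in># M"
  then have "size M < n" using assms by (auto simp: deg_less_def)
  moreover have "size (M - {#v#}) < size M" using M(2) by (simp add: size_Diff1_less)
  ultimately have s: "size (M - {#v#}) < n - 1" "1 + (n - 1) = n" by auto
  have "lin (x ** mat_unit (snd v) (fst v)) * Poly_Mapping.single (M - {#v#}) (Poly_Mapping.lookup f M) \<in> deg_less (1 + (n - 1))"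
    using deg_less_mult[OF deg_less_lin deg_less_single[OF s(1)]] by simp
  then show "Poly_Mapping.single (M - {#v#}) (Poly_Mapping.lookup f M) * lin (x ** mat_unit (snd v) (fst v)) \<in> deg_less n"
    unfolding s(2) by (simp only: mult.commute)
qed

lemma deg_less_const: "f \<in> deg_less n \<Longrightarrow> const c * f \<in> deg_less n"
  using deg_less_mult[of "const c" 0 f n] deg_less_single[of "{#}" 1 c] by simp

lemma deg_less_mono: "f \<in> deg_less m \<Longrightarrow> m \<le> n \<Longrightarrow> f \<in> deg_less n"
  by (fastforce simp: deg_less_def)

text \<open>For pairs (i, j) with j \<le> i these elements kill the highest weight vector of the
  Verma module of highest weight \<open>lam\<close>; for i < j they are the lowering
  operators.\<close>

definition e_shift :: "'m weight \<Rightarrow> 'm \<times> 'm \<Rightarrow> 'm::finite ugl" where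
  "e_shift lam \<alpha> = e_neg \<alpha> - scalar (if fst \<alpha> = snd \<alpha> then lam $ fst \<alpha> else 0)"

lemma act_diff: "act (u - v) s = act u s - act v s"
  by transfer (rule act_free_diff)

lemma act_e_shift:
  "act (e_shift lam \<alpha>) s = Poly_Mapping.single {#\<alpha>#} 1 * s +
    (left_deriv (mat_unit (snd \<alpha>) (fst \<alpha>)) s + const (- (if fst \<alpha> = snd \<alpha> then lam $ fst \<alpha> else 0)) * s)"
  by (simp add: e_shift_def e_neg_def act_diff act_emb act_scalar left_op_def lin_mat_unit single_uminus)

text \<open>A letter acts as multiplication by its variable plus a derivation and a scalar, which do
  not raise the degree. Hence a word applied to 1 has its commutative monomial as leading
  term.\<close>

lemma act_word_leading:
  "act (word_prod (e_shift lam) w) 1 - Poly_Mapping.single (mset w) (1 :: complex) \<in> deg_less (length w)"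
proof (induction w)
  case Nil
  show ?case by (simp add: deg_less_0 act_one)
next
  case (Cons \<alpha> w)
  let ?s = "act (word_prod (e_shift lam) w) 1" and ?m = "Poly_Mapping.single (mset w) (1 :: complex)" and ?n = "length w"
  define c where "c = - (if fst \<alpha> = snd \<alpha> then lam $ fst \<alpha> else 0)"
  have m: "?m \<in> deg_less (Suc ?n)" by (rule deg_less_single) simp
  have "(?s - ?m) + ?m \<in> deg_less (Suc ?n)"
    by (rule deg_less_add[OF deg_less_mono[OF Cons.IH] m]) simp
  then have s: "?s \<in> deg_less (Suc ?n)" by simp
  have "Poly_Mapping.single {#\<alpha>#} 1 * (?s - ?m) \<in> deg_less (1 + ?n)"
    by (rule deg_less_mult[OF deg_less_single Cons.IH]) simp
  moreover have "left_deriv (mat_unit (snd \<alpha>) (fst \<alpha>)) ?s + const c * ?s \<in> deg_less (Suc ?n)"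
    by (intro deg_less_add deg_less_left_deriv deg_less_const s)
  ultimately have "Poly_Mapping.single {#\<alpha>#} 1 * (?s - ?m) +
      (left_deriv (mat_unit (snd \<alpha>) (fst \<alpha>)) ?s + const c * ?s) \<in> deg_less (Suc ?n)"
    by (simp add: deg_less_add)
  moreover have "Poly_Mapping.single {#\<alpha>#} 1 * ?m = Poly_Mapping.single (mset (\<alpha> # w)) 1"
    by (simp add: mult_single)
  ultimately show ?case
    by (simp add: act_mult act_e_shift c_def[symmetric] right_diff_distrib add_diff_eq diff_add_eq)
qed

text \<open>Reads a coefficient of the symbol. It is a PBW coefficient only on elements of degree at
  most \<open>size M\<close>, since longer words may contribute lower terms at M.\<close>

definition pbw_coeff :: "('m \<times> 'm) multiset \<Rightarrow> 'm::finite ugl \<Rightarrow> complex" where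
  "pbw_coeff M u = Poly_Mapping.lookup (act u 1) M"

lemma pbw_coeff_add: "pbw_coeff M (u + v) = pbw_coeff M u + pbw_coeff M v"
  by (simp add: pbw_coeff_def act_add lookup_add)

lemma lookup_const_mult: "Poly_Mapping.lookup (const c * f) M = c * Poly_Mapping.lookup f M"
  by (induction f rule: poly_mapping_add_induct)
     (simp_all add: mult_single lookup_single when_def distrib_left lookup_add)

lemma pbw_coeff_scale: "pbw_coeff M (scalar c * u) = c * pbw_coeff M u"
  by (simp add: pbw_coeff_def act_mult act_scalar lookup_const_mult)

lemma pbw_coeff_0 [simp]: "pbw_coeff M 0 = 0"
  using pbw_coeff_scale[of M 0 0] by simp

lemma pbw_coeff_sum: "pbw_coeff M (sum f A) = (\<Sum>i\<in>A. pbw_coeff M (f i))"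
  by (induction A rule: infinite_finite_induct) (simp_all add: pbw_coeff_add)

lemma pbw_coeff_word:
  assumes "length w \<le> size M"
  shows "pbw_coeff M (word_prod (e_shift lam) w) = (if mset w = M then 1 else 0)"
proof -
  let ?r = "act (word_prod (e_shift lam) w) 1 - Poly_Mapping.single (mset w) 1"
  have "M \<notin> Poly_Mapping.keys ?r"
    using act_word_leading[of lam w] assms by (auto simp: deg_less_def)
  then have "Poly_Mapping.lookup ?r M = 0" by (simp add: in_keys_iff)
  then show ?thesis
    by (simp add: pbw_coeff_def lookup_minus lookup_single when_def)
qed

section \<open>Verma ideals and evaluation at a weight\<close>

section \<open>The left ideal defining a Verma module\<close>

text \<open>In the indexing of \<open>e_neg\<close> these pairs are the upper triangular matrix
  units together with the diagonal ones.\<close>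

definition nonpos_roots :: "('m::{finite,linorder} \<times> 'm) set" where
  "nonpos_roots = {(i, j). j \<le> i}"

definition verma_ideal :: "'m::{finite,linorder} weight \<Rightarrow> 'm ugl set" where
  "verma_ideal lam = left_ideal_gen (e_shift lam ` nonpos_roots)"

definition e_neg_const :: "'m::finite weight \<Rightarrow> 'm \<times> 'm \<Rightarrow> complex" where
  "e_neg_const lam \<alpha> = (if fst \<alpha> = snd \<alpha> then lam $ fst \<alpha> else 0)"

lemma e_neg_shift: "e_neg \<alpha> = e_shift lam \<alpha> + scalar (e_neg_const lam \<alpha>)"
  by (simp add: e_shift_def e_neg_const_def)

lemma e_shift_pos [simp]: "\<alpha> \<in> pos_roots \<Longrightarrow> e_shift lam \<alpha> = e_neg \<alpha>"
  by (auto simp: e_shift_def pos_roots_def)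

lemma word_prod_e_shift_pos: "set w \<subseteq> pos_roots \<Longrightarrow> word_prod (e_shift lam) w = word_prod e_neg w"
  by (induction w) auto

lemma e_shift_commutator:
  "e_shift lam (i, j) * e_shift lam (k, l) - e_shift lam (k, l) * e_shift lam (i, j) =
    (if i = l then e_neg (k, j) else 0) - (if k = j then e_neg (i, l) else 0)"
proof -
  have c: "(u - scalar c) * (v - scalar d) - (v - scalar d) * (u - scalar c) = u * v - v * u" for u v :: "'a ugl" and c d
    by (simp add: left_diff_distrib right_diff_distrib scalar_commute[of c] scalar_commute[of d u])
  show ?thesis
    unfolding e_shift_def[of lam] c by (simp add: e_neg_eq E_commutator)
qed

abbreviation no_weight :: "'i \<Rightarrow> nat" where
  "no_weight \<equiv> \<lambda>_. 0"

lemma e_shift_reordering_UNIV: "reordering (e_shift lam) UNIV no_weight True"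
proof
  fix x y :: "'a \<times> 'a"
  let ?S = "ugl.span (word_prod (e_shift lam) ` words UNIV no_weight True 2 (no_weight x + no_weight y))"
  have e: "e_neg z \<in> ?S" for z
  proof -
    have "word_prod (e_shift lam) [z] \<in> ?S" "word_prod (e_shift lam) [] \<in> ?S"
      by (rule ugl.span_base, rule imageI, simp add: words_def)+
    then have "word_prod (e_shift lam) [z] + scalar (e_neg_const lam z) * word_prod (e_shift lam) [] \<in> ?S"
      by (intro ugl.span_add ugl.span_scale)
    then show ?thesis by (simp add: e_neg_shift[of z lam])
  qed
  obtain i j k l where "x = (i, j)" "y = (k, l)" by (cases x; cases y) auto
  then show "e_shift lam x * e_shift lam y - e_shift lam y * e_shift lam x \<in> ?S"
    using e by (auto simp: e_shift_commutator intro!: ugl.span_diff ugl.span_neg ugl.span_zero)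
qed

text \<open>The weight is a character of the upper triangular subalgebra, whose brackets are
  strictly upper triangular, so no constant appears: rearranging a nonempty word never produces the
  empty one. This is what separates the Verma ideal from U(n^-).\<close>

lemma e_shift_reordering_nonpos: "reordering (e_shift lam) nonpos_roots no_weight False"
proof
  fix x y :: "'a \<times> 'a" assume *: "x \<in> nonpos_roots" "y \<in> nonpos_roots"
  let ?S = "ugl.span (word_prod (e_shift lam) ` words nonpos_roots no_weight False 2 (no_weight x + no_weight y))"
  have e: "e_neg z \<in> ?S" if "z \<in> nonpos_roots" "fst z \<noteq> snd z" for z
  proof -
    have "word_prod (e_shift lam) [z] \<in> ?S"
      by (rule ugl.span_base, rule imageI) (use that in \<open>simp add: words_def\<close>)
    then show ?thesis using that by (simp add: e_neg_shift[of z lam] e_neg_const_def)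
  qed
  obtain i j k l where xy: "x = (i, j)" "y = (k, l)" by (cases x; cases y) auto
  then have le: "j \<le> i" "l \<le> k" using * by (auto simp: nonpos_roots_def)
  show "e_shift lam x * e_shift lam y - e_shift lam y * e_shift lam x \<in> ?S"
  proof (cases "i = l \<and> k = j")
    case True
    then have "x = y" using le xy by auto
    then show ?thesis by (simp add: ugl.span_zero)
  next
    case False
    have 1: "e_neg (k, j) \<in> ?S" if "i = l" "k \<noteq> j"
      by (rule e) (use that le in \<open>auto simp: nonpos_roots_def\<close>)
    have 2: "e_neg (i, l) \<in> ?S" if "k = j" "i \<noteq> l"
      by (rule e) (use that le in \<open>auto simp: nonpos_roots_def\<close>)
    have "(if i = l then e_neg (k, j) else 0) \<in> ?S" "(if k = j then e_neg (i, l) else 0) \<in> ?S"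
      using 1 2 False ugl.span_zero by auto
    then show ?thesis unfolding xy e_shift_commutator by (rule ugl.span_diff)
  qed
qed

interpretation all: reordering "e_shift (lam :: 'm::{finite,linorder} weight)" UNIV no_weight True for lam
  by (rule e_shift_reordering_UNIV)

interpretation nonpos: reordering "e_shift (lam :: 'm::{finite,linorder} weight)" nonpos_roots no_weight False for lam
  by (rule e_shift_reordering_nonpos)

interpretation neg0: reordering "e_neg :: 'm::{finite,linorder} \<times> 'm \<Rightarrow> 'm ugl" pos_roots no_weight True
  by (rule e_neg_reordering) simp

section \<open>Linear independence of ordered monomials\<close>

text \<open>\<open>pbw_coeff\<close> at a longest monomial with nonzero coefficient isolates that
  coefficient.\<close>

lemma pbw_independent:
  fixes A :: "('m::finite \<times> 'm \<Rightarrow> nat) set"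
  assumes rs: "distinct rs" "set rs = UNIV" and A: "finite A"
    and zero: "(\<Sum>\<pi>\<in>A. scalar (c \<pi>) * word_prod (e_shift lam) (partition_word rs \<pi>)) = 0"
    and \<pi>: "\<pi> \<in> A"
  shows "c \<pi> = 0"
proof (rule ccontr)
  let ?w = "partition_word rs"
  assume "c \<pi> \<noteq> 0"
  define B where "B = {\<pi> \<in> A. c \<pi> \<noteq> 0}"
  have "finite B" "B \<noteq> {}" using A \<pi> \<open>c \<pi> \<noteq> 0\<close> by (auto simp: B_def)
  then have "Max ((\<lambda>\<pi>. length (?w \<pi>)) ` B) \<in> (\<lambda>\<pi>. length (?w \<pi>)) ` B" by simp
  then obtain \<sigma> where \<sigma>: "\<sigma> \<in> B" and "length (?w \<sigma>) = Max ((\<lambda>\<pi>. length (?w \<pi>)) ` B)" by auto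
  then have max: "length (?w \<tau>) \<le> length (?w \<sigma>)" if "\<tau> \<in> B" for \<tau>
    using that \<open>finite B\<close> by simp
  have inj: "mset (?w \<tau>) = mset (?w \<sigma>) \<longleftrightarrow> \<tau> = \<sigma>" for \<tau>
  proof
    assume "mset (?w \<tau>) = mset (?w \<sigma>)"
    then have "count (mset (?w \<tau>)) \<alpha> = count (mset (?w \<sigma>)) \<alpha>" for \<alpha> by simp
    then show "\<tau> = \<sigma>" using rs by (auto simp: count_partition_word)
  qed simp
  have "0 = pbw_coeff (mset (?w \<sigma>)) (\<Sum>\<pi>\<in>A. scalar (c \<pi>) * word_prod (e_shift lam) (?w \<pi>))"
    by (simp add: zero)
  also have "\<dots> = (\<Sum>\<pi>\<in>A. if \<pi> = \<sigma> then c \<sigma> else 0)"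
    unfolding pbw_coeff_sum pbw_coeff_scale
  proof (rule sum.cong)
    fix \<tau> assume "\<tau> \<in> A"
    show "c \<tau> * pbw_coeff (mset (?w \<sigma>)) (word_prod (e_shift lam) (?w \<tau>)) = (if \<tau> = \<sigma> then c \<sigma> else 0)"
    proof (cases "\<tau> \<in> B")
      case True
      then show ?thesis using pbw_coeff_word[of "?w \<tau>" "mset (?w \<sigma>)" lam] max inj by simp
    next
      case False
      then show ?thesis using \<open>\<tau> \<in> A\<close> \<sigma> by (auto simp: B_def)
    qed
  qed simp
  also have "\<dots> = c \<sigma>" using \<sigma> A by (simp add: B_def)
  finally show False using \<sigma> by (simp add: B_def)
qed

lemma pbw_inj:
  assumes rs: "distinct rs" "set rs = UNIV"
  shows "inj (\<lambda>\<pi>. word_prod (e_shift lam) (partition_word rs \<pi>))"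
proof (rule injI, rule ccontr)
  fix \<pi> \<sigma> :: "'a \<times> 'a \<Rightarrow> nat"
  assume eq: "word_prod (e_shift lam) (partition_word rs \<pi>) = word_prod (e_shift lam) (partition_word rs \<sigma>)"
    and ne: "\<pi> \<noteq> \<sigma>"
  have "(if \<pi> = \<pi> then 1 else -1 :: complex) = 0"
    by (rule pbw_independent[OF rs, of "{\<pi>, \<sigma>}" "\<lambda>\<tau>. if \<tau> = \<pi> then 1 else -1" lam]) (use eq ne in auto)
  then show False by simp
qed

lemma pbw_independent_set:
  assumes rs: "distinct rs" "set rs = UNIV"
  shows "ugl.independent (range (\<lambda>\<pi>. word_prod (e_shift lam) (partition_word rs \<pi>)))" (is "ugl.independent (range ?f)")
  unfolding ugl.dependent_explicit
proof (rule notI, elim exE conjE bexE)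
  fix t u v assume t: "finite t" "t \<subseteq> range ?f" and sum: "(\<Sum>v\<in>t. scalar (u v) * v) = 0"
    and v: "v \<in> t" "u v \<noteq> 0"
  then obtain x where x: "?f x \<in> t" "u (?f x) \<noteq> 0" by blast
  have t_eq: "t = ?f ` (?f -` t)" using t(2) by auto
  have fin: "finite (?f -` t)" using t(1) pbw_inj[OF rs] by (rule finite_vimageI)
  have "(\<Sum>v\<in>t. scalar (u v) * v) = (\<Sum>\<pi>\<in>?f -` t. scalar (u (?f \<pi>)) * ?f \<pi>)"
    using sum.reindex[OF inj_on_subset[OF pbw_inj[OF rs, of lam]], of "?f -` t" "\<lambda>v. scalar (u v) * v"] t_eq by simp
  then have "u (?f x) = 0" using sum x(1) by (intro pbw_independent[OF rs fin]) auto
  then show False using x(2) by simp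
qed

lemma (in vector_space) span_Int_disjoint:
  assumes B: "independent B" and sub: "S \<subseteq> B" "T \<subseteq> B" "S \<inter> T = {}"
    and u: "u \<in> span S" "u \<in> span T"
  shows "u = 0"
proof -
  have "representation B u = representation S u" "representation B u = representation T u"
    by (rule representation_extend[OF B u(1) sub(1)], rule representation_extend[OF B u(2) sub(2)])
  then have "representation S u b = 0" for b
    using representation_ne_zero[of S u b] representation_ne_zero[of T u b] sub(3) by (metis disjoint_iff)
  then have "(\<Sum>b | representation S u b \<noteq> 0. scale (representation S u b) b) = 0" by simp
  then show ?thesis
    using sum_nonzero_representation_eq[OF independent_mono[OF B sub(1)] u(1)] by simp
qed

lemma span_lists_mult:
  assumes "u \<in> ugl.span (word_prod g ` lists K)" "v \<in> ugl.span (word_prod g ` lists K)"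
  shows "u * v \<in> ugl.span (word_prod g ` lists K)"
proof -
  have 1: "word_prod g w * v \<in> ugl.span (word_prod g ` lists K)" if w: "w \<in> lists K" for w
    using assms(2)
  proof (induction rule: ugl.span_induct_alt)
    case (step c x y)
    then obtain w' where "w' \<in> lists K" "x = word_prod g w'" by blast
    then have "word_prod g w * x \<in> word_prod g ` lists K"
      using w by (intro image_eqI[of _ _ "w @ w'"]) auto
    then show ?case using step
      by (simp add: distrib_left scalar_left_commute ugl.span_add ugl.span_scale ugl.span_base)
  qed (simp add: ugl.span_zero)
  show ?thesis
    using assms(1)
  proof (induction rule: ugl.span_induct_alt)
    case (step c x y)
    then show ?case using 1
      by (auto simp: distrib_right mult.assoc intro!: ugl.span_add ugl.span_scale)
  qed (simp add: ugl.span_zero)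
qed

lemma span_lists_letter: "x \<in> K \<Longrightarrow> g x \<in> ugl.span (word_prod g ` lists K)"
  by (rule ugl.span_base, rule image_eqI[of _ _ "[x]"]) auto

lemma span_lists_scalar: "scalar c \<in> ugl.span (word_prod g ` lists K)"
proof -
  have "scalar c * word_prod g [] \<in> ugl.span (word_prod g ` lists K)"
    by (intro ugl.span_scale ugl.span_base imageI) simp
  then show ?thesis by simp
qed

lemma span_all_words: "u \<in> ugl.span (word_prod (e_shift lam) ` lists UNIV)"
proof (induction u rule: ugl_induct)
  case (emb x)
  have "E i j \<in> ugl.span (word_prod (e_shift lam) ` lists UNIV)" for i j
  proof -
    have "E i j = e_shift lam (j, i) + scalar (e_neg_const lam (j, i))"
      using e_neg_shift[of "(j, i)" lam] by (simp add: e_neg_eq)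
    then show ?thesis by (simp only: ugl.span_add span_lists_letter span_lists_scalar UNIV_I)
  qed
  then show ?case unfolding emb_expand[of x] by (intro ugl.span_sum ugl.span_scale)
next
  case (add u v)
  then show ?case by (rule ugl.span_add)
next
  case (mult u v)
  then show ?case by (rule span_lists_mult)
qed (rule span_lists_scalar)

abbreviation neg_span :: "'m::{finite,linorder} ugl set" where
  "neg_span \<equiv> ugl.span (word_prod e_neg ` lists pos_roots)"

lemma U_n_minus_neg_span: "u \<in> U_n_minus \<Longrightarrow> u \<in> neg_span"
proof (induction rule: subalg.induct)
  case (gen x)
  then obtain y where y: "x = emb y" "y \<in> n_minus" by blast
  have "scalar (y $ i $ j) * E i j \<in> neg_span" for i j
  proof (cases "j < i")
    case True
    then have "E i j = e_neg (j, i)" "(j, i) \<in> pos_roots" by (simp_all add: e_neg_eq pos_roots_def)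
    then show ?thesis by (simp only: ugl.span_scale span_lists_letter)
  next
    case False
    then have "y $ i $ j = 0" using y(2) by (auto simp: n_minus_def)
    then show ?thesis by (simp add: ugl.span_zero)
  qed
  then show ?case unfolding y(1) emb_expand[of y] by (intro ugl.span_sum)
qed (auto intro: ugl.span_add span_lists_mult span_lists_scalar)

lemma word_U_n_minus: "set w \<subseteq> pos_roots \<Longrightarrow> word_prod e_neg w \<in> U_n_minus"
proof (induction w)
  case Nil
  then show ?case using subalg.scalar[of 1] by simp
next
  case (Cons x w)
  then have "e_neg x \<in> U_n_minus"
    unfolding e_neg_eq by (intro subalg.gen imageI) (auto simp: pos_roots_def n_minus_def)
  then show ?case using Cons by (simp add: subalg.mult)
qed

text \<open>By PBW, ordered monomials with all lower triangular factors in front form a basis. Those with a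
  factor \<open>e_shift lam \<alpha>\<close>, \<open>\<alpha>\<close> not positive, span the left ideal; the others span \<open>U(n\<^sup>-)\<close>.\<close>

lemma neg_span_verma_ideal:
  fixes u :: "'m::{finite,linorder} ugl"
  assumes "u \<in> neg_span" "u \<in> verma_ideal lam"
  shows "u = 0"
proof -
  obtain ps where ps: "distinct ps" "set ps = (pos_roots :: ('m \<times> 'm) set)" using finite_distinct_list[of "pos_roots :: ('m \<times> 'm) set"] by auto
  obtain ns where ns: "distinct ns" "set ns = (nonpos_roots :: ('m \<times> 'm) set)" using finite_distinct_list[of "nonpos_roots :: ('m \<times> 'm) set"] by auto
  have pn: "pos_roots \<inter> nonpos_roots = {}" "pos_roots \<union> nonpos_roots = (UNIV :: ('m \<times> 'm) set)"
    by (auto simp: pos_roots_def nonpos_roots_def)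
  let ?rs = "ps @ ns"
  have rs: "distinct ?rs" "set ?rs = UNIV" using ps ns pn by auto
  let ?f = "\<lambda>\<pi>. word_prod (e_shift lam) (partition_word ?rs \<pi>)"
  have pw: "partition_word (xs @ ys) \<pi> = partition_word xs \<pi> @ partition_word ys \<pi>" for xs ys :: "('m \<times> 'm) list" and \<pi>
    by (simp add: partition_word_def)
  have pw_cong: "partition_word xs \<pi> = partition_word xs \<sigma>" if "\<And>x. x \<in> set xs \<Longrightarrow> \<pi> x = \<sigma> x" for xs :: "('m \<times> 'm) list" and \<pi> \<sigma>
    unfolding partition_word_def using that by (intro arg_cong[of _ _ concat]) auto
  define S where "S = {\<pi> :: 'm \<times> 'm \<Rightarrow> nat. \<forall>\<alpha>\<in>nonpos_roots. \<pi> \<alpha> = 0}"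
  have len: "w \<in> words K no_weight True (Suc (length w)) 0" if "w \<in> lists K" for w :: "('m \<times> 'm) list" and K
    using that by (auto simp: words_def)
  have can: "mset (partition_word ?rs (count (mset w))) = mset w" for w
    by (rule mset_partition_word_count) (use rs in auto)
  have neg: "neg_span \<subseteq> ugl.span (?f ` S)"
  proof (rule ugl.span_minimal)
    show "word_prod e_neg ` lists pos_roots \<subseteq> ugl.span (?f ` S)"
    proof (rule image_subsetI)
      fix w :: "('m \<times> 'm) list" assume w: "w \<in> lists pos_roots"
      have "word_prod e_neg w \<in> neg0.W (Suc (length w)) 0"
        by (rule ugl.span_base, rule imageI, rule len[OF w])
      also have "\<dots> \<subseteq> ugl.span (word_prod e_neg ` (\<lambda>w. partition_word ?rs (count (mset w))) ` words pos_roots no_weight True (Suc (length w)) 0)"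
        by (rule neg0.W_canonical) (rule can)
      also have "\<dots> \<subseteq> ugl.span (?f ` S)"
      proof (rule ugl.span_mono, clarify)
        fix v :: "('m \<times> 'm) list" assume v: "v \<in> words pos_roots no_weight True (Suc (length w)) 0"
        have "set (partition_word ?rs (count (mset v))) = set v" using can mset_eq_setD by blast
        then have "word_prod e_neg (partition_word ?rs (count (mset v))) = ?f (count (mset v))"
          using v by (simp add: word_prod_e_shift_pos words_def)
        moreover have "count (mset v) \<in> S"
          using v pn(1) by (auto simp: words_def S_def count_eq_zero_iff)
        ultimately show "word_prod e_neg (partition_word ?rs (count (mset v))) \<in> ?f ` S" by blast
      qed
      finally show "word_prod e_neg w \<in> ugl.span (?f ` S)" .
    qed
  qed (rule ugl.subspace_span)
  have full: "x \<in> ugl.span (range ?f)" for x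
  proof -
    have "word_prod (e_shift lam) w \<in> ugl.span (range ?f)" for w
    proof -
      have "word_prod (e_shift lam) w \<in> all.W lam (Suc (length w)) 0"
        by (rule ugl.span_base, rule imageI, rule len) simp
      also have "\<dots> \<subseteq> ugl.span (word_prod (e_shift lam) ` (\<lambda>w. partition_word ?rs (count (mset w))) ` words UNIV no_weight True (Suc (length w)) 0)"
        by (rule all.W_canonical) (rule can)
      also have "\<dots> \<subseteq> ugl.span (range ?f)" by (rule ugl.span_mono) auto
      finally show ?thesis .
    qed
    then have "ugl.span (word_prod (e_shift lam) ` lists UNIV) \<subseteq> ugl.span (range ?f)"
      by (intro ugl.span_minimal) (auto simp: ugl.subspace_span)
    then show ?thesis using span_all_words by blast
  qed
  \<comment> \<open>The letter joins the nonpositive tail and only the tail is reordered; it stays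
    nonempty, so the resulting monomials are outside S.\<close>
  have letter: "?f \<pi> * e_shift lam \<alpha> \<in> ugl.span (?f ` (- S))" if \<alpha>: "\<alpha> \<in> nonpos_roots" for \<pi> \<alpha>
  proof -
    let ?p = "partition_word ps \<pi>" and ?q = "partition_word ns \<pi> @ [\<alpha>]"
    let ?can = "\<lambda>w. partition_word ns (count (mset w))"
    have "word_prod (e_shift lam) ?q \<in> nonpos.W lam (Suc (length ?q)) 0"
    proof (intro ugl.span_base imageI)
      have "set (partition_word ns \<pi>) \<subseteq> set ns" by (auto simp: partition_word_def)
      then show "?q \<in> words nonpos_roots no_weight False (Suc (length ?q)) 0"
        using \<alpha> ns(2) by (auto simp: words_def)
    qed
    also have "\<dots> \<subseteq> ugl.span (word_prod (e_shift lam) ` ?can ` words nonpos_roots no_weight False (Suc (length ?q)) 0)"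
      by (rule nonpos.W_canonical) (use ns in \<open>simp add: mset_partition_word_count\<close>)
    finally have "word_prod (e_shift lam) ?q \<in> \<dots>" .
    then have "word_prod (e_shift lam) ?p * word_prod (e_shift lam) ?q \<in> ugl.span (?f ` (- S))"
    proof (induction rule: ugl.span_induct_alt)
      case (step c x y)
      then obtain w where w: "w \<in> words nonpos_roots no_weight False (Suc (length ?q)) 0"
        "x = word_prod (e_shift lam) (?can w)" by blast
      define \<sigma> where "\<sigma> \<beta> = (if \<beta> \<in> pos_roots then \<pi> \<beta> else count (mset w) \<beta>)" for \<beta>
      have "partition_word ps \<sigma> = ?p" by (rule pw_cong) (use ps in \<open>simp add: \<sigma>_def\<close>)
      moreover have "partition_word ns \<sigma> = ?can w" by (rule pw_cong) (use ns pn in \<open>auto simp: \<sigma>_def\<close>)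
      ultimately have "word_prod (e_shift lam) ?p * x = ?f \<sigma>" by (simp add: w(2) pw)
      moreover have "\<sigma> \<notin> S"
      proof -
        have "w \<noteq> []" "set w \<subseteq> nonpos_roots" using w(1) by (auto simp: words_def)
        then have "hd w \<in> nonpos_roots" "count (mset w) (hd w) \<noteq> 0" by (auto simp: count_eq_zero_iff)
        moreover have "hd w \<notin> pos_roots" using calculation(1) pn by blast
        ultimately show ?thesis by (auto simp: S_def \<sigma>_def)
      qed
      ultimately have "word_prod (e_shift lam) ?p * x \<in> ?f ` (- S)" by blast
      then show ?case using step.IH
        by (simp only: distrib_left scalar_left_commute ugl.span_add ugl.span_scale ugl.span_base)
    qed (simp add: ugl.span_zero)
    then show ?thesis by (simp add: pw mult.assoc word_prod_def)
  qed
  have "x * e_shift lam \<alpha> \<in> ugl.span (?f ` (- S))" if \<alpha>: "\<alpha> \<in> nonpos_roots" for x \<alpha>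
    using full[of x]
  proof (induction rule: ugl.span_induct_alt)
    case (step c y z)
    then show ?case using letter[OF \<alpha>]
      by (auto simp: distrib_right mult.assoc intro!: ugl.span_add ugl.span_scale)
  qed (simp add: ugl.span_zero)
  note * = this
  have ideal: "verma_ideal lam \<subseteq> ugl.span (?f ` (- S))"
    unfolding verma_ideal_def
  proof (rule subsetI)
    fix x assume "x \<in> left_ideal_gen (e_shift lam ` nonpos_roots)"
    then show "x \<in> ugl.span (?f ` (- S))"
      by (induction rule: left_ideal_gen_induct) (auto intro: ugl.span_add ugl.span_zero *)
  qed
  have disj: "?f ` S \<inter> ?f ` (- S) = {}"
    using image_Int[OF pbw_inj[OF rs, of lam], of S "- S"] by simp
  show ?thesis
    by (rule ugl.span_Int_disjoint[OF pbw_independent_set[OF rs, of lam], of "?f ` S" "?f ` (- S)"])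
       (use assms neg ideal disj in auto)
qed

section \<open>Evaluation\<close>

lemma verma_0: "0 \<in> verma_ideal lam"
  and verma_add: "x \<in> verma_ideal lam \<Longrightarrow> y \<in> verma_ideal lam \<Longrightarrow> x + y \<in> verma_ideal lam"
  and verma_diff: "x \<in> verma_ideal lam \<Longrightarrow> y \<in> verma_ideal lam \<Longrightarrow> x - y \<in> verma_ideal lam"
  and verma_mult: "x \<in> verma_ideal lam \<Longrightarrow> u * x \<in> verma_ideal lam"
  and verma_sum: "(\<And>i. i \<in> A \<Longrightarrow> f i \<in> verma_ideal lam) \<Longrightarrow> sum f A \<in> verma_ideal lam"
  unfolding verma_ideal_def
  by (rule left_ideal_gen_0 left_ideal_gen_add left_ideal_gen_diff left_ideal_gen_mult left_ideal_gen_sum; assumption)+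

lemma verma_E_diag: "E i i - scalar (lam $ i) \<in> verma_ideal lam"
proof -
  have "1 * e_shift lam (i, i) \<in> verma_ideal lam"
    unfolding verma_ideal_def by (rule left_ideal_gen_base) (simp add: nonpos_roots_def)
  then show ?thesis by (simp add: e_shift_def e_neg_eq)
qed

lemma verma_E_upper: "i < j \<Longrightarrow> u * E i j \<in> verma_ideal lam"
proof -
  assume "i < j"
  then have "u * e_shift lam (j, i) \<in> verma_ideal lam"
    unfolding verma_ideal_def by (intro left_ideal_gen_base) (simp add: nonpos_roots_def)
  moreover have "j \<noteq> i" using \<open>i < j\<close> by auto
  ultimately show ?thesis by (simp add: e_shift_def e_neg_eq)
qed

lemma verma_n_plus: "x \<in> left_ideal_gen (emb ` n_plus) \<Longrightarrow> x \<in> verma_ideal lam"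
proof (induction rule: left_ideal_gen_induct)
  case (add_mult x u s)
  then obtain y where y: "s = emb y" "y \<in> n_plus" by blast
  have "u * (scalar (y $ i $ j) * E i j) \<in> verma_ideal lam" for i j
  proof (cases "i < j")
    case True
    then show ?thesis by (simp add: mult.assoc[symmetric] verma_E_upper)
  next
    case False
    then have "y $ i $ j = 0" using y(2) by (auto simp: n_plus_def)
    then show ?thesis by (simp add: verma_0)
  qed
  then have "u * s \<in> verma_ideal lam"
    unfolding y(1) emb_expand[of y] sum_distrib_left by (intro verma_sum)
  then show ?case using add_mult by (intro verma_add)
qed (rule verma_0)

lemma verma_cartan:
  assumes "h \<in> cartan"
  shows "emb h - scalar (wt lam h) \<in> verma_ideal lam"
proof -
  have "h $ i $ j = 0" if "i \<noteq> j" for i j using assms that by (auto simp: cartan_def)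
  then have "scalar (h $ i $ j) * E i j = (if i = j then scalar (h $ i $ i) * E i i else 0)" for i j
    by (cases "i = j") simp_all
  then have "emb h = (\<Sum>i\<in>UNIV. \<Sum>j\<in>UNIV. if i = j then scalar (h $ i $ i) * E i i else 0)"
    unfolding emb_expand[of h] by (intro sum.cong refl)
  then have "emb h = (\<Sum>i\<in>UNIV. scalar (h $ i $ i) * E i i)" by simp
  moreover have "scalar (wt lam h) = (\<Sum>i\<in>UNIV. scalar (h $ i $ i) * scalar (lam $ i))"
  proof -
    have "scalar (sum f A) = (\<Sum>i\<in>A. scalar (f i))" for f and A :: "'a set"
      by (induction A rule: infinite_finite_induct) (simp_all add: scalar_add)
    then show ?thesis by (simp add: wt_def scalar_mult[symmetric] mult.commute)
  qed
  ultimately have "emb h - scalar (wt lam h) = (\<Sum>i\<in>UNIV. scalar (h $ i $ i) * (E i i - scalar (lam $ i)))"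
    by (simp add: right_diff_distrib sum_subtractf)
  then show ?thesis by (simp add: verma_sum verma_mult verma_E_diag)
qed

text \<open>Nonvanishing of the Verma module. It makes the scalar congruent to an element of U(h)
  well defined.\<close>

lemma verma_scalar_iff: "scalar c \<in> verma_ideal lam \<longleftrightarrow> c = 0"
proof
  assume "scalar c \<in> verma_ideal lam"
  then have "scalar c = (0 :: 'a ugl)" using neg_span_verma_ideal span_lists_scalar by blast
  then have "scalar (inverse c * c) = (0 :: 'a ugl)" by (simp add: scalar_mult)
  then show "c = 0" by (cases "c = 0") simp_all
qed (simp add: verma_0)

lemma verma_value_unique:
  assumes "H - scalar c \<in> verma_ideal lam" "H - scalar d \<in> verma_ideal lam"
  shows "c = d"
  using verma_diff[OF assms] verma_scalar_iff[of "d - c" lam] by (simp add: scalar_diff)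

lemma verma_value_add:
  "H - scalar c \<in> verma_ideal lam \<Longrightarrow> K - scalar d \<in> verma_ideal lam \<Longrightarrow> H + K - scalar (c + d) \<in> verma_ideal lam"
  using verma_add[of "H - scalar c" lam "K - scalar d"] by (simp add: scalar_add algebra_simps)

lemma verma_value_mult:
  assumes "H - scalar c \<in> verma_ideal lam" "K - scalar d \<in> verma_ideal lam"
  shows "H * K - scalar (c * d) \<in> verma_ideal lam"
proof -
  have "H * K - scalar (c * d) = H * (K - scalar d) + scalar d * (H - scalar c)"
    by (simp add: right_diff_distrib scalar_commute[of d H] scalar_mult[symmetric] mult.commute)
  then show ?thesis using assms by (simp add: verma_add verma_mult)
qed

lemma verma_value_exists:
  assumes "H \<in> U_h"
  shows "\<exists>c. H - scalar c \<in> verma_ideal lam"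
  using assms
proof (induction rule: subalg.induct)
  case (scalar c)
  show ?case by (rule exI[of _ c]) (simp add: verma_0)
next
  case (gen x)
  then show ?case using verma_cartan by blast
qed (blast intro: verma_value_add verma_value_mult)+

text \<open>H(\<lambda>) is obtained as the scalar congruent to H modulo the Verma ideal, which
  yields a character without first identifying U(h) with a polynomial ring.\<close>

lemma is_character_verma: "is_character lam (\<lambda>H. SOME c. H - scalar c \<in> verma_ideal lam)" (is "is_character lam ?chi")
proof -
  have val: "?chi H = c" if "H - scalar c \<in> verma_ideal lam" for H c
    using that by (rule some_equality) (rule verma_value_unique[OF _ that])
  have ex: "H - scalar (?chi H) \<in> verma_ideal lam" if "H \<in> U_h" for H
    using verma_value_exists[OF that] by (rule someI_ex)
  show ?thesis
    unfolding is_character_def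
    by (intro conjI allI ballI; rule val)
       (auto simp: verma_0 verma_cartan intro!: verma_value_add verma_value_mult ex)
qed

lemma character_unique:
  assumes "is_character lam chi" "is_character lam chi'" "H \<in> U_h"
  shows "chi H = chi' H"
  using assms(3,1,2) by (induction rule: subalg.induct) (auto simp: is_character_def)

lemma U_h_at_verma:
  assumes "H \<in> U_h"
  shows "H - scalar (U_h_at lam H) \<in> verma_ideal lam"
proof -
  let ?chi = "\<lambda>H. SOME c. H - scalar c \<in> verma_ideal lam"
  have "U_h_at lam H = ?chi H"
    unfolding U_h_at_def
    by (rule the_equality) (use is_character_verma[of lam] character_unique[OF _ _ assms] in blast)+
  then show ?thesis using someI_ex[OF verma_value_exists[OF assms]] by simp
qed

text \<open>u(\<lambda>) is the only element of U(n^-) congruent to u modulo the Verma ideal, whence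
  the independence of the decomposition. An arbitrary finite index set is carried to an initial
  segment of the naturals by a bijection.\<close>

lemma eval_at_eq:
  assumes u: "u = (\<Sum>x\<in>A. f x * H x)" and "finite A"
    and f: "\<And>x. x \<in> A \<Longrightarrow> f x \<in> U_n_minus" and H: "\<And>x. x \<in> A \<Longrightarrow> H x \<in> U_h"
    and c: "\<And>x. x \<in> A \<Longrightarrow> H x - scalar (c x) \<in> verma_ideal lam"
  shows "eval_at lam u = (\<Sum>x\<in>A. f x * scalar (c x))"
proof -
  obtain g where g: "bij_betw g {0..<card A} A" using ex_bij_betw_nat_finite[OF assms(2)] by blast
  then have g': "bij_betw g {..<card A} A" by (simp add: lessThan_atLeast0)
  have c': "U_h_at lam (H x) = c x" if "x \<in> A" for x
    using verma_value_unique[OF U_h_at_verma[OF H] c] that by blast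
  have gA: "g i \<in> A" if "i < card A" for i using g' that by (auto simp: bij_betw_def)
  have val: "u - (\<Sum>i<n. us i * scalar (U_h_at lam (Hs i))) \<in> verma_ideal lam \<and> (\<Sum>i<n. us i * scalar (U_h_at lam (Hs i))) \<in> neg_span"
    if us: "\<forall>i<n. us i \<in> U_n_minus \<and> Hs i \<in> U_h" and u: "u = (\<Sum>i<n. us i * Hs i)"
    for n :: nat and us Hs
  proof
    have "u - (\<Sum>i<n. us i * scalar (U_h_at lam (Hs i))) = (\<Sum>i<n. us i * (Hs i - scalar (U_h_at lam (Hs i))))"
      by (simp add: u right_diff_distrib sum_subtractf)
    also have "\<dots> \<in> verma_ideal lam" using us by (intro verma_sum verma_mult U_h_at_verma) auto
    finally show "u - (\<Sum>i<n. us i * scalar (U_h_at lam (Hs i))) \<in> verma_ideal lam" .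
    show "(\<Sum>i<n. us i * scalar (U_h_at lam (Hs i))) \<in> neg_span"
      using us by (intro ugl.span_sum U_n_minus_neg_span subalg.mult subalg.scalar) auto
  qed
  show ?thesis
    unfolding eval_at_def
  proof (rule the_equality)
    show ex: "\<exists>(n::nat) us Hs. (\<forall>i<n. us i \<in> U_n_minus \<and> Hs i \<in> U_h) \<and> u = (\<Sum>i<n. us i * Hs i) \<and>
        (\<Sum>x\<in>A. f x * scalar (c x)) = (\<Sum>i<n. us i * scalar (U_h_at lam (Hs i)))"
    proof (intro exI conjI)
      show "\<forall>i<card A. f (g i) \<in> U_n_minus \<and> H (g i) \<in> U_h" using f H gA by blast
      show "u = (\<Sum>i<card A. f (g i) * H (g i))"
        unfolding u by (rule sum.reindex_bij_betw[OF g', symmetric])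
      have "(\<Sum>x\<in>A. f x * scalar (c x)) = (\<Sum>i<card A. f (g i) * scalar (c (g i)))"
        by (rule sum.reindex_bij_betw[OF g', symmetric])
      also have "\<dots> = (\<Sum>i<card A. f (g i) * scalar (U_h_at lam (H (g i))))"
        using c' gA by (intro sum.cong) auto
      finally show "(\<Sum>x\<in>A. f x * scalar (c x)) = (\<Sum>i<card A. f (g i) * scalar (U_h_at lam (H (g i))))" .
    qed
    fix w assume "\<exists>(n::nat) us Hs. (\<forall>i<n. us i \<in> U_n_minus \<and> Hs i \<in> U_h) \<and> u = (\<Sum>i<n. us i * Hs i) \<and>
        w = (\<Sum>i<n. us i * scalar (U_h_at lam (Hs i)))"
    then have w: "u - w \<in> verma_ideal lam" "w \<in> neg_span" using val by blast+
    let ?v = "\<Sum>x\<in>A. f x * scalar (c x)"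
    obtain n us Hs where *: "\<forall>i<(n::nat). us i \<in> U_n_minus \<and> Hs i \<in> U_h" "u = (\<Sum>i<n. us i * Hs i)"
        "?v = (\<Sum>i<n. us i * scalar (U_h_at lam (Hs i)))" using ex by blast
    have v: "u - ?v \<in> verma_ideal lam" "?v \<in> neg_span" using val[OF *(1,2)] by (simp_all only: *(3))
    have "(u - ?v) - (u - w) = w - ?v" by simp
    then have "w - ?v \<in> verma_ideal lam" using verma_diff[OF v(1) w(1)] by simp
    then have "w - ?v = 0" by (rule neg_span_verma_ideal[OF ugl.span_diff[OF w(2) v(2)]])
    then show "w = ?v" by simp
  qed
qed

section \<open>Uniqueness of the evaluated element\<close>

section \<open>Uniqueness of singular vectors along a line of weights\<close>

lemma word_weight: "\<exists>\<beta>. has_weight (word_prod e_neg w) \<beta>"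
proof (induction w)
  case Nil
  then show ?case using has_weight_scalar[of 1] by auto
next
  case (Cons x w)
  then show ?case using has_weight_mult[OF has_weight_E] unfolding word_prod_simps(2) e_neg_eq by blast
qed

lemma W_neg_span: "neg0.W n 0 \<subseteq> neg_span"
  by (rule ugl.span_mono) (auto simp: words_def)

lemma W0_base: "set w \<subseteq> pos_roots \<Longrightarrow> length w < n \<Longrightarrow> word_prod e_neg w \<in> neg0.W n 0"
  by (rule ugl.span_base, rule imageI) (simp add: words_def)

lemma W0_mult_left:
  assumes "u \<in> neg0.W (n - 1) 0" "x \<in> pos_roots"
  shows "e_neg x * u \<in> neg0.W n 0"
proof (cases n)
  case 0
  then have "u = 0" using assms(1) by (simp add: words_def)
  then show ?thesis by (simp add: ugl.span_zero)
next
  case (Suc k)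
  then show ?thesis using neg0.W_mult_left[of u k 0 x] assms by simp
qed

text \<open>Modulo the Verma ideal, t enters only through diagonal elements. Each factor
  \<open>e_neg (i, j)\<close> yields one of them, with slope \<open>mu $ i - mu $ j\<close>, and
  disappears from the word. Brackets with other factors give lowering operators, or raising
  operators acting on the remaining word, whose t-part has smaller PBW degree.\<close>

lemma raising_word:
  fixes w :: "('m::{finite,linorder} \<times> 'm) list"
  assumes "set w \<subseteq> pos_roots" "i < j"
  shows "\<exists>X\<in>neg_span. \<exists>Y. Y - scalar ((mu $ i - mu $ j) * of_nat (count (mset w) (i, j))) * word_prod e_neg (remove1 (i, j) w)
        \<in> neg0.W (length w - 1) 0 \<and>
      (\<forall>t. E i j * word_prod e_neg w - (X + scalar t * Y) \<in> verma_ideal (lam + t *s mu))"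
  using assms
proof (induction w arbitrary: i j)
  case Nil
  show ?case
    by (rule bexI[of _ 0], rule exI[of _ 0])
       (use verma_E_upper[OF Nil.prems(2), of 1] in \<open>simp_all add: ugl.span_zero\<close>)
next
  case (Cons \<gamma> w)
  obtain k l where \<gamma>: "\<gamma> = (k, l)" by (cases \<gamma>)
  then have kl: "k < l" "(k, l) \<in> pos_roots" and wp: "set w \<subseteq> pos_roots" using Cons.prems by (auto simp: pos_roots_def)
  let ?P = "word_prod e_neg" and ?n = "length w" and ?I = "\<lambda>t. verma_ideal (lam + t *s mu)" and ?e = "E l k"
  let ?r = "remove1 (i, j) w" and ?c = "(mu $ i - mu $ j) * of_nat (count (mset w) (i, j))"
  have e: "?e = e_neg (k, l)" by (simp add: e_neg_eq)
  have Pw: "?P w \<in> neg_span" by (rule ugl.span_base) (use wp in auto)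
  have e_span: "u \<in> neg_span \<Longrightarrow> ?e * u \<in> neg_span" for u
    unfolding e by (rule span_lists_mult[OF span_lists_letter[OF kl(2)]])
  \<comment> \<open>Such operators arise by bracketing with a different factor. That factor is
    already gone from w, and the t-part is shorter by one more letter, hence negligible.\<close>
  have upper: "\<exists>X\<in>neg_span. \<exists>Y\<in>neg0.W ?n 0. \<forall>t. E x y * ?P w - (X + scalar t * Y) \<in> ?I t" if xy: "x \<noteq> y" for x y
  proof (cases "x < y")
    case True
    let ?d = "(mu $ x - mu $ y) * of_nat (count (mset w) (x, y))"
    from Cons.IH[OF wp True] obtain X Y where X: "X \<in> neg_span"
      and Y: "Y - scalar ?d * ?P (remove1 (x, y) w) \<in> neg0.W (?n - 1) 0"
      and a: "\<forall>t. E x y * ?P w - (X + scalar t * Y) \<in> ?I t" by blast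
    have "scalar ?d * ?P (remove1 (x, y) w) \<in> neg0.W ?n 0"
    proof (cases "(x, y) \<in> set w")
      case True
      then have "length (remove1 (x, y) w) < ?n" "set (remove1 (x, y) w) \<subseteq> pos_roots"
        using wp length_pos_if_in_set[OF True] set_remove1_subset[of "(x, y)" w] by (auto simp: length_remove1)
      then show ?thesis by (intro ugl.span_scale W0_base)
    next
      case False
      then have "count (mset w) (x, y) = 0" by (simp add: count_eq_zero_iff)
      then show ?thesis by (simp only: of_nat_0 mult_zero_right scalar_0 mult_zero_left ugl.span_zero)
    qed
    moreover have "Y - scalar ?d * ?P (remove1 (x, y) w) \<in> neg0.W ?n 0"
      using Y neg0.W_mono[of "?n - 1" ?n 0] by auto
    ultimately have "(Y - scalar ?d * ?P (remove1 (x, y) w)) + scalar ?d * ?P (remove1 (x, y) w) \<in> neg0.W ?n 0"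
      by (intro ugl.span_add)
    then have "Y \<in> neg0.W ?n 0" by simp
    then show ?thesis using X a by blast
  next
    case False
    then have "(y, x) \<in> pos_roots" using xy by (auto simp: pos_roots_def)
    then have "e_neg (y, x) * ?P w \<in> neg_span" using Pw by (intro span_lists_mult[OF span_lists_letter])
    then show ?thesis
      by (intro bexI[of _ "e_neg (y, x) * ?P w"] bexI[of _ 0]) (simp_all add: e_neg_eq verma_0 ugl.span_zero)
  qed
  from Cons.IH[OF wp Cons.prems(2)] obtain X1 Y1 where X1: "X1 \<in> neg_span"
    and Y1: "Y1 - scalar ?c * ?P ?r \<in> neg0.W (?n - 1) 0"
    and a1: "\<forall>t. E i j * ?P w - (X1 + scalar t * Y1) \<in> ?I t" by blast
  have "?e * (Y1 - scalar ?c * ?P ?r) \<in> neg0.W ?n 0" unfolding e by (rule W0_mult_left[OF Y1 kl(2)])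
  then have eY1: "?e * Y1 - scalar ?c * ?P ((k, l) # ?r) \<in> neg0.W ?n 0"
    by (simp add: right_diff_distrib scalar_left_commute e)
  have comm: "E i j * ?e = ?e * E i j + ((if j = l then E i k else 0) - (if k = i then E l j else 0))"
    using E_commutator[of i j l k] by (simp add: algebra_simps)
  have expand: "E i j * ?P (\<gamma> # w) = ?e * (E i j * ?P w) + ((if j = l then E i k else 0) - (if k = i then E l j else 0)) * ?P w"
    by (simp add: \<gamma> e[symmetric] mult.assoc[symmetric] comm distrib_right)
  have combine: "E i j * ?P (\<gamma> # w) - ((?e * X1 + X2) + scalar t * (?e * Y1 + Y2)) \<in> ?I t"
    if "((if j = l then E i k else 0) - (if k = i then E l j else 0)) * ?P w - (X2 + scalar t * Y2) \<in> ?I t" for X2 Y2 t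
  proof -
    have "E i j * ?P (\<gamma> # w) - ((?e * X1 + X2) + scalar t * (?e * Y1 + Y2)) =
      ?e * (E i j * ?P w - (X1 + scalar t * Y1)) +
      (((if j = l then E i k else 0) - (if k = i then E l j else 0)) * ?P w - (X2 + scalar t * Y2))"
      unfolding expand by (simp only: right_diff_distrib distrib_left scalar_left_commute[of ?e]) (simp only: algebra_simps)
    then show ?thesis using that a1 by (simp only: verma_add verma_mult)
  qed
  show ?case
  proof (cases "\<gamma> = (i, j)")
    case True
    then have kl_ij: "k = i" "l = j" using \<gamma> by auto
    obtain \<beta> where \<beta>: "has_weight (?P w) \<beta>" using word_weight by blast
    \<comment> \<open>The weight \<beta> of the remaining word affects only the part without
      t.\<close>
    have diag: "E x x * ?P w - (scalar (\<beta> $ x + lam $ x) * ?P w + scalar t * (scalar (mu $ x) * ?P w)) \<in> ?I t" for x t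
    proof -
      have sc: "?P w * scalar c = scalar c * ?P w" for c by (rule scalar_commute[symmetric])
      have 1: "?P w * scalar ((lam + t *s mu) $ x) = scalar (lam $ x) * ?P w + scalar t * (scalar (mu $ x) * ?P w)"
        by (subst sc) (simp only: vector_add_component vector_smult_component scalar_add scalar_mult distrib_right mult.assoc)
      have 2: "E x x * ?P w = ?P w * E x x + scalar (\<beta> $ x) * ?P w"
        using has_weightD[OF \<beta>, of "mat_unit x x"] by (simp add: wt_mat_unit distrib_left sc)
      have "E x x * ?P w - (scalar (\<beta> $ x + lam $ x) * ?P w + scalar t * (scalar (mu $ x) * ?P w)) =
        ?P w * (E x x - scalar ((lam + t *s mu) $ x))"
        unfolding right_diff_distrib 1 2 scalar_add distrib_right by simp
      then show ?thesis by (simp only: verma_mult verma_E_diag)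
    qed
    define X2 where "X2 = scalar (\<beta> $ i + lam $ i) * ?P w - scalar (\<beta> $ j + lam $ j) * ?P w"
    define Y2 where "Y2 = scalar (mu $ i) * ?P w - scalar (mu $ j) * ?P w"
    have a2: "((if j = l then E i k else 0) - (if k = i then E l j else 0)) * ?P w - (X2 + scalar t * Y2) \<in> ?I t" for t
      using verma_diff[OF diag[of i t] diag[of j t]]
      by (simp add: kl_ij X2_def Y2_def left_diff_distrib right_diff_distrib algebra_simps)
    have X2: "X2 \<in> neg_span" unfolding X2_def by (intro ugl.span_diff ugl.span_scale Pw)
    \<comment> \<open>Putting (i, j) back in front of \<open>?r\<close> gives a permutation of w.
      So, modulo shorter words, the old occurrences and the new one add up to \<open>Suc\<close> of
      the count.\<close>
    have "scalar ?c * (?P ((i, j) # ?r) - ?P w) \<in> neg0.W ?n 0"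
    proof (cases "(i, j) \<in> set w")
      case True
      then have m: "mset ((i, j) # ?r) = mset w" by simp
      then have len: "length ((i, j) # ?r) = ?n" and "set ((i, j) # ?r) = set w"
        by (rule mset_eq_length, metis m set_mset_mset)
      then show ?thesis using neg0.reorder[OF m] wp by (intro ugl.span_scale) simp
    next
      case False
      then have "count (mset w) (i, j) = 0" by (simp add: count_eq_zero_iff)
      then show ?thesis by (simp only: of_nat_0 mult_zero_right scalar_0 mult_zero_left ugl.span_zero)
    qed
    from ugl.span_add[OF eY1 this[folded kl_ij]]
    have "(?e * Y1 + Y2) - scalar ((mu $ i - mu $ j) * of_nat (Suc (count (mset w) (i, j)))) * ?P w \<in> neg0.W ?n 0"
      by (simp add: kl_ij Y2_def scalar_add scalar_diff distrib_left distrib_right left_diff_distrib right_diff_distrib algebra_simps)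
    then have "(?e * Y1 + Y2) - scalar ((mu $ i - mu $ j) * of_nat (count (mset (\<gamma> # w)) (i, j))) * ?P (remove1 (i, j) (\<gamma> # w)) \<in> neg0.W (length (\<gamma> # w) - 1) 0"
      using True by simp
    then show ?thesis
      using combine[OF a2] ugl.span_add[OF e_span[OF X1] X2] by blast
  next
    case False
    have "\<exists>X2\<in>neg_span. \<exists>Y2\<in>neg0.W ?n 0. \<forall>t. ((if j = l then E i k else 0) - (if k = i then E l j else 0)) * ?P w - (X2 + scalar t * Y2) \<in> ?I t"
    proof -
      consider "j = l" "k \<noteq> i" | "j \<noteq> l" "k = i" | "j \<noteq> l" "k \<noteq> i" using False \<gamma> by blast
      then show ?thesis
      proof cases
        case 1
        then show ?thesis using upper[of i k] by simp
      next
        case 2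
        then obtain X Y where XY: "X \<in> neg_span" "Y \<in> neg0.W ?n 0" "\<forall>t. E l j * ?P w - (X + scalar t * Y) \<in> ?I t"
          using upper[of l j] by blast
        have "- 1 * (E l j * ?P w - (X + scalar t * Y)) \<in> ?I t" for t using XY(3) by (intro verma_mult) blast
        then have "(0 - E l j) * ?P w - (- X + scalar t * (- Y)) \<in> ?I t" for t by (simp add: algebra_simps)
        then show ?thesis using 2 XY ugl.span_neg by (intro bexI[of _ "- X"] bexI[of _ "- Y"]) auto
      next
        case 3
        then show ?thesis by (intro bexI[of _ 0]) (simp_all add: verma_0 ugl.span_zero)
      qed
    qed
    then obtain X2 Y2 where X2: "X2 \<in> neg_span" and Y2: "Y2 \<in> neg0.W ?n 0"
      and a2: "\<And>t. ((if j = l then E i k else 0) - (if k = i then E l j else 0)) * ?P w - (X2 + scalar t * Y2) \<in> ?I t" by blast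
    have "(?e * Y1 - scalar ?c * ?P ((k, l) # ?r)) + Y2 \<in> neg0.W ?n 0" by (rule ugl.span_add[OF eY1 Y2])
    then have "(?e * Y1 + Y2) - scalar ((mu $ i - mu $ j) * of_nat (count (mset (\<gamma> # w)) (i, j))) * ?P (remove1 (i, j) (\<gamma> # w)) \<in> neg0.W (length (\<gamma> # w) - 1) 0"
      using False by (simp add: \<gamma>[symmetric] add_diff_eq diff_add_eq)
    then show ?thesis
      using combine[OF a2] ugl.span_add[OF e_span[OF X1] X2] by blast
  qed
qed

lemma pbw_coeff_W0:
  assumes "u \<in> neg0.W (size M) 0"
  shows "pbw_coeff M u = 0"
  using assms
proof (induction rule: ugl.span_induct_alt)
  case (step c x y)
  from step.hyps(1) obtain w where w: "x = word_prod e_neg w" "w \<in> words pos_roots no_weight True (size M) 0"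
    by (rule imageE)
  then have "length w < size M" "x = word_prod (e_shift 0) w"
    by (simp_all add: words_def word_prod_e_shift_pos)
  then have "pbw_coeff M x = 0" using pbw_coeff_word[of w M 0] by auto
  then show ?case using step.IH by (simp add: pbw_coeff_add pbw_coeff_scale)
qed simp

text \<open>The top coefficient in \<open>t\<close> of the condition \<open>E i j * f(t) \<in> verma_ideal (lam + t mu)\<close>, and in it the terms
  of top PBW degree, only involve the removal of one factor \<open>e_neg (i, j)\<close>.\<close>

lemma singular_family_eq_0:
  fixes q :: "('m::{finite,linorder} \<times> 'm \<Rightarrow> nat) \<Rightarrow> complex poly"
  assumes rs: "distinct rs" "set rs = pos_roots" and A: "finite A" "\<And>\<pi> \<alpha>. \<pi> \<in> A \<Longrightarrow> \<alpha> \<notin> pos_roots \<Longrightarrow> \<pi> \<alpha> = 0"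
    and supp: "\<And>\<pi>. \<pi> \<in> A \<Longrightarrow> q \<pi> \<noteq> 0 \<Longrightarrow> \<exists>i j. i < j \<and> \<pi> (i, j) \<noteq> 0 \<and> mu $ i \<noteq> mu $ j"
    and sing: "\<And>t i j. i < j \<Longrightarrow>
      E i j * (\<Sum>\<pi>\<in>A. scalar (poly (q \<pi>) t) * word_prod e_neg (partition_word rs \<pi>)) \<in> verma_ideal (lam + t *s mu)"
    and \<pi>: "\<pi> \<in> A"
  shows "q \<pi> = 0"
proof (rule ccontr)
  assume q\<pi>: "q \<pi> \<noteq> 0"
  let ?w = "partition_word rs"
  have w_pos: "set (?w \<pi>) \<subseteq> pos_roots" for \<pi>
    unfolding rs(2)[symmetric] by (auto simp: partition_word_def)
  have count_w: "count (mset (?w \<pi>)) \<alpha> = \<pi> \<alpha>" if "\<pi> \<in> A" for \<pi> \<alpha>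
    using count_partition_word[OF rs(1)] A(2)[OF that] rs(2) by auto
  define D where "D = Max (degree ` (q ` A))"
  have D: "degree (q \<pi>) \<le> D" if "\<pi> \<in> A" for \<pi> unfolding D_def using A(1) that by simp
  have "D \<in> degree ` (q ` A)" unfolding D_def using A(1) \<pi> by (intro Max_in) auto
  then obtain \<pi>1 where \<pi>1: "\<pi>1 \<in> A" "degree (q \<pi>1) = D" by auto
  \<comment> \<open>The zero polynomial has degree 0, so for D = 0 the polynomial at \<pi>1 may
    vanish; the given \<open>q \<pi>\<close> is used instead.\<close>
  have "\<exists>\<pi>2\<in>A. coeff (q \<pi>2) D \<noteq> 0"
  proof (cases "D = 0")
    case True
    then have "coeff (q \<pi>) D \<noteq> 0" using q\<pi> D[OF \<pi>] by (metis le_zero_eq leading_coeff_0_iff)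
    then show ?thesis using \<pi> by blast
  next
    case False
    then have "q \<pi>1 \<noteq> 0" using \<pi>1 by auto
    then have "coeff (q \<pi>1) D \<noteq> 0" using \<pi>1 by (metis leading_coeff_0_iff)
    then show ?thesis using \<pi>1 by blast
  qed
  define c where "c \<pi> = coeff (q \<pi>) D" for \<pi>
  define B where "B = {\<pi> \<in> A. c \<pi> \<noteq> 0}"
  have B: "finite B" "B \<noteq> {}" using A(1) \<open>\<exists>\<pi>2\<in>A. coeff (q \<pi>2) D \<noteq> 0\<close> by (auto simp: B_def c_def)
  then have "Max ((\<lambda>\<pi>. length (?w \<pi>)) ` B) \<in> (\<lambda>\<pi>. length (?w \<pi>)) ` B" by simp
  then obtain \<sigma> where \<sigma>: "\<sigma> \<in> B" and mx: "length (?w \<sigma>) = Max ((\<lambda>\<pi>. length (?w \<pi>)) ` B)" by auto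
  have max: "length (?w \<tau>) \<le> length (?w \<sigma>)" if "\<tau> \<in> B" for \<tau>
    using that B(1) by (simp add: mx)
  have \<sigma>A: "\<sigma> \<in> A" "c \<sigma> \<noteq> 0" using \<sigma> by (auto simp: B_def)
  then have "q \<sigma> \<noteq> 0" by (auto simp: c_def)
  then obtain i j where ij: "i < j" "\<sigma> (i, j) \<noteq> 0" "mu $ i \<noteq> mu $ j" using supp \<sigma>A by blast
  let ?m = "mu $ i - mu $ j" and ?\<alpha> = "(i, j)"
  \<comment> \<open>The monomial of \<sigma> with one factor \<open>e_neg (i, j)\<close> removed is
    the top degree place at which the t-part of raising \<sigma> is visible.\<close>
  define M where "M = mset (?w \<sigma>) - {#(i, j)#}"
  have "?\<alpha> \<in># mset (?w \<sigma>)" using ij(2) count_w[OF \<sigma>A(1)] by (metis count_eq_zero_iff)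
  then have M: "add_mset ?\<alpha> M = mset (?w \<sigma>)" "size M = length (?w \<sigma>) - 1"
    by (simp_all add: M_def size_Diff_singleton)
  have "\<forall>\<pi>. \<exists>X Y. X \<in> neg_span \<and> Y - scalar (?m * of_nat (count (mset (?w \<pi>)) ?\<alpha>)) * word_prod e_neg (remove1 ?\<alpha> (?w \<pi>))
        \<in> neg0.W (length (?w \<pi>) - 1) 0 \<and>
      (\<forall>t. E i j * word_prod e_neg (?w \<pi>) - (X + scalar t * Y) \<in> verma_ideal (lam + t *s mu))"
    using raising_word[OF w_pos ij(1), of mu _ lam] by blast
  then obtain X Y where X: "\<And>\<pi>. X \<pi> \<in> neg_span"
    and Y: "\<And>\<pi>. Y \<pi> - scalar (?m * of_nat (count (mset (?w \<pi>)) ?\<alpha>)) * word_prod e_neg (remove1 ?\<alpha> (?w \<pi>))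
        \<in> neg0.W (length (?w \<pi>) - 1) 0"
    and XY: "\<And>\<pi> t. E i j * word_prod e_neg (?w \<pi>) - (X \<pi> + scalar t * Y \<pi>) \<in> verma_ideal (lam + t *s mu)"
    by metis
  have rem_pos: "set (remove1 ?\<alpha> (?w \<pi>)) \<subseteq> pos_roots" for \<pi>
    using w_pos set_remove1_subset by fastforce
  have Yspan: "Y \<pi> \<in> neg_span" for \<pi>
  proof -
    have "word_prod e_neg (remove1 ?\<alpha> (?w \<pi>)) \<in> neg_span"
      by (rule ugl.span_base) (use rem_pos in blast)
    from ugl.span_add[OF subsetD[OF W_neg_span Y[of \<pi>]] ugl.span_scale[OF this, of "?m * of_nat (count (mset (?w \<pi>)) ?\<alpha>)"]]
    show ?thesis by (rule back_subst[of "\<lambda>u. u \<in> neg_span"]) simp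
  qed
  \<comment> \<open>The raised vector lies in the Verma ideal and is congruent to this element of
    U(n^-), which therefore vanishes for every t.\<close>
  have zero: "(\<Sum>\<pi>\<in>A. scalar (poly (q \<pi>) t) * (X \<pi> + scalar t * Y \<pi>)) = 0" (is "?S = 0") for t
  proof (rule neg_span_verma_ideal)
    show "?S \<in> neg_span" by (intro ugl.span_sum ugl.span_scale ugl.span_add X Yspan)
    have "(\<Sum>\<pi>\<in>A. scalar (poly (q \<pi>) t) * (E i j * word_prod e_neg (?w \<pi>) - (X \<pi> + scalar t * Y \<pi>))) \<in> verma_ideal (lam + t *s mu)"
      by (intro verma_sum verma_mult XY)
    moreover have "(\<Sum>\<pi>\<in>A. scalar (poly (q \<pi>) t) * (E i j * word_prod e_neg (?w \<pi>) - (X \<pi> + scalar t * Y \<pi>))) =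
      E i j * (\<Sum>\<pi>\<in>A. scalar (poly (q \<pi>) t) * word_prod e_neg (?w \<pi>)) - ?S"
      by (simp only: sum_distrib_left scalar_left_commute right_diff_distrib sum_subtractf)
    ultimately have "E i j * (\<Sum>\<pi>\<in>A. scalar (poly (q \<pi>) t) * word_prod e_neg (?w \<pi>)) - ?S \<in> verma_ideal (lam + t *s mu)" by simp
    from verma_diff[OF sing[OF ij(1), of t] this] show "?S \<in> verma_ideal (lam + t *s mu)" by simp
  qed
  define R where "R = (\<Sum>\<pi>\<in>A. q \<pi> * [:pbw_coeff M (X \<pi>), pbw_coeff M (Y \<pi>):])"
  have "poly R t = 0" for t
  proof -
    have "poly R t = pbw_coeff M (\<Sum>\<pi>\<in>A. scalar (poly (q \<pi>) t) * (X \<pi> + scalar t * Y \<pi>))"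
      by (simp add: R_def poly_sum pbw_coeff_sum pbw_coeff_scale pbw_coeff_add algebra_simps)
    then show ?thesis by (simp add: zero)
  qed
  then have "R = 0" by (simp add: poly_all_0_iff_0[symmetric])
  then have "0 = coeff R (Suc D)" by simp
  \<comment> \<open>No \<open>q \<pi>\<close> reaches degree D + 1, so X drops out and only the top
    coefficients times Y remain.\<close>
  also have "\<dots> = (\<Sum>\<pi>\<in>A. c \<pi> * pbw_coeff M (Y \<pi>))"
    unfolding R_def coeff_sum
  proof (rule sum.cong)
    fix \<pi> assume "\<pi> \<in> A"
    then have "coeff (q \<pi>) (Suc D) = 0" using D by (intro coeff_eq_0) (simp add: le_imp_less_Suc)
    then show "coeff (q \<pi> * [:pbw_coeff M (X \<pi>), pbw_coeff M (Y \<pi>):]) (Suc D) = c \<pi> * pbw_coeff M (Y \<pi>)"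
      by (simp add: c_def coeff_pCons mult.commute)
  qed simp
  also have "\<dots> = (\<Sum>\<pi>\<in>A. if \<pi> = \<sigma> then c \<sigma> * (?m * of_nat (\<sigma> ?\<alpha>)) else 0)"
  proof (rule sum.cong)
    fix \<pi> assume \<pi>A: "\<pi> \<in> A"
    show "c \<pi> * pbw_coeff M (Y \<pi>) = (if \<pi> = \<sigma> then c \<sigma> * (?m * of_nat (\<sigma> ?\<alpha>)) else 0)"
    proof (cases "c \<pi> = 0")
      case True
      then show ?thesis using \<sigma>A by auto
    next
      case False
      then have le: "length (?w \<pi>) - 1 \<le> size M" using max[of \<pi>] \<pi>A M(2) by (simp add: B_def)
      let ?c = "?m * of_nat (count (mset (?w \<pi>)) ?\<alpha>)" and ?v = "remove1 ?\<alpha> (?w \<pi>)"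
      have "pbw_coeff M (Y \<pi> - scalar ?c * word_prod e_neg ?v) = 0"
        using Y[of \<pi>] neg0.W_mono[OF le] by (intro pbw_coeff_W0) blast
      then have "pbw_coeff M (Y \<pi>) = pbw_coeff M (scalar ?c * word_prod e_neg ?v)"
        using pbw_coeff_add[of M "Y \<pi> - scalar ?c * word_prod e_neg ?v" "scalar ?c * word_prod e_neg ?v"] by simp
      then have eq: "pbw_coeff M (Y \<pi>) = ?c * pbw_coeff M (word_prod e_neg ?v)"
        by (simp only: pbw_coeff_scale)
      have "?c * pbw_coeff M (word_prod e_neg ?v) = (if \<pi> = \<sigma> then ?m * of_nat (\<sigma> ?\<alpha>) else 0)"
      proof (cases "?\<alpha> \<in> set (?w \<pi>)")
        case True
        then have "length ?v \<le> size M" using le by (simp add: length_remove1)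
        then have "pbw_coeff M (word_prod e_neg ?v) = (if mset ?v = M then 1 else 0)"
          using pbw_coeff_word[of ?v M 0] rem_pos by (simp add: word_prod_e_shift_pos)
        moreover have "mset ?v = M \<longleftrightarrow> \<pi> = \<sigma>"
        proof
          assume "mset ?v = M"
          moreover have "add_mset ?\<alpha> (mset ?v) = mset (?w \<pi>)" using True by simp
          ultimately have "mset (?w \<pi>) = mset (?w \<sigma>)" by (simp only: M(1))
          then show "\<pi> = \<sigma>" using count_w[OF \<pi>A] count_w[OF \<sigma>A(1)] by (metis ext)
        qed (simp add: M_def)
        ultimately show ?thesis using count_w[OF \<pi>A] by simp
      next
        case False
        then have "count (mset (?w \<pi>)) ?\<alpha> = 0" by (simp add: count_eq_zero_iff)
        moreover from this have "\<pi> \<noteq> \<sigma>" using ij(2) count_w[OF \<pi>A, of ?\<alpha>] by auto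
        ultimately show ?thesis by simp
      qed
      then show ?thesis by (simp add: eq)
    qed
  qed simp
  also have "\<dots> = c \<sigma> * (?m * of_nat (\<sigma> ?\<alpha>))" using A(1) \<sigma>A(1) by simp
  finally show False using \<sigma>A(2) ij by simp
qed

lemma U_h_value_poly:
  assumes "H \<in> U_h"
  shows "\<exists>q. \<forall>t. H - scalar (poly q t) \<in> verma_ideal (lam + t *s mu)"
  using assms
proof (induction rule: subalg.induct)
  case (scalar c)
  show ?case by (rule exI[of _ "[:c:]"]) (simp add: verma_0)
next
  case (gen x)
  then obtain h where h: "x = emb h" "h \<in> cartan" by blast
  have "poly [:wt lam h, wt mu h:] t = wt (lam + t *s mu) h" for t
    by (simp add: wt_def distrib_right sum.distrib sum_distrib_left mult.assoc)
  then show ?case using verma_cartan[OF h(2)] unfolding h(1) by metis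
next
  case (add x y)
  then obtain q r where "\<forall>t. x - scalar (poly q t) \<in> verma_ideal (lam + t *s mu)"
    "\<forall>t. y - scalar (poly r t) \<in> verma_ideal (lam + t *s mu)" by blast
  then show ?case by (intro exI[of _ "q + r"]) (simp add: verma_value_add)
next
  case (mult x y)
  then obtain q r where "\<forall>t. x - scalar (poly q t) \<in> verma_ideal (lam + t *s mu)"
    "\<forall>t. y - scalar (poly r t) \<in> verma_ideal (lam + t *s mu)" by blast
  then show ?case by (intro exI[of _ "q * r"]) (simp add: verma_value_mult)
qed

text \<open>The rank separates all indices; giving b the rank of a makes \<eta> the only positive
  root orthogonal to the direction.\<close>

lemma generic_direction:
  fixes a b :: "'m::{finite,linorder}"
  assumes "a < b"
  obtains mu :: "'m weight" where "mu $ a = mu $ b" "\<And>i j. i < j \<Longrightarrow> (i, j) \<noteq> (a, b) \<Longrightarrow> mu $ i \<noteq> mu $ j"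
proof
  let ?r = "\<lambda>i :: 'm. card {..<i}"
  have r: "?r i = ?r j \<longleftrightarrow> i = j" for i j
  proof -
    have "?r i < ?r j" if "i < j" for i j by (rule psubset_card_mono) (use that in auto)
    then show ?thesis by (metis less_irrefl linorder_neqE)
  qed
  let ?mu = "(\<chi> i. if i = b then of_nat (?r a) else of_nat (?r i)) :: 'm weight"
  show "?mu $ a = ?mu $ b" by simp
  show "?mu $ i \<noteq> ?mu $ j" if "i < j" "(i, j) \<noteq> (a, b)" for i j
    using that assms r[of i j] r[of a j] r[of i a] by auto
qed

lemma partition_top_only:
  fixes a b :: "'m::{finite,linorder}"
  assumes "a < b" "\<pi> \<in> partitions (of_nat p *s root_vec (a, b))"
    and "\<And>\<alpha>. \<alpha> \<in> pos_roots \<Longrightarrow> \<alpha> \<noteq> (a, b) \<Longrightarrow> \<pi> \<alpha> = 0"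
  shows "\<pi> = (\<lambda>\<alpha>. if \<alpha> = (a, b) then p else 0)"
proof -
  have ab: "(a, b) \<in> pos_roots" using assms(1) by (simp add: pos_roots_def)
  have "(\<Sum>\<alpha>\<in>pos_roots. of_nat (\<pi> \<alpha>) *s root_vec \<alpha>) = (\<Sum>\<alpha>\<in>pos_roots. if \<alpha> = (a, b) then of_nat (\<pi> (a, b)) *s root_vec (a, b) else (0 :: 'm weight))"
    by (rule sum.cong) (use assms(3) in \<open>auto simp: vector_smult_lzero\<close>)
  also have "\<dots> = of_nat (\<pi> (a, b)) *s root_vec (a, b)" using ab by simp
  finally have "of_nat p *s root_vec (a, b) = of_nat (\<pi> (a, b)) *s (root_vec (a, b) :: 'm weight)"
    using assms(2) unfolding partitions_def by (metis (mono_tags, lifting) mem_Collect_eq)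
  then have "of_nat p * (root_vec (a, b) $ a) = of_nat (\<pi> (a, b)) * (root_vec (a, b) $ a :: complex)"
    by (metis vector_smult_component)
  moreover have "root_vec (a, b) $ a = 1" using less_imp_neq[OF assms(1)] by (simp add: root_vec_def eps_nth)
  ultimately have "\<pi> (a, b) = p" by simp
  moreover have "\<pi> \<alpha> = 0" if "\<alpha> \<noteq> (a, b)" for \<alpha>
    using assms(2,3) that unfolding partitions_def by blast
  ultimately show ?thesis by auto
qed

text \<open>The leading word of the power of \<Theta> serves as the witness.\<close>

lemma simple_partition_exists:
  fixes a b :: "'m::{finite,linorder}"
  assumes "a < b"
  obtains \<pi> where "\<pi> \<in> partitions (of_nat p *s root_vec (a, b))" "\<forall>\<alpha>. \<alpha> \<notin> simple_roots \<longrightarrow> \<pi> \<alpha> = 0"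
proof -
  obtain w where "set w \<subseteq> simple_roots" "sum_list (map root_vec w) = root_vec (a, b)"
    "Theta a b - word_prod e_neg w \<in> filt (length w) (root_vec (a, b))"
    using Theta_leading[OF less_imp_le[OF assms]] by blast
  from power_leading[OF this, of p] obtain v where v: "set v \<subseteq> simple_roots" "sum_list (map root_vec v) = of_nat p *s root_vec (a, b)" by blast
  show thesis
  proof
    show "count (mset v) \<in> partitions (of_nat p *s root_vec (a, b))"
      by (rule count_word_partitions[of _ "Suc (length v)"]) (use v simple_subset_pos in \<open>auto simp: words_def\<close>)
    show "\<forall>\<alpha>. \<alpha> \<notin> simple_roots \<longrightarrow> count (mset v) \<alpha> = 0" using v(1) by (auto simp: count_eq_zero_iff)
  qed
qed

text \<open>Each H_\<pi> takes polynomial values along the line. As \<open>mu $ a = mu $ b\<close>,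
  the line stays in the hyperplane, so the Cartan factor in the singularity condition lies in every
  Verma ideal on it, and the evaluated element is singular for all t.\<close>

lemma shapovalov_family:
  fixes a b :: "'m::{finite,linorder}"
  assumes ab: "a < b" and rs: "distinct rs" "set rs = pos_roots"
    and \<theta>: "shapovalov_element rs (a, b) p \<theta>"
    and lam: "form (lam + rho) (root_vec (a, b)) = of_nat p" and mu: "mu $ a = mu $ b"
    and \<pi>0: "\<pi>0 \<in> partitions (of_nat p *s root_vec (a, b))" "\<forall>\<alpha>. \<alpha> \<notin> simple_roots \<longrightarrow> \<pi>0 \<alpha> = 0"
  shows "\<exists>q. q \<pi>0 = 1 \<and>
    (\<forall>t i j. i < j \<longrightarrow> E i j * (\<Sum>\<pi>\<in>partitions (of_nat p *s root_vec (a, b)). scalar (poly (q \<pi>) t) * word_prod e_neg (partition_word rs \<pi>))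
      \<in> verma_ideal (lam + t *s mu)) \<and>
    eval_at lam \<theta> = (\<Sum>\<pi>\<in>partitions (of_nat p *s root_vec (a, b)). scalar (poly (q \<pi>) 0) * word_prod e_neg (partition_word rs \<pi>))"
proof -
  let ?A = "partitions (of_nat p *s root_vec (a, b)) :: ('m \<times> 'm \<Rightarrow> nat) set" and ?P = "\<lambda>\<pi>. word_prod e_neg (partition_word rs \<pi>)"
  let ?I = "\<lambda>t. verma_ideal (lam + t *s mu)" and ?z = "h_elt a b + 1 - of_nat p"
  from \<theta> obtain H where H: "\<And>\<pi>. \<pi> \<in> ?A \<Longrightarrow> H \<pi> \<in> U_h"
    and \<theta>_eq: "\<theta> = (\<Sum>\<pi>\<in>?A. e_neg_partition rs \<pi> * H \<pi>)" and H0: "H \<pi>0 = 1"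
    unfolding shapovalov_element_def using \<pi>0 by blast
  have sing: "\<exists>u. \<exists>v\<in>left_ideal_gen (emb ` n_plus). E i j * \<theta> = u * ?z + v" if "i < j" for i j
  proof -
    have "(i, j) \<in> pos_roots" using that by (simp add: pos_roots_def)
    with \<theta> have "\<exists>u. \<exists>v\<in>left_ideal_gen (emb ` n_plus). e_pos (i, j) * \<theta> = u * ?z + v"
      unfolding shapovalov_element_def shapovalov_factor_eq[OF less_imp_neq[OF ab], symmetric] by blast
    then show ?thesis by (simp add: e_pos_def)
  qed
  have "\<forall>\<pi>. \<exists>q. \<pi> \<in> ?A \<longrightarrow> (\<forall>t. H \<pi> - scalar (poly q t) \<in> ?I t)"
    using U_h_value_poly[OF H] by blast
  then obtain q where q: "\<And>\<pi> t. \<pi> \<in> ?A \<Longrightarrow> H \<pi> - scalar (poly (q \<pi>) t) \<in> ?I t" by metis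
  have q_\<pi>0: "q \<pi>0 = 1"
  proof -
    have "poly (q \<pi>0) t = poly 1 t" for t
      using verma_value_unique[OF q[OF \<pi>0(1), of t], of 1] by (simp add: H0 verma_0)
    then show ?thesis by (simp add: poly_eq_poly_eq_iff[symmetric] fun_eq_iff)
  qed
  have z: "?z \<in> ?I t" for t
  proof -
    let ?l = "lam + t *s mu"
    have "form rho (root_vec (a, b)) = of_nat p - (?l $ a - ?l $ b)"
      using lam mu by (simp add: form_root_vec algebra_simps)
    then have "?z = (E a a - scalar (?l $ a)) - (E b b - scalar (?l $ b))"
      by (simp add: h_elt_eq scalar_diff scalar_of_nat)
    then show ?thesis using verma_diff[OF verma_E_diag verma_E_diag] by metis
  qed
  have w: "\<theta> - (\<Sum>\<pi>\<in>?A. scalar (poly (q \<pi>) t) * ?P \<pi>) \<in> ?I t" for t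
  proof -
    have "\<theta> - (\<Sum>\<pi>\<in>?A. scalar (poly (q \<pi>) t) * ?P \<pi>) = (\<Sum>\<pi>\<in>?A. ?P \<pi> * (H \<pi> - scalar (poly (q \<pi>) t)))"
      by (simp add: \<theta>_eq word_prod_partition_word right_diff_distrib sum_subtractf scalar_commute)
    also have "\<dots> \<in> ?I t" by (intro verma_sum verma_mult q)
    finally show ?thesis .
  qed
  have "E i j * (\<Sum>\<pi>\<in>?A. scalar (poly (q \<pi>) t) * ?P \<pi>) \<in> ?I t" if ij: "i < j" for t i j
  proof -
    obtain u v where uv: "v \<in> left_ideal_gen (emb ` n_plus)" "E i j * \<theta> = u * ?z + v" using sing[OF ij] by blast
    have "u * ?z + v \<in> ?I t" by (intro verma_add verma_mult z verma_n_plus uv)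
    from verma_diff[OF this[folded uv(2)] verma_mult[OF w, of "E i j" t]]
    show ?thesis by (simp add: right_diff_distrib)
  qed
  moreover have "eval_at lam \<theta> = (\<Sum>\<pi>\<in>?A. scalar (poly (q \<pi>) 0) * ?P \<pi>)"
  proof -
    have "eval_at lam \<theta> = (\<Sum>\<pi>\<in>?A. ?P \<pi> * scalar (poly (q \<pi>) 0))"
    proof (rule eval_at_eq)
      show "\<theta> = (\<Sum>\<pi>\<in>?A. ?P \<pi> * H \<pi>)" by (simp add: \<theta>_eq word_prod_partition_word)
      show "?P \<pi> \<in> U_n_minus" for \<pi>
        by (rule word_U_n_minus) (auto simp: partition_word_def rs)
      show "H \<pi> - scalar (poly (q \<pi>) 0) \<in> verma_ideal lam" if "\<pi> \<in> ?A" for \<pi>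
        using q[OF that, of 0] by (simp add: vector_smult_lzero)
    qed (simp_all add: finite_partitions H)
    then show ?thesis by (simp add: scalar_commute)
  qed
  ultimately show ?thesis using q_\<pi>0 by blast
qed

text \<open>Singular families along a generic line in the hyperplane are determined by their coefficient at
  \<open>e_neg (a, b) ^ p\<close>; eliminating it from two Shapovalov families and looking at the coefficient \<open>1\<close> of
  \<open>\<pi>\<^sup>0\<close> shows that they agree.\<close>

lemma shapovalov_eval_unique:
  fixes a b :: "'m::{finite,linorder}"
  assumes ab: "a < b" and rs: "distinct rs" "set rs = pos_roots"
    and \<theta>: "shapovalov_element rs (a, b) p \<theta>" and \<theta>': "shapovalov_element rs (a, b) p \<theta>'"
    and lam: "form (lam + rho) (root_vec (a, b)) = of_nat p"
  shows "eval_at lam \<theta> = eval_at lam \<theta>'"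
proof -
  let ?A = "partitions (of_nat p *s root_vec (a, b)) :: ('m \<times> 'm \<Rightarrow> nat) set" and ?P = "\<lambda>\<pi>. word_prod e_neg (partition_word rs \<pi>)"
  obtain mu :: "'m weight" where mu: "mu $ a = mu $ b" "\<And>i j. i < j \<Longrightarrow> (i, j) \<noteq> (a, b) \<Longrightarrow> mu $ i \<noteq> mu $ j"
    using generic_direction[OF ab] by blast
  let ?I = "\<lambda>t. verma_ideal (lam + t *s mu)" and ?F = "\<lambda>q t. \<Sum>\<pi>\<in>?A. scalar (poly (q \<pi>) t) * ?P \<pi>"
  obtain \<pi>0 where \<pi>0: "\<pi>0 \<in> ?A" "\<forall>\<alpha>. \<alpha> \<notin> simple_roots \<longrightarrow> \<pi>0 \<alpha> = 0" using simple_partition_exists[OF ab] by blast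
  obtain q where q: "q \<pi>0 = 1" "\<And>t i j. i < j \<Longrightarrow> E i j * ?F q t \<in> ?I t" "eval_at lam \<theta> = ?F q 0"
    using shapovalov_family[OF ab rs \<theta> lam mu(1) \<pi>0] by blast
  obtain q' where q': "q' \<pi>0 = 1" "\<And>t i j. i < j \<Longrightarrow> E i j * ?F q' t \<in> ?I t" "eval_at lam \<theta>' = ?F q' 0"
    using shapovalov_family[OF ab rs \<theta>' lam mu(1) \<pi>0] by blast
  let ?\<pi>1 = "\<lambda>\<alpha>. if \<alpha> = (a, b) then p else 0"
  have vanish: "r \<pi> = 0" if r0: "r ?\<pi>1 = 0" and sing: "\<And>t i j. i < j \<Longrightarrow> E i j * ?F r t \<in> ?I t" and \<pi>: "\<pi> \<in> ?A" for r \<pi>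
  proof (rule singular_family_eq_0[OF rs finite_partitions _ _ sing \<pi>])
    show "\<sigma> \<alpha> = 0" if "\<sigma> \<in> ?A" "\<alpha> \<notin> pos_roots" for \<sigma> \<alpha> using that unfolding partitions_def by blast
    show "\<exists>i j. i < j \<and> \<sigma> (i, j) \<noteq> 0 \<and> mu $ i \<noteq> mu $ j" if \<sigma>: "\<sigma> \<in> ?A" "r \<sigma> \<noteq> 0" for \<sigma>
    proof -
      have "\<sigma> \<noteq> ?\<pi>1" using \<sigma>(2) r0 by blast
      then obtain \<alpha> where "\<alpha> \<in> pos_roots" "\<alpha> \<noteq> (a, b)" "\<sigma> \<alpha> \<noteq> 0" using partition_top_only[OF ab \<sigma>(1)] by blast
      then show ?thesis using mu(2) by (cases \<alpha>) (auto simp: pos_roots_def)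
    qed
  qed
  have F_scale: "?F (\<lambda>\<pi>. s * r \<pi>) t = scalar (poly s t) * ?F r t" for s r t
    by (simp only: poly_mult scalar_mult mult.assoc sum_distrib_left)
  have F_diff: "?F (\<lambda>\<pi>. r \<pi> - r' \<pi>) t = ?F r t - ?F r' t" for r r' t
    by (simp add: scalar_diff left_diff_distrib sum_subtractf)
  define d where "d \<pi> = q \<pi> - q' \<pi>" for \<pi>
  have d_sing: "E i j * ?F d t \<in> ?I t" if "i < j" for t i j
    unfolding d_def F_diff right_diff_distrib by (intro verma_diff q(2) q'(2) that)
  \<comment> \<open>The coefficients are polynomials in t, so the elimination is by
    cross-multiplication instead of division.\<close>
  have "q ?\<pi>1 * d \<pi>0 - d ?\<pi>1 * q \<pi>0 = 0"
  proof (rule vanish[where r = "\<lambda>\<pi>. q ?\<pi>1 * d \<pi> - d ?\<pi>1 * q \<pi>"])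
    show "E i j * ?F (\<lambda>\<pi>. q ?\<pi>1 * d \<pi> - d ?\<pi>1 * q \<pi>) t \<in> ?I t" if "i < j" for t i j
      unfolding F_diff[of "\<lambda>\<pi>. q ?\<pi>1 * d \<pi>"] F_scale right_diff_distrib scalar_left_commute
      by (intro verma_diff verma_mult d_sing q(2) that)
  qed (simp_all add: \<pi>0 mult.commute)
  then have "d ?\<pi>1 = 0" by (simp add: d_def q(1) q'(1))
  then have "d \<pi> = 0" if "\<pi> \<in> ?A" for \<pi> using vanish[of d] d_sing that by blast
  then have "q \<pi> = q' \<pi>" if "\<pi> \<in> ?A" for \<pi> using that by (simp add: d_def)
  then show ?thesis unfolding q(3) q'(3) by (intro sum.cong) auto
qed

theorem proposition5p2:
  fixes a b :: "'m::{finite,linorder}"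
    and p :: nat
    and rs :: "('m \<times> 'm) list"
  assumes "a < b"
    and "p \<ge> 1"
    and "distinct rs" and "set rs = pos_roots"
  shows "shapovalov_element rs (a, b) p (Theta a b ^ p) \<and>
    (\<forall>\<theta>. shapovalov_element rs (a, b) p \<theta> \<longrightarrow>
      (\<forall>lam. form (lam + rho) (root_vec (a, b)) = of_nat p \<longrightarrow>
        eval_at lam (Theta a b ^ p) = eval_at lam \<theta>))"
  using shapovalov_Theta_power[OF assms(1,3,4)] shapovalov_eval_unique[OF assms(1,3,4)] by blast

end
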